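(* Let $(M,\mu,d)$, $(\mathcal{E},\mathcal{F})$, $(X_t)$ be as in the context. If the elliptic Harnack inequality holds on $M$, then there are constants $q>0$ and $b,C>0$ such that, with $\nu(x,t,R)$ defined using this $q$, for all $x,y\in M$, $t>0$ and $r>0$ with $\frac14 d(x,y)\le r<d(x,y)$, $$\mathbb{P}_x\left(\tau_{y,r}<t\right)\ge \exp\left(-C\,\nu\left(x,t,b\,d(x,y)\right)\right).$$
   Context: Standing assumptions: $(M,\mu,d)$ is a locally compact separable metric measure space with a Radon measure $\mu$ of full support, and the metric $d$ is geodesic. $(\mathcal{E},\mathcal{F})$ is a strictly local (i.e. strongly local) regular Dirichlet form in $L^2(M,\mu)$, and $(X_t)$ is the associated diffusion process on $M$, with Feller semigroup $P_t$. $\mathbb{P}_x,\mathbb{E}_x$ denote probability and expectation given $X_0=x$. The process has a transition density $p_t(x,y)$ with respect to $\mu$ satisfying: $p_t(x,y)\ge 0$; $\int_M p_t(x,y)\,d\mu(y)=1$; $p_t(x,y)=p_t(y,x)$; $p_t(x,y)=\int_M p_s(x,z)p_{t-s}(z,y)\,d\mu(z)$ for $0<s<t$. Notation: $B(x,R)=\{y\in M:d(x,y)<R\}$. The exit time from $A\subset M$ is $T_A=\inf\{t>0:X_t\in A^c\}$, and $E(x,R)=\mathbb{E}_x[T_{B(x,R)}]$. The hitting time of $A$ is $\tau_A=T_{A^c}=\inf\{t>0:X_t\in A\}$, and $\tau_{y,r}=\tau_{B(y,r)}$. For a constant $q>0$, $A\subset M$ and $t,R>0$, $\nu_A(t,R)$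 is the smallest positive integer $\nu$ for which $\frac{t}{\nu}\ge q\sup_{z\in A}E\left(z,\frac{R}{\nu}\right)$, and $\nu_A(t,R)=\infty$ if there is no such integer; $\nu(x,t,R)=\nu_{B(x,R)}(t,R)$. Convention: $\exp(-\infty)=0$. A function $h:M\to\mathbb{R}$ is harmonic on an open set $A\subset M$ if it is defined on $\overline{A}$ and $h(x)=\mathbb{E}_x\left(h(X_{T_A})\right)$ for all $x\in A$. The elliptic Harnack inequality holds on $M$ if there is a constant $H\ge 1$ such that for all $x\in M$, $R>0$ and every non-negative function $u$ harmonic in $B(x,2R)$, $\sup_{B(x,R)}u\le H\inf_{B(x,R)}u$. *)

theory Defs
  imports "HOL-Probability.Probability"
begin

section \<open>Metric measure spaces\<close>

text \<open>The space \<open>M\<close> is the universe of a type of class \<^class>\<open>metric_space\<close>. Separability is imposed by the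
  class \<^class>\<open>second_countable_topology\<close>, to which it is equivalent for metric spaces, and local
  compactness is written \<open>locally compact UNIV\<close>.\<close>

definition geodesic_metric :: "'a::metric_space itself \<Rightarrow> bool" where
  "geodesic_metric _ \<longleftrightarrow>
     (\<forall>x y :: 'a. \<exists>\<gamma>. \<gamma> 0 = x \<and> \<gamma> (dist x y) = y \<and>
        (\<forall>s\<in>{0..dist x y}. \<forall>t\<in>{0..dist x y}. dist (\<gamma> s) (\<gamma> t) = \<bar>s - t\<bar>))"

definition radon_measure :: "'a::topological_space measure \<Rightarrow> bool" where
  "radon_measure \<mu> \<longleftrightarrow> sets \<mu> = sets borel \<and>
     (\<forall>K. compact K \<longrightarrow> emeasure \<mu> K < \<infinity>) \<and>
     (\<forall>A\<in>sets borel. emeasure \<mu> A = (INF U\<in>{U. open U \<and> A \<subseteq> U}. emeasure \<mu> U)) \<and>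
     (\<forall>U. open U \<longrightarrow> emeasure \<mu> U = (SUP K\<in>{K. compact K \<and> K \<subseteq> U}. emeasure \<mu> K))"

definition full_support :: "'a::topological_space measure \<Rightarrow> bool" where
  "full_support \<mu> \<longleftrightarrow> (\<forall>U. open U \<longrightarrow> U \<noteq> {} \<longrightarrow> 0 < emeasure \<mu> U)"


section \<open>Dirichlet forms\<close>

text \<open>Elements of \<open>L\<^sup>2(M,\<mu>)\<close> are handled through representatives: a form domain is a set of square
  integrable functions saturated under almost everywhere equality, and a form does not
  distinguish almost everywhere equal functions.\<close>

definition L2 :: "'a measure \<Rightarrow> ('a \<Rightarrow> real) set" where
  "L2 \<mu> = {f \<in> borel_measurable \<mu>. integrable \<mu> (\<lambda>x. (f x)\<^sup>2)}"

definition l2_inner :: "'a measure \<Rightarrow> ('a \<Rightarrow> real) \<Rightarrow> ('a \<Rightarrow> real) \<Rightarrow> real" where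
  "l2_inner \<mu> f g = (\<integral>x. f x * g x \<partial>\<mu>)"

definition l2_norm :: "'a measure \<Rightarrow> ('a \<Rightarrow> real) \<Rightarrow> real" where
  "l2_norm \<mu> f = sqrt (l2_inner \<mu> f f)"

definition form_norm ::
  "'a measure \<Rightarrow> (('a \<Rightarrow> real) \<Rightarrow> ('a \<Rightarrow> real) \<Rightarrow> real) \<Rightarrow> ('a \<Rightarrow> real) \<Rightarrow> real" where
  "form_norm \<mu> \<E> f = sqrt (\<E> f f + l2_inner \<mu> f f)"

definition symmetric_form ::
  "'a measure \<Rightarrow> ('a \<Rightarrow> real) set \<Rightarrow> (('a \<Rightarrow> real) \<Rightarrow> ('a \<Rightarrow> real) \<Rightarrow> real) \<Rightarrow> bool" where
  "symmetric_form \<mu> \<F> \<E> \<longleftrightarrow>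
     \<F> \<subseteq> L2 \<mu> \<and>
     (\<lambda>_. 0) \<in> \<F> \<and>
     (\<forall>f\<in>\<F>. \<forall>g\<in>\<F>. (\<lambda>x. f x + g x) \<in> \<F>) \<and>
     (\<forall>f\<in>\<F>. \<forall>c. (\<lambda>x. c * f x) \<in> \<F>) \<and>
     (\<forall>f\<in>\<F>. \<forall>g\<in>borel_measurable \<mu>. (AE x in \<mu>. f x = g x) \<longrightarrow>
        g \<in> \<F> \<and> (\<forall>h\<in>\<F>. \<E> f h = \<E> g h)) \<and>
     (\<forall>f\<in>\<F>. \<forall>g\<in>\<F>. \<E> f g = \<E> g f) \<and>
     (\<forall>f\<in>\<F>. \<forall>g\<in>\<F>. \<forall>h\<in>\<F>. \<E> (\<lambda>x. f x + g x) h = \<E> f h + \<E> g h) \<and>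
     (\<forall>f\<in>\<F>. \<forall>h\<in>\<F>. \<forall>c. \<E> (\<lambda>x. c * f x) h = c * \<E> f h) \<and>
     (\<forall>f\<in>\<F>. 0 \<le> \<E> f f)"

definition closed_form ::
  "'a measure \<Rightarrow> ('a \<Rightarrow> real) set \<Rightarrow> (('a \<Rightarrow> real) \<Rightarrow> ('a \<Rightarrow> real) \<Rightarrow> real) \<Rightarrow> bool" where
  "closed_form \<mu> \<F> \<E> \<longleftrightarrow>
     (\<forall>u :: nat \<Rightarrow> 'a \<Rightarrow> real.
        range u \<subseteq> \<F> \<longrightarrow>
        (\<forall>e>0. \<exists>n0. \<forall>m\<ge>n0. \<forall>n\<ge>n0. form_norm \<mu> \<E> (\<lambda>x. u m x - u n x) < e) \<longrightarrow>
        (\<exists>f\<in>\<F>. (\<lambda>n. form_norm \<mu> \<E> (\<lambda>x. u n x - f x)) \<longlonglongrightarrow> 0))"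

definition dirichlet_form ::
  "'a measure \<Rightarrow> ('a \<Rightarrow> real) set \<Rightarrow> (('a \<Rightarrow> real) \<Rightarrow> ('a \<Rightarrow> real) \<Rightarrow> real) \<Rightarrow> bool" where
  "dirichlet_form \<mu> \<F> \<E> \<longleftrightarrow>
     symmetric_form \<mu> \<F> \<E> \<and>
     (\<forall>f\<in>L2 \<mu>. \<forall>e>0. \<exists>g\<in>\<F>. l2_norm \<mu> (\<lambda>x. f x - g x) < e) \<and>
     closed_form \<mu> \<F> \<E> \<and>
     (\<forall>f\<in>\<F>. let g = (\<lambda>x. min (max (f x) 0) 1) in g \<in> \<F> \<and> \<E> g g \<le> \<E> f f)"

definition Cc :: "('a::topological_space \<Rightarrow> real) set" where
  "Cc = {f. continuous_on UNIV f \<and> compact (closure {x. f x \<noteq> 0})}"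

definition regular_form ::
  "'a::topological_space measure \<Rightarrow> ('a \<Rightarrow> real) set \<Rightarrow>
     (('a \<Rightarrow> real) \<Rightarrow> ('a \<Rightarrow> real) \<Rightarrow> real) \<Rightarrow> bool" where
  "regular_form \<mu> \<F> \<E> \<longleftrightarrow>
     (\<forall>f\<in>\<F>. \<forall>e>0. \<exists>g\<in>\<F> \<inter> Cc. form_norm \<mu> \<E> (\<lambda>x. f x - g x) < e) \<and>
     (\<forall>f\<in>Cc. \<forall>e>0. \<exists>g\<in>\<F> \<inter> Cc. \<forall>x. \<bar>f x - g x\<bar> < e)"

definition ess_support :: "'a::topological_space measure \<Rightarrow> ('a \<Rightarrow> real) \<Rightarrow> 'a set" where
  "ess_support \<mu> f = - \<Union>{U. open U \<and> (AE x in \<mu>. x \<in> U \<longrightarrow> f x = 0)}"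

definition strongly_local ::
  "'a::topological_space measure \<Rightarrow> ('a \<Rightarrow> real) set \<Rightarrow>
     (('a \<Rightarrow> real) \<Rightarrow> ('a \<Rightarrow> real) \<Rightarrow> real) \<Rightarrow> bool" where
  "strongly_local \<mu> \<F> \<E> \<longleftrightarrow>
     (\<forall>f\<in>\<F>. \<forall>g\<in>\<F>. compact (ess_support \<mu> f) \<longrightarrow> compact (ess_support \<mu> g) \<longrightarrow>
        (\<exists>U c. open U \<and> ess_support \<mu> g \<subseteq> U \<and> (AE x in \<mu>. x \<in> U \<longrightarrow> f x = c)) \<longrightarrow>
        \<E> f g = 0)"


section \<open>Diffusions\<close>

text \<open>A process is a family \<open>X\<close> of maps on a measurable space \<open>N\<close>, indexed by the times
  \<open>t \<ge> 0\<close> (the values at negative times are irrelevant), with a law \<open>P x\<close> on \<open>N\<close> for every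
  starting point \<open>x\<close>. There is no cemetery point: the processes considered are conservative. The
  filtrations are indexed by \<^typ>\<open>ennreal\<close>, so that stopping times may be infinite.\<close>

definition natural_filtration ::
  "'w measure \<Rightarrow> (real \<Rightarrow> 'w \<Rightarrow> 'a::topological_space) \<Rightarrow> ennreal \<Rightarrow> 'w measure" where
  "natural_filtration N X t =
     sigma (space N) {X s -` B \<inter> space N | s B. 0 \<le> s \<and> ennreal s \<le> t \<and> B \<in> sets borel}"

text \<open>The intersection with the terminal \<open>\<sigma>\<close>-algebra only matters for \<open>t = \<infinity>\<close>.\<close>

definition right_filtration ::
  "'w measure \<Rightarrow> (real \<Rightarrow> 'w \<Rightarrow> 'a::topological_space) \<Rightarrow> ennreal \<Rightarrow> 'w measure" where
  "right_filtration N X t =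
     sigma (space N) (sets (natural_filtration N X \<infinity>) \<inter>
       (\<Inter>u\<in>{t<..}. sets (natural_filtration N X u)))"

lemma filtration_right_filtration: "filtration (space N) (right_filtration N X)"
proof
  have sub: "sets (natural_filtration N X \<infinity>) \<subseteq> Pow (space N)"
    using sets.space_closed[of "natural_filtration N X \<infinity>"]
    by (simp add: natural_filtration_def space_measure_of_conv)
  fix i j :: ennreal
  show "space (right_filtration N X i) = space N"
    by (simp add: right_filtration_def space_measure_of_conv)
  assume "i \<le> j"
  then show "sets (right_filtration N X i) \<subseteq> sets (right_filtration N X j)"
    unfolding right_filtration_def
    by (subst (1 2) sets_measure_of; (intro sigma_sets_mono')?; use sub in force)
qed

definition strong_markov ::
  "'w measure \<Rightarrow> ('a::topological_space \<Rightarrow> 'w measure) \<Rightarrow> (real \<Rightarrow> 'w \<Rightarrow> 'a) \<Rightarrow> bool" where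
  "strong_markov N P X \<longleftrightarrow>
     (\<forall>x T. stopping_time (right_filtration N X) T \<longrightarrow>
        (\<forall>A\<in>sets (filtration.pre_sigma (space N) (right_filtration N X) T).
         \<forall>s\<ge>0. \<forall>B\<in>sets borel.
           emeasure (P x) {\<omega>\<in>A. T \<omega> < \<infinity> \<and> X (enn2real (T \<omega>) + s) \<omega> \<in> B} =
           (\<integral>\<^sup>+\<omega>\<in>{\<omega>\<in>A. T \<omega> < \<infinity>}.
              emeasure (P (X (enn2real (T \<omega>)) \<omega>)) {\<omega>'\<in>space N. X s \<omega>' \<in> B} \<partial>P x)))"

definition diffusion ::
  "'w measure \<Rightarrow> ('a::topological_space \<Rightarrow> 'w measure) \<Rightarrow> (real \<Rightarrow> 'w \<Rightarrow> 'a) \<Rightarrow> bool" where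
  "diffusion N P X \<longleftrightarrow>
     (\<forall>x. prob_space (P x) \<and> sets (P x) = sets N) \<and>
     (\<forall>t\<ge>0. X t \<in> N \<rightarrow>\<^sub>M borel) \<and>
     (\<forall>t\<ge>0. \<forall>B\<in>sets borel. (\<lambda>x. emeasure (P x) {\<omega>\<in>space N. X t \<omega> \<in> B}) \<in> borel_measurable borel) \<and>
     (\<forall>x. AE \<omega> in P x. X 0 \<omega> = x) \<and>
     (\<forall>\<omega>\<in>space N. continuous_on {0..} (\<lambda>t. X t \<omega>)) \<and>
     strong_markov N P X"

definition trans_op ::
  "('a \<Rightarrow> 'w measure) \<Rightarrow> (real \<Rightarrow> 'w \<Rightarrow> 'a) \<Rightarrow> real \<Rightarrow> ('a \<Rightarrow> real) \<Rightarrow> 'a \<Rightarrow> real" where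
  "trans_op P X t f x = (\<integral>\<omega>. f (X t \<omega>) \<partial>P x)"

definition C0 :: "('a::topological_space \<Rightarrow> real) set" where
  "C0 = {f. continuous_on UNIV f \<and> (\<forall>e>0. compact {x. e \<le> \<bar>f x\<bar>})}"

definition feller_process ::
  "('a::topological_space \<Rightarrow> 'w measure) \<Rightarrow> (real \<Rightarrow> 'w \<Rightarrow> 'a) \<Rightarrow> bool" where
  "feller_process P X \<longleftrightarrow>
     (\<forall>f\<in>C0. (\<forall>t\<ge>0. trans_op P X t f \<in> C0) \<and>
        uniform_limit UNIV (\<lambda>t. trans_op P X t f) f (at_right 0))"

text \<open>Both operators are the positive generator \<open>L\<close>, that is, \<open>P\<^sub>t = exp (- t L)\<close>. They are given
  by their graphs on representatives.\<close>

definition form_generator ::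
  "'a measure \<Rightarrow> ('a \<Rightarrow> real) set \<Rightarrow> (('a \<Rightarrow> real) \<Rightarrow> ('a \<Rightarrow> real) \<Rightarrow> real) \<Rightarrow>
     (('a \<Rightarrow> real) \<times> ('a \<Rightarrow> real)) set" where
  "form_generator \<mu> \<F> \<E> =
     {(f, h). f \<in> \<F> \<and> h \<in> L2 \<mu> \<and> (\<forall>g\<in>\<F>. \<E> f g = l2_inner \<mu> h g)}"

definition semigroup_generator ::
  "'a measure \<Rightarrow> (real \<Rightarrow> ('a \<Rightarrow> real) \<Rightarrow> 'a \<Rightarrow> real) \<Rightarrow>
     (('a \<Rightarrow> real) \<times> ('a \<Rightarrow> real)) set" where
  "semigroup_generator \<mu> S =
     {(f, h). f \<in> L2 \<mu> \<and> h \<in> L2 \<mu> \<and>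
        ((\<lambda>t. l2_norm \<mu> (\<lambda>x. (f x - S t f x) / t - h x)) \<longlongrightarrow> 0) (at_right 0)}"

definition l2_semigroup ::
  "'a measure \<Rightarrow> (real \<Rightarrow> ('a \<Rightarrow> real) \<Rightarrow> 'a \<Rightarrow> real) \<Rightarrow> bool" where
  "l2_semigroup \<mu> S \<longleftrightarrow>
     (\<forall>t>0. \<forall>f\<in>L2 \<mu>. S t f \<in> L2 \<mu> \<and> l2_norm \<mu> (S t f) \<le> l2_norm \<mu> f) \<and>
     (\<forall>s>0. \<forall>t>0. \<forall>f\<in>L2 \<mu>. AE x in \<mu>. S (s + t) f x = S s (S t f) x) \<and>
     (\<forall>f\<in>L2 \<mu>. ((\<lambda>t. l2_norm \<mu> (\<lambda>x. S t f x - f x)) \<longlongrightarrow> 0) (at_right 0))"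

definition associated_process ::
  "'a measure \<Rightarrow> ('a \<Rightarrow> real) set \<Rightarrow> (('a \<Rightarrow> real) \<Rightarrow> ('a \<Rightarrow> real) \<Rightarrow> real) \<Rightarrow>
     ('a \<Rightarrow> 'w measure) \<Rightarrow> (real \<Rightarrow> 'w \<Rightarrow> 'a) \<Rightarrow> bool" where
  "associated_process \<mu> \<F> \<E> P X \<longleftrightarrow>
     l2_semigroup \<mu> (trans_op P X) \<and>
     semigroup_generator \<mu> (trans_op P X) = form_generator \<mu> \<F> \<E>"

definition transition_density ::
  "'a::topological_space measure \<Rightarrow> ('a \<Rightarrow> 'w measure) \<Rightarrow> (real \<Rightarrow> 'w \<Rightarrow> 'a) \<Rightarrow>
     (real \<Rightarrow> 'a \<Rightarrow> 'a \<Rightarrow> real) \<Rightarrow> bool" where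
  "transition_density \<mu> P X p \<longleftrightarrow>
     (\<forall>t>0. (\<lambda>(x, y). p t x y) \<in> borel_measurable (borel \<Otimes>\<^sub>M borel)) \<and>
     (\<forall>t>0. \<forall>x. distr (P x) borel (X t) = density \<mu> (\<lambda>y. ennreal (p t x y))) \<and>
     (\<forall>t>0. \<forall>x y. 0 \<le> p t x y) \<and>
     (\<forall>t>0. \<forall>x. (\<integral>\<^sup>+y. ennreal (p t x y) \<partial>\<mu>) = 1) \<and>
     (\<forall>t>0. \<forall>x y. p t x y = p t y x) \<and>
     (\<forall>s t. 0 < s \<longrightarrow> s < t \<longrightarrow>
        (\<forall>x y. ennreal (p t x y) = (\<integral>\<^sup>+z. ennreal (p s x z * p (t - s) z y) \<partial>\<mu>)))"


section \<open>Exit times and the elliptic Harnack inequality\<close>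

text \<open>\<^term>\<open>Inf {} = (\<infinity>::ennreal)\<close> gives the value of the times for paths that never hit.\<close>

definition hitting_time :: "(real \<Rightarrow> 'w \<Rightarrow> 'a) \<Rightarrow> 'a set \<Rightarrow> 'w \<Rightarrow> ennreal" where
  "hitting_time X A \<omega> = (INF t\<in>{t. 0 < t \<and> X t \<omega> \<in> A}. ennreal t)"

definition exit_time :: "(real \<Rightarrow> 'w \<Rightarrow> 'a) \<Rightarrow> 'a set \<Rightarrow> 'w \<Rightarrow> ennreal" where
  "exit_time X A = hitting_time X (- A)"

definition mean_exit_time ::
  "('a::metric_space \<Rightarrow> 'w measure) \<Rightarrow> (real \<Rightarrow> 'w \<Rightarrow> 'a) \<Rightarrow> 'a \<Rightarrow> real \<Rightarrow> ennreal" where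
  "mean_exit_time P X x R = (\<integral>\<^sup>+\<omega>. exit_time X (ball x R) \<omega> \<partial>P x)"

text \<open>\<open>\<nu>\<^sub>A(t,R)\<close>; again the infimum of the empty set is \<open>\<infinity>\<close>.\<close>

definition nu_set ::
  "('a::metric_space \<Rightarrow> 'w measure) \<Rightarrow> (real \<Rightarrow> 'w \<Rightarrow> 'a) \<Rightarrow> real \<Rightarrow> 'a set \<Rightarrow>
     real \<Rightarrow> real \<Rightarrow> enat" where
  "nu_set P X q A t R =
     (INF n\<in>{n::nat. 1 \<le> n \<and>
         ennreal q * (SUP z\<in>A. mean_exit_time P X z (R / real n)) \<le> ennreal (t / real n)}. enat n)"

definition nu ::
  "('a::metric_space \<Rightarrow> 'w measure) \<Rightarrow> (real \<Rightarrow> 'w \<Rightarrow> 'a) \<Rightarrow> real \<Rightarrow> 'a \<Rightarrow>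
     real \<Rightarrow> real \<Rightarrow> enat" where
  "nu P X q x t R = nu_set P X q (ball x R) t R"

text \<open>\<open>exp (- C n)\<close> with the convention \<open>exp (- \<infinity>) = 0\<close>.\<close>

definition exp_neg :: "real \<Rightarrow> enat \<Rightarrow> real" where
  "exp_neg C n = (case n of enat k \<Rightarrow> exp (- C * real k) | \<infinity> \<Rightarrow> 0)"

text \<open>Paths that never leave \<open>A\<close> contribute \<open>0\<close>, which is the usual convention \<open>h(X\<^sub>\<infinity>) = 0\<close>. By
  path continuity only the values of \<open>h\<close> on the closure of \<open>A\<close> enter.\<close>

definition exit_value ::
  "(real \<Rightarrow> 'w \<Rightarrow> 'a) \<Rightarrow> 'a set \<Rightarrow> ('a \<Rightarrow> real) \<Rightarrow> 'w \<Rightarrow> real" where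
  "exit_value X A h \<omega> =
     (if exit_time X A \<omega> < \<infinity> then h (X (enn2real (exit_time X A \<omega>)) \<omega>) else 0)"

definition harmonic_in ::
  "('a::topological_space \<Rightarrow> 'w measure) \<Rightarrow> (real \<Rightarrow> 'w \<Rightarrow> 'a) \<Rightarrow> 'a set \<Rightarrow> ('a \<Rightarrow> real) \<Rightarrow> bool" where
  "harmonic_in P X A h \<longleftrightarrow> h \<in> borel_measurable borel \<and>
     (\<forall>x\<in>A. integrable (P x) (exit_value X A h) \<and> h x = (\<integral>\<omega>. exit_value X A h \<omega> \<partial>P x))"

definition elliptic_harnack ::
  "('a::metric_space \<Rightarrow> 'w measure) \<Rightarrow> (real \<Rightarrow> 'w \<Rightarrow> 'a) \<Rightarrow> bool" where
  "elliptic_harnack P X \<longleftrightarrow>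
     (\<exists>H::real. 1 \<le> H \<and> (\<forall>x R u. 0 < R \<longrightarrow> (\<forall>z. 0 \<le> u z) \<longrightarrow> harmonic_in P X (ball x (2 * R)) u \<longrightarrow>
        (SUP z\<in>ball x R. ennreal (u z)) \<le> ennreal H * (INF z\<in>ball x R. ennreal (u z))))"

end

theory Submission
  imports Defs
begin

text \<open>Kill the process on leaving \<open>F = cball y (3 r)\<close>, and let \<open>G f z\<close> be the expected occupation of
  a bump function \<open>f\<close> before that time, starting from \<open>z\<close>. Away from the support of \<open>f\<close> the function
  \<open>G f\<close> is harmonic, and symmetry of the transition density gives \<open>\<integral> g G f = \<integral> f G g\<close>. With the elliptic
  Harnack inequality this makes the values of \<open>G f\<close>, for \<open>f\<close> concentrated near \<open>y\<close>, comparable at all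
  points of the sphere of radius \<open>r\<close> about \<open>y\<close>. By the strong Markov property, \<open>G f x\<close> is at most the
  supremum of \<open>G f\<close> over that sphere times the probability to hit \<open>ball y r\<close> before leaving \<open>F\<close>, so
  this probability is bounded below by a constant when \<open>r \<le> dist x y \<le> 2 r\<close>. Markov's inequality for
  the exit time turns this into a bound for hitting within time \<open>t/(4\<nu>)\<close>, and \<open>4\<nu>\<close> such steps along
  a geodesic from \<open>x\<close> to \<open>y\<close> give the claim.\<close>

section \<open>Filtrations and stopping times\<close>

text \<open>G is used only as an operator on bump functions: symmetry is tested by integrating one
  bump against the potential of another, so no Green kernel has to be constructed. The hitting bound
  comes from dividing by the supremum of G f over the sphere, which must be finite and nonzero.
  Finiteness rests on mean exit times, which a finite \<nu> controls at all centres involved.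
  Positivity is not a matter of Harnack: it uses symmetry once more, and the fact that paths from
  near y must cross the shell around \<open>ball y r\<close>. The strong Markov property is given
  for one position at a fixed delay after a stopping time, whereas occupation depends on the whole
  path. It is therefore extended first to functionals on a product space of paths, and G is built
  from such a functional. Symmetry of the killed process is obtained by killing at grid times only
  and refining the grid. The exponent 45 is 32 + 13: 13 Harnack steps for a radial segment of length
  at most r, and 32 = 3 * 2 + 2 * 13 for two points of the sphere, by three exchanges of pole and
  argument and two radial segments.\<close>

lemma LIMSEQ_dyadic:
  fixes \<tau> :: real
  assumes "0 \<le> \<tau>"
  shows "(\<lambda>n. real (Suc (nat \<lfloor>2^n * \<tau>\<rfloor>)) / 2^n) \<longlonglongrightarrow> \<tau>"
proof -
  have bnd: "\<tau> \<le> real (Suc (nat \<lfloor>2^n * \<tau>\<rfloor>)) / 2^n \<and>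
      real (Suc (nat \<lfloor>2^n * \<tau>\<rfloor>)) / 2^n \<le> \<tau> + (1/2)^n" for n
  proof -
    have "real (nat \<lfloor>2^n * \<tau>\<rfloor>) = of_int \<lfloor>2^n * \<tau>\<rfloor>" using assms by simp
    then have "2^n * \<tau> \<le> real (Suc (nat \<lfloor>2^n * \<tau>\<rfloor>))" "real (Suc (nat \<lfloor>2^n * \<tau>\<rfloor>)) \<le> 2^n * \<tau> + 1"
      using floor_correct[of "2^n * \<tau>"] by linarith+
    then show ?thesis by (simp add: field_simps power_divide)
  qed
  have "(\<lambda>n. (1/2::real)^n) \<longlonglongrightarrow> 0" by (rule LIMSEQ_power_zero) simp
  then have "(\<lambda>n. \<tau> + (1/2::real)^n) \<longlonglongrightarrow> \<tau>"
    using tendsto_add[OF tendsto_const, of "\<lambda>n. (1/2::real)^n" 0 sequentially \<tau>] by simp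
  show ?thesis
  proof (rule tendsto_sandwich)
    show "\<forall>\<^sub>F n in sequentially. \<tau> \<le> real (Suc (nat \<lfloor>2^n * \<tau>\<rfloor>)) / 2^n"
      "\<forall>\<^sub>F n in sequentially. real (Suc (nat \<lfloor>2^n * \<tau>\<rfloor>)) / 2^n \<le> \<tau> + (1/2)^n"
      using bnd by (blast intro: always_eventually)+
  qed (rule tendsto_const, fact)
qed

locale markov_diffusion =
  fixes N :: "'w measure"
    and P :: "'a::{metric_space, second_countable_topology} \<Rightarrow> 'w measure"
    and X :: "real \<Rightarrow> 'w \<Rightarrow> 'a"
  assumes diffusion: "diffusion N P X"
begin

lemma prob_space_P: "prob_space (P x)"
  and sets_P[measurable_cong, simp]: "sets (P x) = sets N"
  and measurable_X: "0 \<le> t \<Longrightarrow> X t \<in> N \<rightarrow>\<^sub>M borel"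
  and AE_X_0: "AE \<omega> in P x. X 0 \<omega> = x"
  and continuous_X: "\<omega> \<in> space N \<Longrightarrow> continuous_on {0..} (\<lambda>t. X t \<omega>)"
  and strong_markov: "strong_markov N P X"
  using diffusion unfolding diffusion_def by auto

lemma measurable_emeasure_X:
  "0 \<le> t \<Longrightarrow> B \<in> sets borel \<Longrightarrow> (\<lambda>x. emeasure (P x) {\<omega>\<in>space N. X t \<omega> \<in> B}) \<in> borel_measurable borel"
  using diffusion unfolding diffusion_def by auto

lemma space_P[simp]: "space (P x) = space N"
  by (rule sets_eq_imp_space_eq) simp

lemma space_N_nonempty: "space N \<noteq> {}"
  using prob_space.not_empty[OF prob_space_P] by simp

abbreviation "\<G> \<equiv> natural_filtration N X"
abbreviation "\<R> \<equiv> right_filtration N X"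

sublocale right: filtration "space N" \<R>
  by (rule filtration_right_filtration)

lemma space_nat[simp]: "space (\<G> u) = space N"
  by (simp add: natural_filtration_def space_measure_of_conv)

lemma sets_nat: "sets (\<G> u) =
    sigma_sets (space N) {X s -` B \<inter> space N | s B. 0 \<le> s \<and> ennreal s \<le> u \<and> B \<in> sets borel}"
  unfolding natural_filtration_def by (rule sets_measure_of) auto

lemma nat_mono: "u \<le> v \<Longrightarrow> sets (\<G> u) \<subseteq> sets (\<G> v)"
  unfolding sets_nat by (rule sigma_sets_mono') (auto intro: order_trans)

lemma nat_subset: "sets (\<G> u) \<subseteq> sets N"
  unfolding sets_nat by (rule sets.sigma_sets_subset) (auto intro!: measurable_sets measurable_X)

lemma measurable_X_nat: "0 \<le> s \<Longrightarrow> ennreal s \<le> u \<Longrightarrow> X s \<in> \<G> u \<rightarrow>\<^sub>M borel"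
  by (rule measurableI) (auto simp: sets_nat intro!: sigma_sets.Basic)

text \<open>An intersection of sigma-algebras on one space is already a sigma-algebra, so the
  \<open>sigma\<close> in the definition adds no sets.\<close>

lemma sets_right: "sets (\<R> t) = sets (\<G> \<infinity>) \<inter> (\<Inter>u\<in>{t<..}. sets (\<G> u))"
proof -
  have "sigma_algebra (space N) (sets (\<G> \<infinity>) \<inter> (\<Inter>u\<in>{t<..}. sets (\<G> u)))"
    unfolding sigma_algebra_iff2
  proof (intro conjI ballI allI impI)
    show "sets (\<G> \<infinity>) \<inter> (\<Inter>u\<in>{t<..}. sets (\<G> u)) \<subseteq> Pow (space N)"
      using sets.space_closed[of "\<G> \<infinity>"] by auto
    fix s assume "s \<in> sets (\<G> \<infinity>) \<inter> (\<Inter>u\<in>{t<..}. sets (\<G> u))"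
    then show "space N - s \<in> sets (\<G> \<infinity>) \<inter> (\<Inter>u\<in>{t<..}. sets (\<G> u))"
      using sets.compl_sets[of s "\<G> _"] by simp
  qed (auto intro!: sets.countable_nat_UN)
  then show ?thesis
    unfolding right_filtration_def by (rule sigma_algebra.sets_measure_of_eq)
qed

text \<open>Right continuity turns strict into weak inequalities: T \<le> t is the intersection of
  the events T < t + 1/(n+1). The set \<open>A\<close> is carried along to serve stopping times and
  events of the pre-sigma-algebra at once. The value t = \<infinity> is separate because there t +
  1/(n+1) does not exceed t.\<close>

lemma right_leI:
  assumes "\<And>u. {\<omega>\<in>A. T \<omega> < u} \<in> sets (\<G> u)" and "A \<in> sets (\<G> \<infinity>)"
  shows "{\<omega>\<in>A. T \<omega> \<le> t} \<in> sets (\<R> t)"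
proof (cases "t = \<infinity>")
  case True
  then show ?thesis using assms(2) by (auto simp: sets_right)
next
  case False
  have *: "{\<omega>\<in>A. T \<omega> \<le> t} \<in> sets (\<G> u)" if "t < u" for u
  proof -
    have lim: "(\<lambda>n. t + ennreal (1 / Suc n)) \<longlonglongrightarrow> t + ennreal 0"
      by (intro tendsto_intros tendsto_ennrealI LIMSEQ_Suc[OF lim_inverse_n'])
    \<comment> \<open>Cutting at \<open>u\<close> keeps every set in \<open>\<G> u\<close>, also for
      those n with t + 1/(n+1) > u.\<close>
    have "{\<omega>\<in>A. T \<omega> \<le> t} = (\<Inter>n::nat. {\<omega>\<in>A. T \<omega> < min u (t + ennreal (1 / Suc n))})"
    proof (intro set_eqI iffI)
      fix \<omega> assume "\<omega> \<in> (\<Inter>n::nat. {\<omega>\<in>A. T \<omega> < min u (t + ennreal (1 / Suc n))})"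
      then have "\<omega> \<in> A" "\<And>n. T \<omega> \<le> t + ennreal (1 / Suc n)" by (auto simp: less_imp_le)
      moreover from this have "T \<omega> \<le> t + ennreal 0"
        by (intro LIMSEQ_le_const[OF lim]) auto
      ultimately show "\<omega> \<in> {\<omega>\<in>A. T \<omega> \<le> t}" by simp
    next
      fix \<omega> assume "\<omega> \<in> {\<omega>\<in>A. T \<omega> \<le> t}"
      moreover have "t < t + ennreal (1 / Suc n)" for n
        using False by (cases t) (auto simp flip: ennreal_plus simp: ennreal_less_iff)
      ultimately show "\<omega> \<in> (\<Inter>n::nat. {\<omega>\<in>A. T \<omega> < min u (t + ennreal (1 / Suc n))})"
        using that by (auto intro: le_less_trans)
    qed
    also have "\<dots> \<in> sets (\<G> u)"
    proof (rule sets.countable_INT)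
      show "range (\<lambda>n. {\<omega>\<in>A. T \<omega> < min u (t + ennreal (1 / Suc n))}) \<subseteq> sets (\<G> u)"
        using assms(1) nat_mono[OF min.cobounded1] by blast
    qed simp
    finally show ?thesis .
  qed
  show ?thesis
    using * *[of \<infinity>] False by (auto simp: sets_right top.not_eq_extremum)
qed

lemma stopping_timeI':
  assumes "\<And>u. {\<omega>\<in>space N. T \<omega> < u} \<in> sets (\<G> u)"
  shows "stopping_time \<R> T"
proof
  fix t
  show "Measurable.pred (\<R> t) (\<lambda>\<omega>. T \<omega> \<le> t)"
    using right_leI[of "space N", OF assms] sets.top[of "\<G> \<infinity>"]
    by (simp add: pred_def right.space_F)
qed

lemma pre_sigmaI:
  assumes "stopping_time \<R> T" "\<And>u. {\<omega>\<in>A. T \<omega> < u} \<in> sets (\<G> u)" "A \<in> sets (\<G> \<infinity>)"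
  shows "A \<in> sets (right.pre_sigma T)"
  using right_leI[OF assms(2,3)] by (intro right.sets_pre_sigmaI assms(1))

text \<open>Between T \<omega> and \<open>u\<close> there is a q from a countable set, and what is
  known immediately after q < u is known at \<open>u\<close>. With \<open>pre_sigmaI\<close>, later
  arguments can work with strict inequalities and the natural filtration.\<close>

lemma pre_sigmaD:
  assumes T: "stopping_time \<R> T" and A: "A \<in> sets (right.pre_sigma T)"
  shows "{\<omega>\<in>A. T \<omega> < u} \<in> sets (\<G> u)"
proof -
  obtain D :: "ennreal set" where D: "countable D" "\<And>x y. x < y \<Longrightarrow> \<exists>b\<in>D. x \<le> b \<and> b < y"
    using countable_separating_set_linorder2 by blast
  have "{\<omega>\<in>A. T \<omega> < u} = (\<Union>q\<in>{q\<in>D. q < u}. {\<omega>\<in>A. T \<omega> \<le> q})"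
    using D(2) by (auto intro: le_less_trans)
  also have "\<dots> \<in> sets (\<G> u)"
  proof (intro sets.countable_UN'' countable_Collect D)
    fix q assume "q \<in> {q\<in>D. q < u}"
    then show "{\<omega>\<in>A. T \<omega> \<le> q} \<in> sets (\<G> u)"
      using right.sets_pre_sigmaD[OF T A, of q] by (auto simp: sets_right)
  qed
  finally show ?thesis .
qed

lemma stopping_timeD':
  assumes T: "stopping_time \<R> T"
  shows "{\<omega>\<in>space N. T \<omega> < u} \<in> sets (\<G> u)"
  using pre_sigmaD[OF T sets.top] by (simp add: right.space_pre_sigma)

lemma stopping_time_add:
  assumes T: "stopping_time \<R> T"
  shows "stopping_time \<R> (\<lambda>\<omega>. T \<omega> + ennreal s)"
proof (rule stopping_timeI')
  fix u
  have "{\<omega>\<in>space N. T \<omega> + ennreal s < u} = {\<omega>\<in>space N. T \<omega> < u - ennreal s}"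
    by (auto simp: less_diff_eq_ennreal)
  also have "\<dots> \<in> sets (\<G> u)"
    using stopping_timeD'[OF T, of "u - ennreal s"] nat_mono[of "u - ennreal s" u]
    by (auto simp: diff_le_self_ennreal)
  finally show "{\<omega>\<in>space N. T \<omega> + ennreal s < u} \<in> sets (\<G> u)" .
qed

text \<open>Approximate the stopped time from the right by dyadic times. Since T + s < u, all but
  finitely many approximations lie below \<open>u\<close>, so the limit only involves positions
  known at \<open>u\<close>.\<close>

lemma measurable_X_stopping:
  assumes T: "stopping_time \<R> T" and s: "0 \<le> s"
  shows "(\<lambda>\<omega>. X (enn2real (T \<omega>) + s) \<omega>) \<in>
    restrict_space (\<G> u) {\<omega>\<in>space N. T \<omega> + ennreal s < u} \<rightarrow>\<^sub>M borel"
proof -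
  define \<Omega> where "\<Omega> = {\<omega>\<in>space N. T \<omega> + ennreal s < u}"
  let ?R = "restrict_space (\<G> u) \<Omega>"
  have \<Omega>_eq: "\<Omega> = {\<omega>\<in>space N. T \<omega> < u - ennreal s}"
    by (auto simp: less_diff_eq_ennreal \<Omega>_def)
  have \<Omega>N: "\<Omega> \<inter> space N = \<Omega>"
    by (auto simp: \<Omega>_def)
  have T_le: "{\<omega>\<in>space N. T \<omega> < v} \<in> sets (\<G> u)" if "v \<le> u" for v
    using stopping_timeD'[OF T, of v] nat_mono[OF that] by auto
  have \<Omega>[measurable]: "\<Omega> \<in> sets (\<G> u)"
    unfolding \<Omega>_eq by (intro T_le) (auto simp: diff_le_self_ennreal)
  have [measurable]: "T \<in> borel_measurable ?R"
  proof (rule borel_measurableI_less)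
    fix c
    have "{\<omega>\<in>space N. T \<omega> < min c (u - ennreal s)} \<in> sets (\<G> u)"
      by (intro T_le) (auto simp: min_le_iff_disj diff_le_self_ennreal)
    also have "{\<omega>\<in>space N. T \<omega> < min c (u - ennreal s)} = {\<omega>\<in>space ?R. T \<omega> < c}"
      by (auto simp: space_restrict_space \<Omega>_eq)
    finally show "{\<omega>\<in>space ?R. T \<omega> < c} \<in> sets ?R"
      using \<Omega> \<Omega>N by (subst sets_restrict_space_iff) (auto simp: space_restrict_space)
  qed
  \<comment> \<open>Grid times that reach \<open>u\<close> are replaced by 0, so that each
    approximation is measurable at \<open>u\<close>. For a given path this changes only finitely
    many n.\<close>
  define tm :: "nat \<Rightarrow> nat \<Rightarrow> real" where
    "tm n j = (if ennreal (real (Suc j) / 2^n + s) < u then real (Suc j) / 2^n + s else 0)" for n j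
  have tm: "0 \<le> tm n j" "ennreal (tm n j) \<le> u" for n j
    using s by (auto simp: tm_def)
  define ix :: "nat \<Rightarrow> 'w \<Rightarrow> nat" where "ix n \<omega> = nat \<lfloor>2^n * enn2real (T \<omega>)\<rfloor>" for n \<omega>
  have [measurable]: "ix n \<in> ?R \<rightarrow>\<^sub>M count_space UNIV" for n
    unfolding ix_def by measurable
  have [measurable]: "(\<lambda>\<omega>. X (tm n j) \<omega>) \<in> ?R \<rightarrow>\<^sub>M borel" for n j
    by (intro measurable_restrict_space1 measurable_X_nat tm)
  have meas: "(\<lambda>\<omega>. X (tm n (ix n \<omega>)) \<omega>) \<in> ?R \<rightarrow>\<^sub>M borel" for n
    by (rule measurable_compose_countable) measurable
  have "(\<lambda>\<omega>. X (enn2real (T \<omega>) + s) \<omega>) \<in> ?R \<rightarrow>\<^sub>M borel"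
  proof (rule borel_measurable_LIMSEQ_metric[OF meas])
    fix \<omega> assume "\<omega> \<in> space ?R"
    then have \<omega>: "\<omega> \<in> space N" "T \<omega> + ennreal s < u" using \<Omega> by (auto simp: space_restrict_space \<Omega>_def)
    define \<tau> where "\<tau> = enn2real (T \<omega>)"
    have \<tau>: "0 \<le> \<tau>" "T \<omega> = ennreal \<tau>"
      using \<omega>(2) unfolding \<tau>_def by (cases "T \<omega>"; fastforce)+
    have lim0: "(\<lambda>n. real (Suc (ix n \<omega>)) / 2^n) \<longlonglongrightarrow> \<tau>"
      using LIMSEQ_dyadic[OF \<tau>(1)] by (simp add: ix_def \<tau>_def)
    have lim1: "(\<lambda>n. real (Suc (ix n \<omega>)) / 2^n + s) \<longlonglongrightarrow> \<tau> + s"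
      by (intro tendsto_intros lim0)
    then have "(\<lambda>n. ennreal (real (Suc (ix n \<omega>)) / 2^n + s)) \<longlonglongrightarrow> ennreal (\<tau> + s)"
      by (intro tendsto_ennrealI)
    moreover have "ennreal (\<tau> + s) < u" using \<omega>(2) \<tau> s by simp
    ultimately have "\<forall>\<^sub>F n in sequentially. ennreal (real (Suc (ix n \<omega>)) / 2^n + s) < u"
      by (rule order_tendstoD)
    then have "\<forall>\<^sub>F n in sequentially. real (Suc (ix n \<omega>)) / 2^n + s = tm n (ix n \<omega>)"
      by eventually_elim (simp add: tm_def)
    then have "(\<lambda>n. tm n (ix n \<omega>)) \<longlonglongrightarrow> \<tau> + s"
      by (rule Lim_transform_eventually[OF lim1])
    then show "(\<lambda>n. X (tm n (ix n \<omega>)) \<omega>) \<longlonglongrightarrow> X (enn2real (T \<omega>) + s) \<omega>"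
      using continuous_X[OF \<omega>(1)] tm \<tau> s unfolding \<tau>_def[symmetric]
      by (intro continuous_on_tendsto_compose[of "{0..}" "\<lambda>t. X t \<omega>"]) auto
  qed
  then show ?thesis unfolding \<Omega>_def .
qed

text \<open>Drives the induction in \<open>fin_dim\<close>: a condition on the position at T + s
  becomes part of the conditioning event for the stopping time T + s.\<close>

lemma pre_sigma_X:
  assumes T: "stopping_time \<R> T" and s: "0 \<le> s" and A: "A \<in> sets (right.pre_sigma T)"
    and B: "B \<in> sets borel"
  shows "{\<omega>\<in>A. T \<omega> < \<infinity> \<and> X (enn2real (T \<omega>) + s) \<omega> \<in> B} \<in> sets (right.pre_sigma (\<lambda>\<omega>. T \<omega> + ennreal s))"
    (is "?E \<in> _")
proof -
  have A': "A \<subseteq> space N" using sets.sets_into_space[OF A] by (simp add: right.space_pre_sigma)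
  have *: "{\<omega>\<in>?E. T \<omega> + ennreal s < u} \<in> sets (\<G> u)" for u
  proof -
    let ?O = "{\<omega>\<in>space N. T \<omega> + ennreal s < u}"
    have O: "?O \<in> sets (\<G> u)"
      using stopping_timeD'[OF stopping_time_add[OF T]] .
    have "{\<omega>\<in>A. T \<omega> + ennreal s < u} = {\<omega>\<in>A. T \<omega> < u - ennreal s}"
      by (auto simp: less_diff_eq_ennreal)
    then have 1: "{\<omega>\<in>A. T \<omega> + ennreal s < u} \<in> sets (\<G> u)"
      using pre_sigmaD[OF T A, of "u - ennreal s"] nat_mono[of "u - ennreal s" u]
      by (auto simp: diff_le_self_ennreal)
    have "(\<lambda>\<omega>. X (enn2real (T \<omega>) + s) \<omega>) -` B \<inter> space (restrict_space (\<G> u) ?O) \<in> sets (restrict_space (\<G> u) ?O)"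
      by (rule measurable_sets[OF measurable_X_stopping[OF T s] B])
    then have "(\<lambda>\<omega>. X (enn2real (T \<omega>) + s) \<omega>) -` B \<inter> ?O \<in> sets (\<G> u)"
      using O sets.sets_into_space[OF O]
      by (subst (asm) sets_restrict_space_iff) (auto simp: space_restrict_space Int_absorb1 Int_absorb2)
    from sets.Int[OF 1 this]
    have "{\<omega>\<in>A. T \<omega> + ennreal s < u} \<inter> ((\<lambda>\<omega>. X (enn2real (T \<omega>) + s) \<omega>) -` B \<inter> ?O) \<in> sets (\<G> u)" .
    also have "{\<omega>\<in>A. T \<omega> + ennreal s < u} \<inter> ((\<lambda>\<omega>. X (enn2real (T \<omega>) + s) \<omega>) -` B \<inter> ?O) = {\<omega>\<in>?E. T \<omega> + ennreal s < u}"
    proof -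
      have "T \<omega> < \<infinity>" if "T \<omega> + ennreal s < u" for \<omega>
        using that by (cases "T \<omega>") auto
      then show ?thesis using A' by auto
    qed
    finally show ?thesis .
  qed
  show ?thesis
  proof (rule pre_sigmaI[OF stopping_time_add[OF T] *])
    have "?E = {\<omega>\<in>?E. T \<omega> + ennreal s < \<infinity>}" by (auto simp: top.not_eq_extremum)
    then show "?E \<in> sets (\<G> \<infinity>)" using *[of \<infinity>] by simp
  qed
qed

lemma pre_sigma_subset:
  assumes T: "stopping_time \<R> T" and A: "A \<in> sets (right.pre_sigma T)"
  shows "A \<in> sets N"
  using right.sets_pre_sigmaD[OF T A, of \<infinity>] nat_subset by (auto simp: sets_right)

lemma measurable_stopping_time_N:
  assumes T: "stopping_time \<R> T"
  shows "T \<in> borel_measurable N"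
  using T by (rule measurable_stopping_time) (use nat_subset right.space_F in \<open>auto simp: sets_right\<close>)

end

section \<open>The strong Markov property for path functionals\<close>

lemma nn_integral_kernel_eq:
  assumes Y[measurable]: "Y \<in> M \<rightarrow>\<^sub>M B" and K: "K \<in> M \<rightarrow>\<^sub>M subprob_algebra B"
    and ne: "space M \<noteq> {}"
    and eq: "distr M B Y = M \<bind> K"
    and f: "f \<in> borel_measurable B"
  shows "(\<integral>\<^sup>+\<omega>. f (Y \<omega>) \<partial>M) = (\<integral>\<^sup>+\<omega>. (\<integral>\<^sup>+y. f y \<partial>K \<omega>) \<partial>M)"
proof -
  have "(\<integral>\<^sup>+\<omega>. f (Y \<omega>) \<partial>M) = (\<integral>\<^sup>+y. f y \<partial>distr M B Y)"
    using f by (intro nn_integral_distr[symmetric] Y) auto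
  also have "\<dots> = (\<integral>\<^sup>+\<omega>. (\<integral>\<^sup>+y. f y \<partial>K \<omega>) \<partial>M)"
    unfolding eq by (rule nn_integral_bind[OF f K])
  finally show ?thesis .
qed

context markov_diffusion
begin

lemma measurable_X_joint[measurable]: "(\<lambda>(t, \<omega>). X (max 0 t) \<omega>) \<in> borel \<Otimes>\<^sub>M N \<rightarrow>\<^sub>M borel"
proof (rule borel_measurable_LIMSEQ_metric)
  fix n :: nat
  have [measurable]: "(\<lambda>p. X (real (Suc i) / 2^n) (snd p)) \<in> (borel :: real measure) \<Otimes>\<^sub>M N \<rightarrow>\<^sub>M borel" for i
    by (intro measurable_compose[OF measurable_snd] measurable_X) simp
  have [measurable]: "(\<lambda>p :: real \<times> 'w. nat \<lfloor>(2::real)^n * max 0 (fst p)\<rfloor>) \<in> borel \<Otimes>\<^sub>M N \<rightarrow>\<^sub>M count_space UNIV"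
    by measurable
  have "(\<lambda>p. X (real (Suc (nat \<lfloor>(2::real)^n * max 0 (fst p)\<rfloor>)) / 2^n) (snd p)) \<in> borel \<Otimes>\<^sub>M N \<rightarrow>\<^sub>M borel"
    by (rule measurable_compose_countable[where f="\<lambda>i p. X (real (Suc i) / 2^n) (snd p)" and
      g="\<lambda>p. nat \<lfloor>(2::real)^n * max 0 (fst p)\<rfloor>"]) measurable
  then show "(\<lambda>(t, \<omega>). X (real (Suc (nat \<lfloor>(2::real)^n * max 0 t\<rfloor>)) / 2^n) \<omega>) \<in> borel \<Otimes>\<^sub>M N \<rightarrow>\<^sub>M borel"
    by (simp add: case_prod_beta')
next
  fix p :: "real \<times> 'w" assume "p \<in> space (borel \<Otimes>\<^sub>M N)"
  then have "snd p \<in> space N" by (auto simp: space_pair_measure)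
  from continuous_X[OF this]
  have "(\<lambda>n. X (real (Suc (nat \<lfloor>(2::real)^n * max 0 (fst p)\<rfloor>)) / 2^n) (snd p)) \<longlonglongrightarrow> X (max 0 (fst p)) (snd p)"
    by (rule continuous_on_tendsto_compose[OF _ LIMSEQ_dyadic]) auto
  then show "(\<lambda>n. case p of (t, \<omega>) \<Rightarrow> X (real (Suc (nat \<lfloor>(2::real)^n * max 0 t\<rfloor>)) / 2^n) \<omega>)
      \<longlonglongrightarrow> (case p of (t, \<omega>) \<Rightarrow> X (max 0 t) \<omega>)"
    by (simp add: case_prod_beta')
qed

lemma measurable_X_at:
  assumes [measurable]: "\<tau> \<in> borel_measurable N" and "\<And>\<omega>. \<omega> \<in> space N \<Longrightarrow> 0 \<le> \<tau> \<omega>"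
  shows "(\<lambda>\<omega>. X (\<tau> \<omega>) \<omega>) \<in> N \<rightarrow>\<^sub>M borel"
proof -
  have "(\<lambda>\<omega>. case (\<tau> \<omega>, \<omega>) of (t, \<omega>) \<Rightarrow> X (max 0 t) \<omega>) \<in> N \<rightarrow>\<^sub>M borel"
    by (rule measurable_compose[OF _ measurable_X_joint]) measurable
  then show ?thesis
    using assms(2) by (subst measurable_cong[of N _ "\<lambda>\<omega>. X (max 0 (\<tau> \<omega>)) \<omega>"]) (auto simp: max_def)
qed

lemma measurable_X_stopped:
  assumes T: "stopping_time \<R> T" and s: "0 \<le> s"
  shows "(\<lambda>\<omega>. X (enn2real (T \<omega>) + s) \<omega>) \<in> N \<rightarrow>\<^sub>M borel"
  using s measurable_stopping_time_N[OF T] by (intro measurable_X_at) auto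

text \<open>Unnormalised law on A \<inter> {T < \<infinity>}. With it the strong Markov property is
  an equality of two finite measures, a pushforward and a \<open>bind\<close>, and so extends from
  sets to functions and from cylinders to all measurable sets of paths.\<close>

definition stopped_law :: "('w \<Rightarrow> ennreal) \<Rightarrow> 'w set \<Rightarrow> 'a \<Rightarrow> 'w measure" where
  "stopped_law T A x = density (P x) (indicator {\<omega>\<in>A. T \<omega> < \<infinity>})"

lemma stopped_set:
  assumes T: "stopping_time \<R> T" and A: "A \<in> sets (right.pre_sigma T)"
  shows "{\<omega>\<in>A. T \<omega> < \<infinity>} \<in> sets N"
proof -
  note [measurable] = pre_sigma_subset[OF T A] measurable_stopping_time_N[OF T]
  have "{\<omega>\<in>A. T \<omega> < \<infinity>} = A \<inter> {\<omega>\<in>space N. T \<omega> < \<infinity>}"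
    using sets.sets_into_space[OF pre_sigma_subset[OF T A]] by auto
  then show ?thesis by simp
qed

lemma sets_stopped_law[simp, measurable_cong]: "sets (stopped_law T A x) = sets N"
  by (simp add: stopped_law_def)

lemma space_stopped_law[simp]: "space (stopped_law T A x) = space N"
  by (simp add: stopped_law_def)

lemma nn_integral_stopped_law:
  assumes "stopping_time \<R> T" "A \<in> sets (right.pre_sigma T)" "f \<in> borel_measurable N"
  shows "(\<integral>\<^sup>+\<omega>. f \<omega> \<partial>stopped_law T A x) = (\<integral>\<^sup>+\<omega>\<in>{\<omega>\<in>A. T \<omega> < \<infinity>}. f \<omega> \<partial>P x)"
  unfolding stopped_law_def using stopped_set[OF assms(1,2)] assms(3)
  by (subst nn_integral_density) (auto simp: mult.commute)

lemma emeasure_stopped_law: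
  assumes "stopping_time \<R> T" "A \<in> sets (right.pre_sigma T)" "B \<in> sets N"
  shows "emeasure (stopped_law T A x) B = emeasure (P x) ({\<omega>\<in>A. T \<omega> < \<infinity>} \<inter> B)"
  unfolding stopped_law_def using stopped_set[OF assms(1,2)] assms(3)
  by (subst emeasure_density) (auto simp: nn_integral_indicator[symmetric] indicator_inter_arith simp del: nn_integral_indicator)

lemma finite_measure_stopped_law:
  assumes "stopping_time \<R> T" "A \<in> sets (right.pre_sigma T)"
  shows "finite_measure (stopped_law T A x)"
proof
  interpret prob_space "P x" by (rule prob_space_P)
  show "emeasure (stopped_law T A x) (space (stopped_law T A x)) \<noteq> \<infinity>"
    using emeasure_finite by (simp add: emeasure_stopped_law[OF assms])
qed

lemma kernel_X:
  assumes [simp]: "0 \<le> s"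
  shows "(\<lambda>z. distr (P z) borel (X s)) \<in> borel \<rightarrow>\<^sub>M subprob_algebra borel"
proof (rule measurable_subprob_algebra)
  note [measurable] = measurable_X[OF assms]
  fix z
  interpret prob_space "P z" by (rule prob_space_P)
  show "subprob_space (distr (P z) borel (X s))"
    by (intro prob_space_imp_subprob_space prob_space_distr) simp
next
  note [measurable] = measurable_X[OF assms]
  fix A :: "'a set" assume A: "A \<in> sets borel"
  have "(\<lambda>z. emeasure (distr (P z) borel (X s)) A) = (\<lambda>z. emeasure (P z) {\<omega>\<in>space N. X s \<omega> \<in> A})"
    using A by (subst emeasure_distr) (auto intro!: arg_cong2[where f=emeasure] ext)
  then show "(\<lambda>z. emeasure (distr (P z) borel (X s)) A) \<in> borel_measurable borel"
    using A measurable_emeasure_X[of s A] by simp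
qed simp

lemma strong_markov_fun:
  assumes T: "stopping_time \<R> T" and A: "A \<in> sets (right.pre_sigma T)" and s: "0 \<le> s"
    and g[measurable]: "g \<in> borel_measurable borel"
  shows "(\<integral>\<^sup>+\<omega>\<in>{\<omega>\<in>A. T \<omega> < \<infinity>}. g (X (enn2real (T \<omega>) + s) \<omega>) \<partial>P x) =
    (\<integral>\<^sup>+\<omega>\<in>{\<omega>\<in>A. T \<omega> < \<infinity>}. (\<integral>\<^sup>+\<omega>'. g (X s \<omega>') \<partial>P (X (enn2real (T \<omega>)) \<omega>)) \<partial>P x)"
proof -
  note XT[measurable] = measurable_X_stopped[OF T s] measurable_X_stopped[OF T order_refl, simplified]
  note Xs[measurable] = measurable_X[OF s]
  note K[measurable] = measurable_compose[OF XT(2) kernel_X[OF s]]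
  let ?M = "stopped_law T A x"
  let ?K = "\<lambda>\<omega>. distr (P (X (enn2real (T \<omega>)) \<omega>)) borel (X s)"
  have K': "?K \<in> ?M \<rightarrow>\<^sub>M subprob_algebra borel" by measurable
  have eq: "distr ?M borel (\<lambda>\<omega>. X (enn2real (T \<omega>) + s) \<omega>) = ?M \<bind> ?K"
  proof (rule measure_eqI)
    show "sets (distr ?M borel (\<lambda>\<omega>. X (enn2real (T \<omega>) + s) \<omega>)) = sets (?M \<bind> ?K)"
      using space_N_nonempty by (subst sets_bind[where N=borel]) auto
    fix B :: "'a set" assume "B \<in> sets (distr ?M borel (\<lambda>\<omega>. X (enn2real (T \<omega>) + s) \<omega>))"
    then have B[measurable]: "B \<in> sets borel" by simp
    have "emeasure (distr ?M borel (\<lambda>\<omega>. X (enn2real (T \<omega>) + s) \<omega>)) B =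
        emeasure ?M ((\<lambda>\<omega>. X (enn2real (T \<omega>) + s) \<omega>) -` B \<inter> space N)"
      by (subst emeasure_distr) auto
    also have "\<dots> = emeasure (P x) {\<omega>\<in>A. T \<omega> < \<infinity> \<and> X (enn2real (T \<omega>) + s) \<omega> \<in> B}"
      using sets.sets_into_space[OF pre_sigma_subset[OF T A]]
      by (subst emeasure_stopped_law[OF T A]) (auto intro!: arg_cong2[where f=emeasure])
    also have "\<dots> = (\<integral>\<^sup>+\<omega>\<in>{\<omega>\<in>A. T \<omega> < \<infinity>}.
              emeasure (P (X (enn2real (T \<omega>)) \<omega>)) {\<omega>'\<in>space N. X s \<omega>' \<in> B} \<partial>P x)"
      using strong_markov T A s B unfolding strong_markov_def by blast
    also have "\<dots> = (\<integral>\<^sup>+\<omega>\<in>{\<omega>\<in>A. T \<omega> < \<infinity>}. emeasure (?K \<omega>) B \<partial>P x)"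
      by (intro nn_integral_cong arg_cong2[where f="(*)"] refl)
        (subst emeasure_distr; auto intro!: arg_cong2[where f=emeasure])
    also have "\<dots> = (\<integral>\<^sup>+\<omega>. emeasure (?K \<omega>) B \<partial>?M)"
      by (rule nn_integral_stopped_law[OF T A, symmetric]) measurable
    also have "\<dots> = emeasure (?M \<bind> ?K) B"
      using space_N_nonempty by (intro emeasure_bind[symmetric, OF _ K']) auto
    finally show "emeasure (distr ?M borel (\<lambda>\<omega>. X (enn2real (T \<omega>) + s) \<omega>)) B = emeasure (?M \<bind> ?K) B" .
  qed
  have "(\<integral>\<^sup>+\<omega>. g (X (enn2real (T \<omega>) + s) \<omega>) \<partial>?M) = (\<integral>\<^sup>+\<omega>. (\<integral>\<^sup>+y. g y \<partial>?K \<omega>) \<partial>?M)"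
    by (rule nn_integral_kernel_eq[OF _ K' _ eq]) (use space_N_nonempty in auto)
  also have "\<dots> = (\<integral>\<^sup>+\<omega>. (\<integral>\<^sup>+\<omega>'. g (X s \<omega>') \<partial>P (X (enn2real (T \<omega>)) \<omega>)) \<partial>?M)"
    by (intro nn_integral_cong nn_integral_distr) auto
  finally have *: "(\<integral>\<^sup>+\<omega>. g (X (enn2real (T \<omega>) + s) \<omega>) \<partial>?M) =
      (\<integral>\<^sup>+\<omega>. (\<integral>\<^sup>+\<omega>'. g (X s \<omega>') \<partial>P (X (enn2real (T \<omega>)) \<omega>)) \<partial>?M)" .
  have "(\<lambda>z. \<integral>\<^sup>+y. g y \<partial>distr (P z) borel (X s)) \<in> borel_measurable borel"
    by (rule nn_integral_measurable_subprob_algebra2[OF _ kernel_X[OF s]]) measurable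
  then have "(\<lambda>z. \<integral>\<^sup>+\<omega>'. g (X s \<omega>') \<partial>P z) \<in> borel_measurable borel"
    by (subst (asm) nn_integral_distr) auto
  then have [measurable]: "(\<lambda>\<omega>. \<integral>\<^sup>+\<omega>'. g (X s \<omega>') \<partial>P (X (enn2real (T \<omega>)) \<omega>)) \<in> borel_measurable N"
    by (rule measurable_compose[OF XT(2)])
  show ?thesis
    using * by (subst (asm) (1 2) nn_integral_stopped_law[OF T A]) auto
qed

lemma measurable_nn_integral_X:
  assumes s: "0 \<le> s" and g[measurable]: "g \<in> borel_measurable borel"
  shows "(\<lambda>z. \<integral>\<^sup>+\<omega>. g (X s \<omega>) \<partial>P z) \<in> borel_measurable borel"
proof -
  note [measurable] = measurable_X[OF s]
  have "(\<lambda>z. \<integral>\<^sup>+y. g y \<partial>distr (P z) borel (X s)) \<in> borel_measurable borel"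
    by (rule nn_integral_measurable_subprob_algebra2[OF _ kernel_X[OF s]]) measurable
  then show ?thesis
    by (subst (asm) nn_integral_distr) auto
qed

section \<open>Finite-dimensional distributions after a stopping time\<close>

definition fin_dim :: "real set \<Rightarrow> (real \<Rightarrow> 'a set) \<Rightarrow> 'a \<Rightarrow> ennreal" where
  "fin_dim J E z = emeasure (P z) {\<omega>\<in>space N. \<forall>j\<in>J. X j \<omega> \<in> E j}"

text \<open>Induction on the number of times. The smallest time m is split off by moving the
  stopping time to T + m and shrinking A by the condition at m; the induction hypothesis handles the
  other times, counted from m. What remains is a function \<open>h\<close> of the single position at
  T + m, to which \<open>strong_markov_fun\<close> applies. Measurability belongs to the induction
  because \<open>h\<close> has to be measurable.\<close>

lemma fin_dim:
  assumes "finite J" "\<And>j. j \<in> J \<Longrightarrow> 0 \<le> j" "\<And>j. j \<in> J \<Longrightarrow> E j \<in> sets borel"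
  shows "fin_dim J E \<in> borel_measurable borel \<and>
    (\<forall>x T A. stopping_time \<R> T \<longrightarrow> A \<in> sets (right.pre_sigma T) \<longrightarrow>
      emeasure (P x) {\<omega>\<in>A. T \<omega> < \<infinity> \<and> (\<forall>j\<in>J. X (enn2real (T \<omega>) + j) \<omega> \<in> E j)} =
      (\<integral>\<^sup>+\<omega>\<in>{\<omega>\<in>A. T \<omega> < \<infinity>}. fin_dim J E (X (enn2real (T \<omega>)) \<omega>) \<partial>P x))"
  using assms
proof (induction "card J" arbitrary: J E)
  case 0
  then have [simp]: "J = {}" by simp
  have "fin_dim J E z = 1" for z
    using prob_space.emeasure_space_1[OF prob_space_P[of z]] by (simp add: fin_dim_def)
  then show ?case
    using stopped_set by simp
next
  case (Suc n)
  define m where "m = Min J"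
  have "J \<noteq> {}" using Suc(2) by auto
  then have m: "m \<in> J" "0 \<le> m" "\<And>j. j \<in> J \<Longrightarrow> m \<le> j"
    using Suc.prems by (auto simp: m_def)
  define J0 where "J0 = (\<lambda>j. j - m) ` (J - {m})"
  define E0 where "E0 j = E (j + m)" for j
  have "card J0 = n" unfolding J0_def
    using Suc(2) Suc.prems(1) m(1) by (subst card_image) (auto simp: inj_on_def)
  then have *: "n = card J0" by simp
  have "fin_dim J0 E0 \<in> borel_measurable borel \<and>
    (\<forall>x T A. stopping_time \<R> T \<longrightarrow> A \<in> sets (right.pre_sigma T) \<longrightarrow>
      emeasure (P x) {\<omega>\<in>A. T \<omega> < \<infinity> \<and> (\<forall>j\<in>J0. X (enn2real (T \<omega>) + j) \<omega> \<in> E0 j)} =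
      (\<integral>\<^sup>+\<omega>\<in>{\<omega>\<in>A. T \<omega> < \<infinity>}. fin_dim J0 E0 (X (enn2real (T \<omega>)) \<omega>) \<partial>P x))"
    using Suc.prems m by (intro Suc(1)[OF *]) (auto simp: J0_def E0_def)
  then have IH: "fin_dim J0 E0 \<in> borel_measurable borel"
    "\<And>x T A. stopping_time \<R> T \<Longrightarrow> A \<in> sets (right.pre_sigma T) \<Longrightarrow>
      emeasure (P x) {\<omega>\<in>A. T \<omega> < \<infinity> \<and> (\<forall>j\<in>J0. X (enn2real (T \<omega>) + j) \<omega> \<in> E0 j)} =
      (\<integral>\<^sup>+\<omega>\<in>{\<omega>\<in>A. T \<omega> < \<infinity>}. fin_dim J0 E0 (X (enn2real (T \<omega>)) \<omega>) \<partial>P x)"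
    by blast+
  have Em[measurable]: "E m \<in> sets borel" using Suc.prems m by auto
  define h where "h z = indicator (E m) z * fin_dim J0 E0 z" for z
  have [measurable]: "h \<in> borel_measurable borel"
    unfolding h_def using IH(1) by measurable
  have J_iff: "(\<forall>j\<in>J. Q j) \<longleftrightarrow> Q m \<and> (\<forall>j\<in>J0. Q (j + m))" for Q
    using m(1) by (auto simp: J0_def)
  have 1: "emeasure (P x) {\<omega>\<in>A. T \<omega> < \<infinity> \<and> (\<forall>j\<in>J. X (enn2real (T \<omega>) + j) \<omega> \<in> E j)} =
      (\<integral>\<^sup>+\<omega>\<in>{\<omega>\<in>A. T \<omega> < \<infinity>}. h (X (enn2real (T \<omega>) + m) \<omega>) \<partial>P x)"
    if T: "stopping_time \<R> T" and A: "A \<in> sets (right.pre_sigma T)" for x T A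
  proof -
    define T' where "T' = (\<lambda>\<omega>. T \<omega> + ennreal m)"
    define A' where "A' = {\<omega>\<in>A. T \<omega> < \<infinity> \<and> X (enn2real (T \<omega>) + m) \<omega> \<in> E m}"
    have T': "stopping_time \<R> T'" unfolding T'_def by (rule stopping_time_add[OF T])
    have A': "A' \<in> sets (right.pre_sigma T')"
      unfolding T'_def A'_def by (rule pre_sigma_X[OF T m(2) A Em])
    have r: "enn2real (T' \<omega>) = enn2real (T \<omega>) + m" "T' \<omega> < top" if "T \<omega> < top" for \<omega>
      using that m(2) by (auto simp: T'_def enn2real_plus)
    have "{\<omega>\<in>A. T \<omega> < \<infinity> \<and> (\<forall>j\<in>J. X (enn2real (T \<omega>) + j) \<omega> \<in> E j)} =
        {\<omega>\<in>A'. T' \<omega> < \<infinity> \<and> (\<forall>j\<in>J0. X (enn2real (T' \<omega>) + j) \<omega> \<in> E0 j)}"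
      unfolding J_iff by (auto simp: A'_def E0_def r add.commute add.left_commute)
    then have "emeasure (P x) {\<omega>\<in>A. T \<omega> < \<infinity> \<and> (\<forall>j\<in>J. X (enn2real (T \<omega>) + j) \<omega> \<in> E j)} =
        (\<integral>\<^sup>+\<omega>\<in>{\<omega>\<in>A'. T' \<omega> < \<infinity>}. fin_dim J0 E0 (X (enn2real (T' \<omega>)) \<omega>) \<partial>P x)"
      using IH(2)[OF T' A'] by simp
    also have "\<dots> = (\<integral>\<^sup>+\<omega>\<in>{\<omega>\<in>A. T \<omega> < \<infinity>}. h (X (enn2real (T \<omega>) + m) \<omega>) \<partial>P x)"
      by (intro nn_integral_cong) (auto simp: A'_def h_def r indicator_def)
    finally show ?thesis .
  qed
  \<comment> \<open>T = 0 in \<open>1\<close> describes the process from its own starting point, so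
    both claims become statements about \<open>h\<close>.\<close>
  have 2: "fin_dim J E z = (\<integral>\<^sup>+\<omega>. h (X m \<omega>) \<partial>P z)" for z
  proof -
    have "fin_dim J E z = (\<integral>\<^sup>+\<omega>\<in>space N. h (X m \<omega>) \<partial>P z)"
      using 1[where T="\<lambda>_. 0" and x=z, OF stopping_time_const sets.top]
      by (simp add: fin_dim_def right.space_pre_sigma)
    also have "\<dots> = (\<integral>\<^sup>+\<omega>. h (X m \<omega>) \<partial>P z)"
      by (intro nn_integral_cong) simp
    finally show ?thesis .
  qed
  show ?case
  proof (intro conjI allI impI)
    show "fin_dim J E \<in> borel_measurable borel"
      unfolding 2 by (rule measurable_nn_integral_X[OF m(2)]) measurable
    fix x T A assume T: "stopping_time \<R> T" and A: "A \<in> sets (right.pre_sigma T)"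
    show "emeasure (P x) {\<omega>\<in>A. T \<omega> < \<infinity> \<and> (\<forall>j\<in>J. X (enn2real (T \<omega>) + j) \<omega> \<in> E j)} =
      (\<integral>\<^sup>+\<omega>\<in>{\<omega>\<in>A. T \<omega> < \<infinity>}. fin_dim J E (X (enn2real (T \<omega>)) \<omega>) \<partial>P x)"
      unfolding 1[OF T A] 2 by (rule strong_markov_fun[OF T A m(2)]) measurable
  qed
qed

section \<open>Strong Markov property on path space\<close>

abbreviation PS :: "(real \<Rightarrow> 'a) measure" where
  "PS \<equiv> PiM UNIV (\<lambda>_. borel)"

text \<open>Clamping the time at \<open>0\<close> makes a path a point of the product over all reals.\<close>

definition path :: "'w \<Rightarrow> real \<Rightarrow> 'a" where
  "path \<omega> s = X (max 0 s) \<omega>"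

definition shifted_path :: "('w \<Rightarrow> ennreal) \<Rightarrow> 'w \<Rightarrow> real \<Rightarrow> 'a" where
  "shifted_path T \<omega> s = X (enn2real (T \<omega>) + max 0 s) \<omega>"

lemma path_eq: "path \<omega> = (\<lambda>s. X (max 0 s) \<omega>)"
  by (auto simp: path_def)

lemma measurable_path[measurable]: "path \<in> N \<rightarrow>\<^sub>M PS"
  unfolding path_def[abs_def]
  by (intro measurable_PiM_single') (auto intro!: measurable_X simp: PiE_def extensional_def)

lemma measurable_shifted_path:
  assumes T: "stopping_time \<R> T"
  shows "shifted_path T \<in> N \<rightarrow>\<^sub>M PS"
  unfolding shifted_path_def[abs_def]
  by (intro measurable_PiM_single') (auto intro!: measurable_X_stopped[OF T] simp: PiE_def extensional_def)

text \<open>Clamping gives all negative indices the value at time 0, so conditions at several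
  indices may concern the same time. They are collected in an intersection.\<close>

lemma cylinder_eq:
  assumes "\<And>j. j \<in> J \<Longrightarrow> E j \<in> sets borel" and "finite J"
  obtains J' E' where "finite J'" "\<And>j. j \<in> J' \<Longrightarrow> 0 \<le> j" "\<And>j. j \<in> J' \<Longrightarrow> E' j \<in> sets borel"
    "\<And>w :: real \<Rightarrow> 'a. (\<lambda>s. w (max 0 s)) \<in> prod_emb UNIV (\<lambda>_. borel) J (Pi\<^sub>E J E) \<longleftrightarrow> (\<forall>j\<in>J'. w j \<in> E' j)"
proof
  let ?J = "max 0 ` J" and ?E = "\<lambda>t. \<Inter>j\<in>{j\<in>J. max 0 j = t}. E j"
  show "finite ?J" using assms by simp
  show "0 \<le> j" if "j \<in> ?J" for j using that by auto
  show "?E j \<in> sets borel" if "j \<in> ?J" for j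
    using that assms by (intro sets.finite_INT) auto
  show "(\<lambda>s. w (max 0 s)) \<in> prod_emb UNIV (\<lambda>_. borel) J (Pi\<^sub>E J E) \<longleftrightarrow> (\<forall>j\<in>?J. w j \<in> ?E j)"
    for w :: "real \<Rightarrow> 'a"
    by (auto simp: prod_emb_def PiE_def Pi_iff extensional_def)
qed

lemma kernel_path: "(\<lambda>z. distr (P z) PS path) \<in> borel \<rightarrow>\<^sub>M prob_algebra PS"
proof (rule measurable_prob_algebra_generated[OF sets_PiM Int_stable_prod_algebra prod_algebra_sets_into_space])
  fix z
  interpret prob_space "P z" by (rule prob_space_P)
  show "prob_space (distr (P z) PS path)"
    by (intro prob_space_distr) simp
next
  fix C :: "(real \<Rightarrow> 'a) set" assume C: "C \<in> prod_algebra UNIV (\<lambda>_. borel)"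
  then obtain J E where JE: "C = prod_emb UNIV (\<lambda>_. borel) J (Pi\<^sub>E J E)" "finite J"
    "\<And>j. j \<in> J \<Longrightarrow> E j \<in> sets borel"
    by (force elim!: prod_algebraE)
  then obtain J' E' where J': "finite J'" "\<And>j. j \<in> J' \<Longrightarrow> 0 \<le> j" "\<And>j. j \<in> J' \<Longrightarrow> E' j \<in> sets borel"
    "\<And>w :: real \<Rightarrow> 'a. (\<lambda>s. w (max 0 s)) \<in> C \<longleftrightarrow> (\<forall>j\<in>J'. w j \<in> E' j)"
    using cylinder_eq[of J E] by metis
  have C': "C \<in> sets PS" using C unfolding sets_PiM by (rule sigma_sets.Basic)
  have "emeasure (distr (P z) PS path) C = fin_dim J' E' z" for z
    using C' J'(4)[of "\<lambda>s. X s _"]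
    by (subst emeasure_distr) (auto simp: fin_dim_def path_eq intro!: arg_cong2[where f=emeasure])
  then show "(\<lambda>z. emeasure (distr (P z) PS path) C) \<in> borel_measurable borel"
    using fin_dim[of J' E', OF J'(1-3)] by simp
qed simp

lemma kernel_path_subprob: "(\<lambda>z. distr (P z) PS path) \<in> borel \<rightarrow>\<^sub>M subprob_algebra PS"
  by (rule measurable_prob_algebraD[OF kernel_path])

lemma measurable_nn_integral_path:
  assumes [measurable]: "f \<in> borel_measurable PS"
  shows "(\<lambda>z. \<integral>\<^sup>+\<omega>. f (path \<omega>) \<partial>P z) \<in> borel_measurable borel"
proof -
  have "(\<lambda>z. \<integral>\<^sup>+w. f w \<partial>distr (P z) PS path) \<in> borel_measurable borel"
    by (rule nn_integral_measurable_subprob_algebra2[OF _ kernel_path_subprob]) measurable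
  then show ?thesis
    by (subst (asm) nn_integral_distr) auto
qed

text \<open>Each side integrates f against a finite measure on \<open>PS\<close>. By
  \<open>fin_dim\<close> the two measures agree on cylinders, which determine them.\<close>

lemma strong_markov_path:
  assumes T: "stopping_time \<R> T" and A: "A \<in> sets (right.pre_sigma T)"
    and f[measurable]: "f \<in> borel_measurable PS"
  shows "(\<integral>\<^sup>+\<omega>\<in>{\<omega>\<in>A. T \<omega> < \<infinity>}. f (shifted_path T \<omega>) \<partial>P x) =
    (\<integral>\<^sup>+\<omega>\<in>{\<omega>\<in>A. T \<omega> < \<infinity>}. (\<integral>\<^sup>+\<omega>'. f (path \<omega>') \<partial>P (X (enn2real (T \<omega>)) \<omega>)) \<partial>P x)"
proof -
  note XT[measurable] = measurable_X_stopped[OF T order_refl, simplified]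
  note [measurable] = measurable_shifted_path[OF T]
  note K[measurable] = measurable_compose[OF XT kernel_path_subprob]
  let ?M = "stopped_law T A x"
  let ?K = "\<lambda>\<omega>. distr (P (X (enn2real (T \<omega>)) \<omega>)) PS path"
  have K': "?K \<in> ?M \<rightarrow>\<^sub>M subprob_algebra PS" by measurable
  have eq: "distr ?M PS (shifted_path T) = ?M \<bind> ?K"
  proof (rule measure_eqI_PiM_infinite)
    show "sets (?M \<bind> ?K) = sets PS"
      using space_N_nonempty by (subst sets_bind[where N=PS]) auto
    show "finite_measure (distr ?M PS (shifted_path T))"
      by (intro finite_measure.finite_measure_distr finite_measure_stopped_law T A) simp
  next
    fix E and J :: "real set" assume "finite J" and E: "\<And>j. j \<in> J \<Longrightarrow> E j \<in> sets (borel :: 'a measure)"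
    let ?C = "prod_emb UNIV (\<lambda>_. borel) J (Pi\<^sub>E J E)"
    have C[measurable]: "?C \<in> sets PS"
      using E \<open>finite J\<close> by (intro sets_PiM_I) auto
    obtain J' E' where J': "finite J'" "\<And>j. j \<in> J' \<Longrightarrow> 0 \<le> j" "\<And>j. j \<in> J' \<Longrightarrow> E' j \<in> sets borel"
      "\<And>w :: real \<Rightarrow> 'a. (\<lambda>s. w (max 0 s)) \<in> ?C \<longleftrightarrow> (\<forall>j\<in>J'. w j \<in> E' j)"
      using cylinder_eq[of J E] E \<open>finite J\<close> by metis
    have fd: "emeasure (distr (P z) PS path) ?C = fin_dim J' E' z" for z
      using C J'(4)[of "\<lambda>s. X s _"]
      by (subst emeasure_distr) (auto simp: fin_dim_def path_eq intro!: arg_cong2[where f=emeasure])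
    have sh: "shifted_path T \<omega> \<in> ?C \<longleftrightarrow> (\<forall>j\<in>J'. X (enn2real (T \<omega>) + j) \<omega> \<in> E' j)" for \<omega>
      using J'(4)[of "\<lambda>s. X (enn2real (T \<omega>) + s) \<omega>"] by (simp add: shifted_path_def[abs_def])
    have "emeasure (distr ?M PS (shifted_path T)) ?C = emeasure ?M (shifted_path T -` ?C \<inter> space N)"
      by (subst emeasure_distr) auto
    also have "\<dots> = emeasure (P x) {\<omega>\<in>A. T \<omega> < \<infinity> \<and> (\<forall>j\<in>J'. X (enn2real (T \<omega>) + j) \<omega> \<in> E' j)}"
      using sets.sets_into_space[OF pre_sigma_subset[OF T A]]
      by (subst emeasure_stopped_law[OF T A]) (auto intro!: arg_cong2[where f=emeasure] simp: sh)
    also have "\<dots> = (\<integral>\<^sup>+\<omega>\<in>{\<omega>\<in>A. T \<omega> < \<infinity>}. emeasure (?K \<omega>) ?C \<partial>P x)"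
      unfolding fd using fin_dim[of J' E', OF J'(1-3)] T A by blast
    also have "\<dots> = (\<integral>\<^sup>+\<omega>. emeasure (?K \<omega>) ?C \<partial>?M)"
      by (rule nn_integral_stopped_law[OF T A, symmetric]) measurable
    also have "\<dots> = emeasure (?M \<bind> ?K) ?C"
      using space_N_nonempty by (intro emeasure_bind[symmetric, OF _ K']) auto
    finally show "emeasure (distr ?M PS (shifted_path T)) ?C = emeasure (?M \<bind> ?K) ?C" .
  qed simp
  have "(\<integral>\<^sup>+\<omega>. f (shifted_path T \<omega>) \<partial>?M) = (\<integral>\<^sup>+\<omega>. (\<integral>\<^sup>+y. f y \<partial>?K \<omega>) \<partial>?M)"
    by (rule nn_integral_kernel_eq[OF _ K' _ eq]) (use space_N_nonempty in auto)
  also have "\<dots> = (\<integral>\<^sup>+\<omega>. (\<integral>\<^sup>+\<omega>'. f (path \<omega>') \<partial>P (X (enn2real (T \<omega>)) \<omega>)) \<partial>?M)"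
    by (intro nn_integral_cong nn_integral_distr) auto
  finally have *: "(\<integral>\<^sup>+\<omega>. f (shifted_path T \<omega>) \<partial>?M) =
      (\<integral>\<^sup>+\<omega>. (\<integral>\<^sup>+\<omega>'. f (path \<omega>') \<partial>P (X (enn2real (T \<omega>)) \<omega>)) \<partial>?M)" .
  have [measurable]: "(\<lambda>\<omega>. \<integral>\<^sup>+\<omega>'. f (path \<omega>') \<partial>P (X (enn2real (T \<omega>)) \<omega>)) \<in> borel_measurable N"
    by (rule measurable_compose[OF XT measurable_nn_integral_path]) measurable
  show ?thesis
    using * by (subst (asm) (1 2) nn_integral_stopped_law[OF T A]) auto
qed

end

section \<open>Hitting times\<close>

context markov_diffusion
begin

lemma hitting_time_less_iff:
  "hitting_time X A \<omega> < u \<longleftrightarrow> (\<exists>t>0. ennreal t < u \<and> X t \<omega> \<in> A)"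
  unfolding hitting_time_def by (auto simp: INF_less_iff)

lemma hitting_time_le: "0 < t \<Longrightarrow> X t \<omega> \<in> A \<Longrightarrow> hitting_time X A \<omega> \<le> ennreal t"
  unfolding hitting_time_def by (auto intro!: INF_lower2[of t])

lemma not_hit_before: "0 < t \<Longrightarrow> ennreal t < hitting_time X A \<omega> \<Longrightarrow> X t \<omega> \<notin> A"
  using hitting_time_le[of t \<omega> A] by (auto simp: not_le[symmetric])

lemma hitting_time_antimono: "A \<subseteq> B \<Longrightarrow> hitting_time X B \<omega> \<le> hitting_time X A \<omega>"
  unfolding hitting_time_def by (rule INF_superset_mono) auto

lemma continuous_X_within: "\<omega> \<in> space N \<Longrightarrow> 0 \<le> t \<Longrightarrow> ((\<lambda>t. X t \<omega>) \<longlongrightarrow> X t \<omega>) (at t within {0..})"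
  using continuous_X by (auto simp: continuous_on_def)

lemma X_open_near:
  assumes "\<omega> \<in> space N" "0 \<le> t" "X t \<omega> \<in> U" "open U"
  obtains e where "e > 0" "\<And>s. 0 \<le> s \<Longrightarrow> \<bar>s - t\<bar> < e \<Longrightarrow> X s \<omega> \<in> U"
proof -
  have "eventually (\<lambda>s. X s \<omega> \<in> U) (at t within {0..})"
    by (rule topological_tendstoD[OF continuous_X_within[OF assms(1,2)] assms(4,3)])
  then obtain e where "e > 0" "\<And>s. s \<in> {0..} \<Longrightarrow> s \<noteq> t \<Longrightarrow> dist s t < e \<Longrightarrow> X s \<omega> \<in> U"
    by (auto simp: eventually_at)
  then show ?thesis
    using that[of e] assms(3) by (auto simp: dist_real_def)
qed

lemma hitting_time_open_less_iff:
  assumes "open A" "\<omega> \<in> space N"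
  shows "hitting_time X A \<omega> < u \<longleftrightarrow> (\<exists>q\<in>\<rat>. 0 < q \<and> ennreal q < u \<and> X q \<omega> \<in> A)"
proof
  assume "hitting_time X A \<omega> < u"
  then obtain t where t: "0 < t" "ennreal t < u" "X t \<omega> \<in> A"
    by (auto simp: hitting_time_less_iff)
  then obtain e where e: "e > 0" "\<And>s. 0 \<le> s \<Longrightarrow> \<bar>s - t\<bar> < e \<Longrightarrow> X s \<omega> \<in> A"
    using X_open_near[OF assms(2) _ t(3) assms(1)] t(1) by (metis less_imp_le)
  obtain q where "q \<in> \<rat>" "max 0 (t - e) < q" "q < t"
    using Rats_dense_in_real[of "max 0 (t - e)" t] t(1) e(1) by auto
  then show "\<exists>q\<in>\<rat>. 0 < q \<and> ennreal q < u \<and> X q \<omega> \<in> A"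
    using e(2)[of q] t(2) by (intro bexI[of _ q]) (auto intro!: le_less_trans[OF ennreal_leI t(2)])
qed (auto simp: hitting_time_less_iff)

lemma stopping_time_hitting_open:
  assumes "open A"
  shows "stopping_time \<R> (hitting_time X A)"
proof (rule stopping_timeI')
  fix u
  have "{\<omega>\<in>space N. hitting_time X A \<omega> < u} = (\<Union>q\<in>{q\<in>\<rat>. 0 < q \<and> ennreal q < u}. X q -` A \<inter> space (\<G> u))"
    using hitting_time_open_less_iff[OF assms] by auto
  also have "\<dots> \<in> sets (\<G> u)"
    using assms by (intro sets.countable_UN'' countable_Collect countable_rat measurable_sets[OF measurable_X_nat]) auto
  finally show "{\<omega>\<in>space N. hitting_time X A \<omega> < u} \<in> sets (\<G> u)" .
qed

text \<open>Along a continuous path the distance to C attains its minimum on the compact interval,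
  so visits to arbitrarily small neighbourhoods at rational times force a true visit.
  \<open>C\<close> has to be nonempty because \<open>infdist\<close> to the empty set is 0.\<close>

lemma hits_closed_iff:
  assumes C: "closed C" "C \<noteq> {}" and \<omega>: "\<omega> \<in> space N" and ab: "0 \<le> a" "a < b"
  shows "(\<exists>t\<in>{a..b}. X t \<omega> \<in> C) \<longleftrightarrow> (\<forall>k::nat. \<exists>q\<in>\<rat>. a \<le> q \<and> q \<le> b \<and> infdist (X q \<omega>) C < 1 / Suc k)"
proof
  assume "\<exists>t\<in>{a..b}. X t \<omega> \<in> C"
  then obtain t where t: "t \<in> {a..b}" "X t \<omega> \<in> C" by auto
  show "\<forall>k::nat. \<exists>q\<in>\<rat>. a \<le> q \<and> q \<le> b \<and> infdist (X q \<omega>) C < 1 / Suc k"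
  proof
    fix k :: nat
    obtain e where e: "e > 0" "\<And>s. 0 \<le> s \<Longrightarrow> \<bar>s - t\<bar> < e \<Longrightarrow> X s \<omega> \<in> ball (X t \<omega>) (1 / Suc k)"
      using X_open_near[OF \<omega>, of t "ball (X t \<omega>) (1 / Suc k)"] t ab by (auto simp del: mem_ball)
    have "max a (t - e) < min b (t + e)" using t ab e(1) by auto
    then obtain q where q: "q \<in> \<rat>" "max a (t - e) < q" "q < min b (t + e)"
      using Rats_dense_in_real by blast
    then have "X q \<omega> \<in> ball (X t \<omega>) (1 / Suc k)" using ab by (intro e(2)) auto
    then have "infdist (X q \<omega>) C < 1 / Suc k"
      using infdist_le[OF t(2), of "X q \<omega>"] by (simp add: dist_commute)
    then show "\<exists>q\<in>\<rat>. a \<le> q \<and> q \<le> b \<and> infdist (X q \<omega>) C < 1 / Suc k"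
      using q by (intro bexI[of _ q]) auto
  qed
next
  assume R: "\<forall>k::nat. \<exists>q\<in>\<rat>. a \<le> q \<and> q \<le> b \<and> infdist (X q \<omega>) C < 1 / Suc k"
  have "continuous_on {a..b} (\<lambda>t. infdist (X t \<omega>) C)"
    using ab by (intro continuous_on_infdist continuous_on_subset[OF continuous_X[OF \<omega>]]) auto
  then obtain t where t: "t \<in> {a..b}" "\<And>s. s \<in> {a..b} \<Longrightarrow> infdist (X t \<omega>) C \<le> infdist (X s \<omega>) C"
    using continuous_attains_inf[of "{a..b}" "\<lambda>t. infdist (X t \<omega>) C"] ab by auto
  have "infdist (X t \<omega>) C \<le> 0"
  proof (rule ccontr)
    assume "\<not> infdist (X t \<omega>) C \<le> 0"
    then obtain k where "1 / Suc k < infdist (X t \<omega>) C"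
      using nat_approx_posE[of "infdist (X t \<omega>) C"] by auto
    moreover obtain q where "a \<le> q" "q \<le> b" "infdist (X q \<omega>) C < 1 / Suc k"
      using R by blast
    ultimately show False using t(2)[of q] by auto
  qed
  then have "X t \<omega> \<in> C"
    using C infdist_nonneg[of "X t \<omega>" C] by (auto simp: in_closed_iff_infdist_zero)
  with t show "\<exists>t\<in>{a..b}. X t \<omega> \<in> C" by auto
qed

lemma stopping_time_hitting_closed:
  assumes "closed C"
  shows "stopping_time \<R> (hitting_time X C)"
proof (cases "C = {}")
  case True
  then have "hitting_time X C = (\<lambda>_. \<infinity>)" by (auto simp: hitting_time_def)
  then show ?thesis by (simp add: stopping_time_const)
next
  case False
  show ?thesis
  proof (rule stopping_timeI')
    fix u
    \<comment> \<open>A visit at t with 0 < t < u is enclosed in a rational interval [a, b] with 0 <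
      a and b < u, so countably many compact intervals suffice.\<close>
    let ?I = "{(a, b). a \<in> \<rat> \<and> b \<in> \<rat> \<and> 0 < a \<and> a < b \<and> ennreal b < u}"
    have "{\<omega>\<in>space N. hitting_time X C \<omega> < u} =
      (\<Union>(a, b)\<in>?I. \<Inter>k::nat. \<Union>q\<in>{q\<in>\<rat>. a \<le> q \<and> q \<le> b}. {\<omega>\<in>space (\<G> u). infdist (X q \<omega>) C < 1 / Suc k})"
      (is "?L = ?R")
    proof (intro set_eqI iffI)
      fix \<omega> assume "\<omega> \<in> ?L"
      then obtain t where \<omega>: "\<omega> \<in> space N" and t: "0 < t" "ennreal t < u" "X t \<omega> \<in> C"
        by (auto simp: hitting_time_less_iff)
      obtain a where a: "a \<in> \<rat>" "0 < a" "a < t" using Rats_dense_in_real[OF t(1)] by auto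
      obtain b where b: "b \<in> \<rat>" "t < b" "ennreal b < u"
      proof (cases u)
        case (real r)
        then have "t < r" using t by (simp add: ennreal_less_iff)
        then obtain b where "b \<in> \<rat>" "t < b" "b < r" using Rats_dense_in_real by blast
        then show ?thesis using that[of b] t(1) real by (simp add: ennreal_less_iff)
      next
        case top
        obtain b where "b \<in> \<rat>" "t < b" using Rats_dense_in_real[of t "t + 1"] by auto
        then show ?thesis using that top by simp
      qed
      have "(a, b) \<in> ?I" using a b by auto
      moreover have "\<exists>t\<in>{a..b}. X t \<omega> \<in> C" using a b t by (intro bexI[of _ t]) auto
      ultimately show "\<omega> \<in> ?R"
        using hits_closed_iff[OF assms False \<omega>, of a b] a b \<omega> by fastforce
    next
      fix \<omega> assume "\<omega> \<in> ?R"
      then obtain a b where \<omega>: "\<omega> \<in> space N" and ab: "0 < a" "a < b" "ennreal b < u"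
        "\<forall>k::nat. \<exists>q\<in>\<rat>. a \<le> q \<and> q \<le> b \<and> infdist (X q \<omega>) C < 1 / Suc k"
        by fastforce
      then obtain t where "t \<in> {a..b}" "X t \<omega> \<in> C"
        using hits_closed_iff[OF assms False \<omega>, of a b] by auto
      then show "\<omega> \<in> ?L"
        using \<omega> ab by (auto simp: hitting_time_less_iff intro!: exI[of _ t] le_less_trans[OF ennreal_leI ab(3)])
    qed
    also have "\<dots> \<in> sets (\<G> u)"
    proof -
      have "countable ?I"
        by (rule countable_subset[of _ "\<rat> \<times> \<rat>"]) (auto intro: countable_rat)
      moreover have "{\<omega>\<in>space (\<G> u). infdist (X q \<omega>) C < 1 / Suc k} \<in> sets (\<G> u)"
        if "0 < a" "a \<le> q" "q \<le> b" "ennreal b < u" for a b q k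
      proof -
        have [measurable]: "X q \<in> \<G> u \<rightarrow>\<^sub>M borel"
          using that by (intro measurable_X_nat) (auto intro: order_trans[OF ennreal_leI less_imp_le])
        have [measurable]: "(\<lambda>x. infdist x C) \<in> borel_measurable borel"
          by (intro borel_measurable_continuous_onI continuous_on_infdist continuous_on_id)
        show ?thesis by measurable
      qed
      then have "(\<Inter>k::nat. \<Union>q\<in>{q\<in>\<rat>. a \<le> q \<and> q \<le> b}. {\<omega>\<in>space (\<G> u). infdist (X q \<omega>) C < 1 / Suc k}) \<in> sets (\<G> u)"
        if "0 < a" "ennreal b < u" for a b
        using that
        by (intro sets.countable_INT image_subsetI sets.countable_UN'' countable_Collect countable_rat) auto
      ultimately show ?thesis
        by (intro sets.countable_UN'') auto
    qed
    finally show "{\<omega>\<in>space N. hitting_time X C \<omega> < u} \<in> sets (\<G> u)" .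
  qed
qed

lemma hit_closure:
  assumes \<omega>: "\<omega> \<in> space N" and fin: "hitting_time X A \<omega> < \<infinity>"
  shows "X (enn2real (hitting_time X A \<omega>)) \<omega> \<in> closure A"
proof (rule ccontr)
  define \<tau> where "\<tau> = enn2real (hitting_time X A \<omega>)"
  have \<tau>: "0 \<le> \<tau>" "hitting_time X A \<omega> = ennreal \<tau>" using fin by (auto simp: \<tau>_def)
  assume "X (enn2real (hitting_time X A \<omega>)) \<omega> \<notin> closure A"
  then obtain e where e: "e > 0" "\<And>s. 0 \<le> s \<Longrightarrow> \<bar>s - \<tau>\<bar> < e \<Longrightarrow> X s \<omega> \<in> - closure A"
    using X_open_near[OF \<omega> \<tau>(1), of "- closure A"] by (auto simp: \<tau>_def)
  have "hitting_time X A \<omega> < ennreal (\<tau> + e)" using \<tau> e(1) by (simp add: ennreal_less_iff)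
  then obtain t where t: "0 < t" "ennreal t < ennreal (\<tau> + e)" "X t \<omega> \<in> A"
    by (auto simp: hitting_time_less_iff)
  have "ennreal \<tau> \<le> ennreal t" using hitting_time_le[OF t(1,3)] \<tau> by simp
  then have "\<tau> \<le> t" "t < \<tau> + e" using t(1,2) \<tau>(1) e(1)
    by (auto simp: ennreal_less_iff simp flip: ennreal_plus)
  then have "X t \<omega> \<in> - closure A" using t(1) by (intro e(2)) auto
  then show False using t(3) closure_subset by auto
qed

text \<open>Together with \<open>hit_closure\<close>: a path that starts outside an open set first
  meets it on the boundary. Hence \<open>green_hit_le\<close> asks for a bound on the boundary
  only.\<close>

lemma not_hit_open:
  assumes \<omega>: "\<omega> \<in> space N" and fin: "hitting_time X A \<omega> < \<infinity>" and A: "open A" and "X 0 \<omega> \<notin> A"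
  shows "X (enn2real (hitting_time X A \<omega>)) \<omega> \<notin> A"
proof
  define \<tau> where "\<tau> = enn2real (hitting_time X A \<omega>)"
  have \<tau>: "0 \<le> \<tau>" "hitting_time X A \<omega> = ennreal \<tau>" using fin by (auto simp: \<tau>_def)
  assume X: "X (enn2real (hitting_time X A \<omega>)) \<omega> \<in> A"
  then have "\<tau> > 0" using assms(4) \<tau>(1) by (cases "\<tau> = 0") (auto simp: \<tau>_def less_le)
  obtain e where e: "e > 0" "\<And>s. 0 \<le> s \<Longrightarrow> \<bar>s - \<tau>\<bar> < e \<Longrightarrow> X s \<omega> \<in> A"
    using X_open_near[OF \<omega> \<tau>(1) _ A] X by (auto simp: \<tau>_def)
  define s where "s = max (\<tau> / 2) (\<tau> - e / 2)"
  have "0 < s" "s < \<tau>" "\<bar>s - \<tau>\<bar> < e" using \<open>\<tau> > 0\<close> e(1) by (auto simp: s_def)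
  then show False
    using e(2)[of s] not_hit_before[of s A \<omega>] \<tau> by (simp add: ennreal_less_iff)
qed

end

section \<open>The Green operator of a killed diffusion\<close>

context markov_diffusion
begin

text \<open>The limit inferior along dyadic times makes \<open>occ\<close> measurable on the product space of all paths;
  on continuous paths it is the integrand of \<open>occ_rate_continuous\<close>.\<close>

definition occ_rate :: "'a set \<Rightarrow> ('a \<Rightarrow> real) \<Rightarrow> (real \<Rightarrow> 'a) \<Rightarrow> real \<Rightarrow> ennreal" where
  "occ_rate F f w t =
     (if 0 \<le> t \<and> (\<forall>q\<in>\<rat>. 0 \<le> q \<longrightarrow> q \<le> t \<longrightarrow> w q \<in> F)
      then liminf (\<lambda>n. ennreal (f (w (real (Suc (nat \<lfloor>2^n * t\<rfloor>)) / 2^n)))) else 0)"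

definition occ :: "'a set \<Rightarrow> ('a \<Rightarrow> real) \<Rightarrow> (real \<Rightarrow> 'a) \<Rightarrow> ennreal" where
  "occ F f w = (\<integral>\<^sup>+t. occ_rate F f w t \<partial>lborel)"

definition green :: "'a set \<Rightarrow> ('a \<Rightarrow> real) \<Rightarrow> 'a \<Rightarrow> ennreal" where
  "green F f z = (\<integral>\<^sup>+\<omega>. occ F f (path \<omega>) \<partial>P z)"

lemma measurable_occ_rate:
  assumes [measurable]: "F \<in> sets borel" "f \<in> borel_measurable borel"
  shows "(\<lambda>(w, t). occ_rate F f w t) \<in> borel_measurable (PS \<Otimes>\<^sub>M borel)"
proof -
  have [measurable]: "(\<lambda>p. fst p q) \<in> PS \<Otimes>\<^sub>M (borel :: real measure) \<rightarrow>\<^sub>M borel" for q :: real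
    by (rule measurable_compose[OF measurable_fst measurable_component_singleton]) simp
  have [measurable]: "(\<lambda>p. ennreal (f (fst p (real (Suc (nat \<lfloor>(2::real)^n * snd p\<rfloor>)) / 2^n)))) \<in> borel_measurable (PS \<Otimes>\<^sub>M borel)" for n
    by (rule measurable_compose_countable[where f="\<lambda>i p. ennreal (f (fst p (real (Suc i) / 2^n)))" and
          g="\<lambda>p. nat \<lfloor>(2::real)^n * snd p\<rfloor>"]) measurable
  have [measurable]: "Measurable.pred (PS \<Otimes>\<^sub>M borel) (\<lambda>p. \<forall>q\<in>\<rat>. 0 \<le> q \<longrightarrow> q \<le> snd p \<longrightarrow> fst p q \<in> F)"
    by (intro measurable_pred_countable countable_rat) measurable
  show ?thesis
    unfolding occ_rate_def case_prod_beta' by measurable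
qed

lemma measurable_occ_rate1:
  assumes "F \<in> sets borel" "f \<in> borel_measurable borel"
  shows "occ_rate F f w \<in> borel_measurable borel"
  using measurable_compose[OF measurable_Pair1'[of w PS borel] measurable_occ_rate[OF assms]]
  by (simp add: space_PiM PiE_UNIV_domain)

lemma measurable_occ:
  assumes [measurable]: "F \<in> sets borel" "f \<in> borel_measurable borel"
  shows "occ F f \<in> borel_measurable PS"
  unfolding occ_def[abs_def]
proof (rule lborel.borel_measurable_nn_integral)
  show "(\<lambda>(w, t). occ_rate F f w t) \<in> borel_measurable (PS \<Otimes>\<^sub>M lborel)"
    using measurable_occ_rate[OF assms]
    by (subst measurable_cong_sets[OF sets_pair_measure_cong[OF refl sets_lborel] refl])
qed

lemma measurable_green:
  assumes "F \<in> sets borel" "f \<in> borel_measurable borel"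
  shows "green F f \<in> borel_measurable borel"
  unfolding green_def[abs_def] by (rule measurable_nn_integral_path[OF measurable_occ[OF assms]])

text \<open>A path outside the closed F at time s is outside it at all nearby times. The rational
  witness is taken before s, so that it does not exceed t.\<close>

lemma rat_stays_iff:
  fixes w :: "real \<Rightarrow> 'a"
  assumes w: "continuous_on {0..} w" and F: "closed F" and t: "0 \<le> t"
  shows "(\<forall>q\<in>\<rat>. 0 \<le> q \<longrightarrow> q \<le> t \<longrightarrow> w q \<in> F) \<longleftrightarrow> (\<forall>s\<in>{0..t}. w s \<in> F)"
proof (intro iffI ballI impI)
  fix s assume R: "\<forall>q\<in>\<rat>. 0 \<le> q \<longrightarrow> q \<le> t \<longrightarrow> w q \<in> F" and s: "s \<in> {0..t}"
  show "w s \<in> F"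
  proof (cases "s = 0")
    case True
    then show ?thesis using bspec[OF R Rats_0] t True by simp
  next
    case False
    then have "s > 0" using s by auto
    show ?thesis
    proof (rule ccontr)
      assume "w s \<notin> F"
      have "(w \<longlongrightarrow> w s) (at s within {0..})"
        using w s by (auto simp: continuous_on_def)
      then have "eventually (\<lambda>q. w q \<in> - F) (at s within {0..})"
        by (rule topological_tendstoD) (use F \<open>w s \<notin> F\<close> in auto)
      then obtain e where e: "e > 0" "\<And>q. 0 \<le> q \<Longrightarrow> q \<noteq> s \<Longrightarrow> \<bar>q - s\<bar> < e \<Longrightarrow> w q \<notin> F"
        by (auto simp: eventually_at dist_real_def)
      obtain q where "q \<in> \<rat>" "max 0 (s - e) < q" "q < s"
        using Rats_dense_in_real[of "max 0 (s - e)" s] e(1) \<open>s > 0\<close> by auto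
      then show False using R s e(2)[of q] by auto
    qed
  qed
qed auto

lemma occ_rate_continuous:
  assumes w: "continuous_on {0..} w" and F: "closed F" and f: "continuous_on UNIV f"
  shows "occ_rate F f w t = (if 0 \<le> t \<and> (\<forall>s\<in>{0..t}. w s \<in> F) then ennreal (f (w t)) else 0)"
proof (cases "0 \<le> t")
  case True
  have "(\<lambda>n. w (real (Suc (nat \<lfloor>2^n * t\<rfloor>)) / 2^n)) \<longlonglongrightarrow> w t"
    by (rule continuous_on_tendsto_compose[OF w LIMSEQ_dyadic[OF True]]) (use True in auto)
  then have "(\<lambda>n. f (w (real (Suc (nat \<lfloor>2^n * t\<rfloor>)) / 2^n))) \<longlonglongrightarrow> f (w t)"
    by (rule continuous_on_tendsto_compose[OF f]) auto
  then have "(\<lambda>n. ennreal (f (w (real (Suc (nat \<lfloor>2^n * t\<rfloor>)) / 2^n)))) \<longlonglongrightarrow> ennreal (f (w t))"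
    by (rule tendsto_ennrealI)
  then have "liminf (\<lambda>n. ennreal (f (w (real (Suc (nat \<lfloor>2^n * t\<rfloor>)) / 2^n)))) = ennreal (f (w t))"
    by (rule lim_imp_Liminf[rotated]) simp
  then show ?thesis
    using rat_stays_iff[OF w F True] True by (simp add: occ_rate_def)
qed (simp add: occ_rate_def)

lemma continuous_path: "\<omega> \<in> space N \<Longrightarrow> continuous_on {0..} (path \<omega>)"
  using continuous_X[of \<omega>] by (subst continuous_on_cong[OF refl, of _ _ "\<lambda>t. X t \<omega>"]) (auto simp: path_def max_def)

lemma occ_eq_0:
  assumes "continuous_on {0..} w" "closed F" "continuous_on UNIV f"
    and "\<And>t. 0 \<le> t \<Longrightarrow> f (w t) = 0"
  shows "occ F f w = 0"
proof -
  have "occ_rate F f w t = 0" for t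
    unfolding occ_rate_continuous[OF assms(1-3)] using assms(4)[of t] by simp
  then show ?thesis by (simp add: occ_def)
qed

text \<open>Substitute t = \<tau> + x in the time integral. Negative x contribute nothing because f
  vanishes along w before \<tau>, and survival up to \<tau> + x splits into survival up to \<tau>
  and survival of the shifted path up to x.\<close>

lemma occ_shift:
  assumes w: "continuous_on {0..} w" and F: "closed F" and f: "continuous_on UNIV f"
    and \<tau>: "0 \<le> \<tau>" and z: "\<And>t. 0 \<le> t \<Longrightarrow> t < \<tau> \<Longrightarrow> f (w t) = 0"
  shows "occ F f w = (if \<forall>s\<in>{0..\<tau>}. w s \<in> F then occ F f (\<lambda>s. w (\<tau> + max 0 s)) else 0)"
proof -
  let ?w = "\<lambda>s. w (\<tau> + max 0 s)"
  have w': "continuous_on {0..} ?w"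
    using \<tau> by (intro continuous_on_compose2[OF w] continuous_intros) auto
  have "occ_rate F f w (\<tau> + x) = (if \<forall>s\<in>{0..\<tau>}. w s \<in> F then occ_rate F f ?w x else 0)" for x
  proof (cases "0 \<le> x")
    case True
    have "(\<forall>s\<in>{0..\<tau> + x}. w s \<in> F) \<longleftrightarrow> (\<forall>s\<in>{0..\<tau>}. w s \<in> F) \<and> (\<forall>s\<in>{0..x}. ?w s \<in> F)"
    proof (intro iffI conjI ballI)
      fix s assume H: "(\<forall>s\<in>{0..\<tau>}. w s \<in> F) \<and> (\<forall>s\<in>{0..x}. ?w s \<in> F)" and s: "s \<in> {0..\<tau> + x}"
      show "w s \<in> F"
      proof (cases "s \<le> \<tau>")
        case False
        then have "s - \<tau> \<in> {0..x}" using s by auto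
        then have "?w (s - \<tau>) \<in> F" using H by blast
        then show ?thesis using False by (simp add: max_def)
      qed (use H s in auto)
    qed (use True \<tau> in \<open>auto simp: max_def\<close>)
    then show ?thesis
      unfolding occ_rate_continuous[OF w F f] occ_rate_continuous[OF w' F f] using True \<tau> by simp
  next
    case False
    then show ?thesis
      unfolding occ_rate_continuous[OF w F f] occ_rate_continuous[OF w' F f] using z[of "\<tau> + x"] by auto
  qed
  moreover have "occ_rate F f w \<in> borel_measurable borel"
    by (intro measurable_occ_rate1 borel_measurable_continuous_onI f) (use F in auto)
  ultimately have eq: "occ F f w = (\<integral>\<^sup>+x. (if \<forall>s\<in>{0..\<tau>}. w s \<in> F then occ_rate F f ?w x else 0) \<partial>lborel)"
    unfolding occ_def by (subst nn_integral_real_affine[where c=1 and t=\<tau>]) simp_all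
  show ?thesis
  proof (cases "\<forall>s\<in>{0..\<tau>}. w s \<in> F")
    case True
    show ?thesis unfolding eq if_P[OF True] unfolding occ_def ..
  next
    case False
    show ?thesis unfolding eq if_not_P[OF False] by simp
  qed
qed

lemma stays_before_exit:
  assumes D: "open D" and \<omega>: "\<omega> \<in> space N" and X0: "X 0 \<omega> \<in> D" and "0 \<le> t" "ennreal t < exit_time X D \<omega>"
  shows "X t \<omega> \<in> D"
  using assms not_hit_before[of t "- D" \<omega>] by (cases "t = 0") (auto simp: exit_time_def)

text \<open>Before its exit the path is in D \<subseteq> F, where f is 0, and at the exit time it is
  still in F because F is closed. So up to then nothing is collected and the path is not
  killed.\<close>

lemma occ_path_exit:
  assumes D: "open D" "D \<subseteq> F" and F: "closed F" and f: "continuous_on UNIV f"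
    and fD: "\<And>x. x \<in> D \<Longrightarrow> f x = 0" and \<omega>: "\<omega> \<in> space N" and X0: "X 0 \<omega> \<in> D"
  shows "occ F f (path \<omega>) =
    (if exit_time X D \<omega> < \<infinity> then occ F f (shifted_path (exit_time X D) \<omega>) else 0)"
proof (cases "exit_time X D \<omega> < \<infinity>")
  case False
  then have "exit_time X D \<omega> = top" by (simp add: less_top[symmetric])
  then have "f (path \<omega> t) = 0" if "0 \<le> t" for t
    using stays_before_exit[OF D(1) \<omega> X0 that] fD that by (auto simp: path_def max_def)
  then show ?thesis
    using False by (simp add: occ_eq_0[OF continuous_path[OF \<omega>] F f])
next
  case True
  define \<tau> where "\<tau> = enn2real (exit_time X D \<omega>)"
  have \<tau>: "0 \<le> \<tau>" "exit_time X D \<omega> = ennreal \<tau>" using True by (auto simp: \<tau>_def)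
  have D': "X t \<omega> \<in> D" if "0 \<le> t" "t < \<tau>" for t
    using stays_before_exit[OF D(1) \<omega> X0 that(1)] that \<tau> by (auto simp: ennreal_less_iff)
  have "path \<omega> s \<in> F" if s: "s \<in> {0..\<tau>}" for s
  proof (rule ccontr)
    assume a: "path \<omega> s \<notin> F"
    then have X: "X s \<omega> \<in> - F" using s by (auto simp: path_def max_def)
    then have "s \<noteq> 0" using X0 D(2) by auto
    then have "s > 0" using s by auto
    obtain e where e: "e > 0" "\<And>u. 0 \<le> u \<Longrightarrow> \<bar>u - s\<bar> < e \<Longrightarrow> X u \<omega> \<in> - F"
      using X_open_near[OF \<omega> _ X] F s by auto
    define u where "u = max (s / 2) (s - e / 2)"
    have "0 \<le> u" "u < s" "\<bar>u - s\<bar> < e" using \<open>s > 0\<close> e(1) by (auto simp: u_def)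
    then show False using e(2)[of u] D'[of u] s D(2) by auto
  qed
  moreover have "(\<lambda>s. path \<omega> (\<tau> + max 0 s)) = shifted_path (exit_time X D) \<omega>"
    using \<tau>(1) by (auto simp: path_def shifted_path_def \<tau>_def fun_eq_iff)
  moreover have "f (path \<omega> t) = 0" if "0 \<le> t" "t < \<tau>" for t
    using D'[OF that] fD that by (auto simp: path_def max_def)
  ultimately show ?thesis
    using True by (subst occ_shift[OF continuous_path[OF \<omega>] F f \<tau>(1)]) auto
qed

text \<open>As F \<subseteq> D, the path is killed no later than it exits D, and until then it
  collects at rate at most 1. Integrated, this makes \<open>green\<close> finite wherever mean exit
  times are.\<close>

lemma occ_le_exit:
  assumes F: "closed F" "F \<subseteq> D" and f: "continuous_on UNIV f" "\<And>x. f x \<le> 1" and \<omega>: "\<omega> \<in> space N"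
  shows "occ F f (path \<omega>) \<le> exit_time X D \<omega>"
proof (cases "exit_time X D \<omega> < \<infinity>")
  case True
  define \<tau> where "\<tau> = enn2real (exit_time X D \<omega>)"
  have \<tau>: "0 \<le> \<tau>" "exit_time X D \<omega> = ennreal \<tau>" using True by (auto simp: \<tau>_def)
  have "occ_rate F f (path \<omega>) t \<le> indicator {0..\<tau>} t" for t
  proof (cases "0 \<le> t \<and> (\<forall>s\<in>{0..t}. path \<omega> s \<in> F)")
    case True
    have "t \<le> \<tau>"
    proof (rule ccontr)
      assume "\<not> t \<le> \<tau>"
      then have "hitting_time X (- D) \<omega> < ennreal t"
        using \<tau> by (simp add: exit_time_def ennreal_less_iff)
      then obtain s where "0 < s" "ennreal s < ennreal t" "X s \<omega> \<in> - D"
        by (auto simp: hitting_time_less_iff)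
      then show False using True F(2) by (auto simp: ennreal_less_iff path_def max_def dest!: bspec[of _ _ s])
    qed
    then show ?thesis
      using True f(2)[of "path \<omega> t"] unfolding occ_rate_continuous[OF continuous_path[OF \<omega>] F(1) f(1)]
      by (auto simp: ennreal_le_1)
  next
    case False
    then show ?thesis unfolding occ_rate_continuous[OF continuous_path[OF \<omega>] F(1) f(1)] by auto
  qed
  then have "occ F f (path \<omega>) \<le> (\<integral>\<^sup>+t. indicator {0..\<tau>} t \<partial>lborel)"
    unfolding occ_def by (intro nn_integral_mono)
  also have "\<dots> = ennreal \<tau>" using \<tau>(1) by simp
  finally show ?thesis using \<tau>(2) by simp
qed (simp add: less_top[symmetric])

lemma green_le_mean_exit:
  assumes "closed F" "F \<subseteq> ball z \<rho>" "continuous_on UNIV f" "\<And>x. f x \<le> 1"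
  shows "green F f z \<le> mean_exit_time P X z \<rho>"
  unfolding green_def mean_exit_time_def
  by (intro nn_integral_mono occ_le_exit assms) simp

lemma green_outside:
  assumes "closed F" "continuous_on UNIV f" "z \<notin> F"
  shows "green F f z = 0"
proof -
  have "AE \<omega> in P z. occ F f (path \<omega>) = 0"
    using AE_X_0[of z] AE_space
  proof eventually_elim
    fix \<omega> assume \<omega>: "X 0 \<omega> = z" "\<omega> \<in> space (P z)"
    then have \<omega>': "\<omega> \<in> space N" by simp
    have "occ_rate F f (path \<omega>) t = 0" for t
      unfolding occ_rate_continuous[OF continuous_path[OF \<omega>'] assms(1,2)]
      using assms(3) \<omega>(1) by (auto simp: path_def dest!: bspec[of _ _ 0])
    then show "occ F f (path \<omega>) = 0" by (simp add: occ_def)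
  qed
  then have "green F f z = (\<integral>\<^sup>+\<omega>. 0 \<partial>P z)"
    unfolding green_def by (rule nn_integral_cong_AE)
  then show ?thesis by simp
qed

text \<open>Strong Markov property at the exit from D, before which f collects nothing. This is the
  mean value property behind \<open>harmonic_green\<close>, where finiteness allows the passage from
  \<open>ennreal\<close> to real values.\<close>

lemma green_exit:
  assumes D: "open D" "D \<subseteq> F" and F: "closed F" and f: "continuous_on UNIV f"
    and fD: "\<And>x. x \<in> D \<Longrightarrow> f x = 0" and z: "z \<in> D"
  shows "green F f z = (\<integral>\<^sup>+\<omega>\<in>{\<omega>\<in>space N. exit_time X D \<omega> < \<infinity>}. green F f (X (enn2real (exit_time X D \<omega>)) \<omega>) \<partial>P z)"
proof -
  let ?T = "exit_time X D"
  have T: "stopping_time \<R> ?T"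
    using D(1) unfolding exit_time_def by (intro stopping_time_hitting_closed) auto
  have top: "space N \<in> sets (right.pre_sigma ?T)"
    using sets.top[of "right.pre_sigma ?T"] by (simp add: right.space_pre_sigma)
  have "green F f z = (\<integral>\<^sup>+\<omega>\<in>{\<omega>\<in>space N. ?T \<omega> < \<infinity>}. occ F f (shifted_path ?T \<omega>) \<partial>P z)"
    unfolding green_def
  proof (rule nn_integral_cong_AE)
    show "AE \<omega> in P z. occ F f (path \<omega>) =
        occ F f (shifted_path ?T \<omega>) * indicator {\<omega>\<in>space N. ?T \<omega> < \<infinity>} \<omega>"
      using AE_X_0[of z] AE_space
      by eventually_elim (use z in \<open>auto simp: occ_path_exit[OF D F f fD] indicator_def\<close>)
  qed
  also have "\<dots> = (\<integral>\<^sup>+\<omega>\<in>{\<omega>\<in>space N. ?T \<omega> < \<infinity>}. green F f (X (enn2real (?T \<omega>)) \<omega>) \<partial>P z)"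
    unfolding green_def using F f
    by (intro strong_markov_path[OF T top]) (auto intro!: measurable_occ borel_measurable_continuous_onI)
  finally show ?thesis .
qed

lemma harmonic_green:
  assumes D: "open D" "D \<subseteq> F" and F: "closed F" and f: "continuous_on UNIV f"
    and fD: "\<And>x. x \<in> D \<Longrightarrow> f x = 0" and fin: "\<And>z. green F f z < \<infinity>"
  shows "harmonic_in P X D (\<lambda>z. enn2real (green F f z))"
  unfolding harmonic_in_def
proof (intro conjI ballI)
  have [measurable]: "green F f \<in> borel_measurable borel"
    by (intro measurable_green borel_measurable_continuous_onI f) (use F in auto)
  show "(\<lambda>z. enn2real (green F f z)) \<in> borel_measurable borel" by measurable
  let ?T = "exit_time X D"
  have T: "stopping_time \<R> ?T"
    using D(1) unfolding exit_time_def by (intro stopping_time_hitting_closed) auto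
  note [measurable] = measurable_X_stopped[OF T order_refl, simplified] measurable_stopping_time_N[OF T]
  let ?v = "exit_value X D (\<lambda>z. enn2real (green F f z))"
  fix z assume z: "z \<in> D"
  have [measurable]: "?v \<in> borel_measurable (P z)"
    unfolding exit_value_def[abs_def] by measurable
  have nn: "0 \<le> ?v \<omega>" for \<omega> by (simp add: exit_value_def)
  have "(\<integral>\<^sup>+\<omega>. ennreal (?v \<omega>) \<partial>P z) =
      (\<integral>\<^sup>+\<omega>\<in>{\<omega>\<in>space N. exit_time X D \<omega> < \<infinity>}. green F f (X (enn2real (exit_time X D \<omega>)) \<omega>) \<partial>P z)"
    using fin by (intro nn_integral_cong) (auto simp: exit_value_def indicator_def)
  then have eq: "(\<integral>\<^sup>+\<omega>. ennreal (?v \<omega>) \<partial>P z) = green F f z"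
    using green_exit[OF D F f fD z] by simp
  show "integrable (P z) ?v"
    using fin[of z] eq nn by (intro integrableI_nonneg) auto
  show "enn2real (green F f z) = (\<integral>\<omega>. ?v \<omega> \<partial>P z)"
    using eq nn by (subst integral_eq_nn_integral) auto
qed

text \<open>Only paths that hit A before being killed collect anything, and they collect it after
  the hit. The strong Markov property restarts them on the boundary of A, where the expected gain is
  at most m.\<close>

lemma green_hit_le:
  assumes A: "open A" "closure A \<subseteq> interior F" and F: "closed F" and f: "continuous_on UNIV f"
    and fA: "\<And>x. x \<notin> A \<Longrightarrow> f x = 0" and z: "z \<notin> A"
    and m: "\<And>x. x \<in> closure A \<Longrightarrow> x \<notin> A \<Longrightarrow> green F f x \<le> m"
  shows "green F f z \<le> m * emeasure (P z) {\<omega>\<in>space N. hitting_time X A \<omega> < hitting_time X (- F) \<omega>}"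
proof -
  let ?T = "hitting_time X A" and ?S = "hitting_time X (- F)"
  let ?B = "{\<omega>\<in>space N. ?T \<omega> < ?S \<omega>}"
  have T: "stopping_time \<R> ?T" using A(1) by (rule stopping_time_hitting_open)
  have S: "stopping_time \<R> ?S" using F by (intro stopping_time_hitting_open) auto
  have B: "?B \<in> sets (right.pre_sigma ?T)"
    using right.stopping_time_less[OF T S] by (simp add: pred_def right.space_pre_sigma)
  have le: "occ F f (path \<omega>) \<le> occ F f (shifted_path ?T \<omega>) * indicator {\<omega>\<in>?B. ?T \<omega> < \<infinity>} \<omega>"
    if \<omega>: "\<omega> \<in> space N" and X0: "X 0 \<omega> = z" for \<omega>
  proof (cases "?T \<omega> < \<infinity>")
    case False
    then have "?T \<omega> = top" by (simp add: less_top[symmetric])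
    then have "f (path \<omega> t) = 0" if "0 \<le> t" for t
      using not_hit_before[of t A \<omega>] fA that z X0 by (cases "t = 0") (auto simp: path_def max_def)
    then show ?thesis by (simp add: occ_eq_0[OF continuous_path[OF \<omega>] F f])
  next
    case True
    define \<tau> where "\<tau> = enn2real (?T \<omega>)"
    have \<tau>: "0 \<le> \<tau>" "?T \<omega> = ennreal \<tau>" using True by (auto simp: \<tau>_def)
    have "f (path \<omega> t) = 0" if "0 \<le> t" "t < \<tau>" for t
      using not_hit_before[of t A \<omega>] fA that z X0 \<tau> by (cases "t = 0") (auto simp: path_def max_def ennreal_less_iff)
    moreover have "(\<lambda>s. path \<omega> (\<tau> + max 0 s)) = shifted_path ?T \<omega>"
      using \<tau>(1) by (auto simp: path_def shifted_path_def \<tau>_def fun_eq_iff)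
    ultimately have eq: "occ F f (path \<omega>) = (if \<forall>s\<in>{0..\<tau>}. path \<omega> s \<in> F then occ F f (shifted_path ?T \<omega>) else 0)"
      by (subst occ_shift[OF continuous_path[OF \<omega>] F f \<tau>(1)]) auto
    show ?thesis
    proof (cases "\<forall>s\<in>{0..\<tau>}. path \<omega> s \<in> F")
      case stays: True
      \<comment> \<open>Survival up to \<tau> alone gives T \<le> S. Equality is impossible: at T
        the path is in \<open>closure A\<close>, hence in the interior of F, while at S it is in the
        closure of the complement of F.\<close>
      have "?T \<omega> < ?S \<omega>"
      proof (rule ccontr)
        assume n: "\<not> ?T \<omega> < ?S \<omega>"
        then have fin: "?S \<omega> < \<infinity>" using True by (auto simp: not_less)
        define \<sigma> where "\<sigma> = enn2real (?S \<omega>)"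
        have \<sigma>: "0 \<le> \<sigma>" "?S \<omega> = ennreal \<sigma>" using fin by (auto simp: \<sigma>_def)
        have "\<sigma> \<le> \<tau>" using n \<sigma> \<tau> by (auto simp: not_less)
        have "X \<sigma> \<omega> \<in> closure (- F)" using hit_closure[OF \<omega> fin] by (simp add: \<sigma>_def)
        moreover have "X \<tau> \<omega> \<in> interior F" using hit_closure[OF \<omega> True] A(2) by (auto simp: \<tau>_def)
        ultimately have "\<sigma> \<noteq> \<tau>" by (auto simp: closure_complement)
        then have "?S \<omega> < ennreal \<tau>" using \<open>\<sigma> \<le> \<tau>\<close> \<sigma> by (simp add: ennreal_less_iff)
        then obtain s where "0 < s" "ennreal s < ennreal \<tau>" "X s \<omega> \<in> - F"
          by (auto simp: hitting_time_less_iff)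
        then show False using stays by (auto simp: ennreal_less_iff path_def max_def dest!: bspec[of _ _ s])
      qed
      then show ?thesis using eq True \<omega> by (auto simp: indicator_def)
    next
      case False
      show ?thesis unfolding eq if_not_P[OF False] by simp
    qed
  qed
  have B': "{\<omega>\<in>?B. ?T \<omega> < \<infinity>} = ?B" by (auto simp: less_top[symmetric])
  have Bs: "?B \<in> sets N" by (rule pre_sigma_subset[OF T B])
  have "green F f z \<le> (\<integral>\<^sup>+\<omega>\<in>{\<omega>\<in>?B. ?T \<omega> < \<infinity>}. occ F f (shifted_path ?T \<omega>) \<partial>P z)"
    unfolding green_def
  proof (rule nn_integral_mono_AE)
    show "AE \<omega> in P z. occ F f (path \<omega>) \<le> occ F f (shifted_path ?T \<omega>) * indicator {\<omega>\<in>?B. ?T \<omega> < \<infinity>} \<omega>"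
      using AE_X_0[of z] AE_space by eventually_elim (rule le, auto)
  qed
  also have "\<dots> = (\<integral>\<^sup>+\<omega>\<in>{\<omega>\<in>?B. ?T \<omega> < \<infinity>}. green F f (X (enn2real (?T \<omega>)) \<omega>) \<partial>P z)"
    unfolding green_def using F f
    by (intro strong_markov_path[OF T B]) (auto intro!: measurable_occ borel_measurable_continuous_onI)
  also have "\<dots> \<le> (\<integral>\<^sup>+\<omega>. m * indicator ?B \<omega> \<partial>P z)"
  proof (rule nn_integral_mono_AE)
    show "AE \<omega> in P z. green F f (X (enn2real (?T \<omega>)) \<omega>) * indicator {\<omega>\<in>?B. ?T \<omega> < \<infinity>} \<omega> \<le> m * indicator ?B \<omega>"
      using AE_X_0[of z] AE_space
    proof eventually_elim
      fix \<omega> assume \<omega>: "X 0 \<omega> = z" "\<omega> \<in> space (P z)"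
      show "green F f (X (enn2real (?T \<omega>)) \<omega>) * indicator {\<omega>\<in>?B. ?T \<omega> < \<infinity>} \<omega> \<le> m * indicator ?B \<omega>"
        using m hit_closure[of \<omega> A] not_hit_open[of \<omega> A] \<omega> z A(1) by (auto simp: indicator_def)
    qed
  qed
  also have "\<dots> = m * emeasure (P z) ?B"
    using Bs by (subst nn_integral_cmult_indicator) auto
  finally show ?thesis .
qed

end

section \<open>Symmetry of the Green operator\<close>

lemma INF_mult_left_ennreal_decseq:
  fixes c :: ennreal
  assumes "decseq a" "c < top" 
  shows "c * (INF n. a n) = (INF n. c * a n)"
proof -
  have "(\<lambda>n. c * a n) \<longlonglongrightarrow> c * (INF n. a n)"
    using assms by (intro ennreal_tendsto_cmult LIMSEQ_INF)
  moreover have "(\<lambda>n. c * a n) \<longlonglongrightarrow> (INF n. c * a n)"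
    using assms(1) by (intro LIMSEQ_INF) (auto simp: decseq_def intro: mult_left_mono)
  ultimately show ?thesis by (rule LIMSEQ_unique)
qed

lemma radon_finite_nbhd:
  fixes \<mu> :: "'a::{metric_space, second_countable_topology} measure"
  assumes "locally compact (UNIV :: 'a set)" "radon_measure \<mu>"
  obtains U where "open U" "x \<in> U" "emeasure \<mu> U < \<infinity>"
proof -
  obtain U K where UK: "open U" "compact K" "x \<in> U" "U \<subseteq> K"
    using assms(1) unfolding locally_def by (metis UNIV_I open_UNIV openin_open_eq subtopology_UNIV Int_UNIV_left openin_subtopology_self)
  have K: "K \<in> sets \<mu>" "emeasure \<mu> K < \<infinity>"
    using assms(2) UK(2) by (auto simp: radon_measure_def intro: borel_compact)
  have "emeasure \<mu> U \<le> emeasure \<mu> K" using UK K by (intro emeasure_mono) auto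
  then show ?thesis using that[OF UK(1,3)] K(2) by auto
qed

text \<open>By Lindelof's theorem, countably many of the open sets of finite measure already cover
  the space.\<close>

lemma radon_sigma_finite:
  fixes \<mu> :: "'a::{metric_space, second_countable_topology} measure"
  assumes lc: "locally compact (UNIV :: 'a set)" and \<mu>: "radon_measure \<mu>"
  shows "sigma_finite_measure \<mu>"
proof -
  have sets: "sets \<mu> = sets borel" using \<mu> by (simp add: radon_measure_def)
  have "\<Union>{U. open U \<and> emeasure \<mu> U < \<infinity>} = UNIV"
    using radon_finite_nbhd[OF assms] by blast
  moreover obtain A where A: "A \<subseteq> {U. open U \<and> emeasure \<mu> U < \<infinity>}" "countable A"
      "\<Union>A = \<Union>{U. open U \<and> emeasure \<mu> U < \<infinity>}"
    by (rule Lindelof[of "{U. open U \<and> emeasure \<mu> U < \<infinity>}"]) blast+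
  ultimately have A': "\<Union>A = space \<mu>"
    using sets_eq_imp_space_eq[OF sets] by simp
  show ?thesis
  proof (intro sigma_finite_measure.intro exI[of _ A] conjI ballI)
    show "A \<subseteq> sets \<mu>" using A(1) by (auto simp: sets)
    show "emeasure \<mu> a \<noteq> \<infinity>" if "a \<in> A" for a using A(1) that by auto
  qed (fact A A')+
qed

locale symmetric_diffusion = markov_diffusion N P X
  for N :: "'w measure"
    and P :: "'a::{metric_space, second_countable_topology} \<Rightarrow> 'w measure"
    and X :: "real \<Rightarrow> 'w \<Rightarrow> 'a" +
  fixes \<mu> :: "'a measure" and p :: "real \<Rightarrow> 'a \<Rightarrow> 'a \<Rightarrow> real"
  assumes sets_mu[measurable_cong, simp]: "sets \<mu> = sets borel"
    and sigma_finite_mu: "sigma_finite_measure \<mu>"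
    and density: "transition_density \<mu> P X p"
begin

lemma measurable_p: "0 < t \<Longrightarrow> (\<lambda>(x, y). p t x y) \<in> borel_measurable (borel \<Otimes>\<^sub>M borel)"
  and p_sym: "0 < t \<Longrightarrow> p t x y = p t y x"
  and law_X: "0 < t \<Longrightarrow> distr (P x) borel (X t) = density \<mu> (\<lambda>y. ennreal (p t x y))"
  using density by (auto simp: transition_density_def)

sublocale mu: sigma_finite_measure \<mu> by (rule sigma_finite_mu)

lemma mu_Fubini:
  assumes "(\<lambda>(x, y). f x y) \<in> borel_measurable (borel \<Otimes>\<^sub>M borel)"
  shows "(\<integral>\<^sup>+y. (\<integral>\<^sup>+x. f x y \<partial>\<mu>) \<partial>\<mu>) = (\<integral>\<^sup>+x. (\<integral>\<^sup>+y. f x y \<partial>\<mu>) \<partial>\<mu>)"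
proof -
  interpret pair_sigma_finite \<mu> \<mu> ..
  show ?thesis using assms by (intro Fubini') (simp cong: measurable_cong_sets)
qed

section \<open>Killing at the times of a grid\<close>

lemma nn_integral_law_X:
  assumes t: "0 < t" and f[measurable]: "f \<in> borel_measurable borel"
  shows "(\<integral>\<^sup>+\<omega>. f (X t \<omega>) \<partial>P z) = (\<integral>\<^sup>+w. ennreal (p t z w) * f w \<partial>\<mu>)"
proof -
  note [measurable] = measurable_X[OF less_imp_le[OF t]] measurable_p[OF t]
  have "(\<integral>\<^sup>+\<omega>. f (X t \<omega>) \<partial>P z) = (\<integral>\<^sup>+w. f w \<partial>distr (P z) borel (X t))"
    by (rule nn_integral_distr[symmetric]) measurable
  also have "\<dots> = (\<integral>\<^sup>+w. ennreal (p t z w) * f w \<partial>\<mu>)"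
    unfolding law_X[OF t] by (rule nn_integral_density) measurable
  finally show ?thesis .
qed

text \<open>With Q the integral operator of the kernel \<open>p h\<close>, this is the product 1_F Q
  1_F ... Q 1_F with m factors Q, applied to f: the process is killed only if it is outside F at a
  multiple of h. The product is a palindrome of factors symmetric with respect to \<mu>, whence
  \<open>killed_symmetric\<close>.\<close>

primrec killed :: "'a set \<Rightarrow> real \<Rightarrow> nat \<Rightarrow> ('a \<Rightarrow> ennreal) \<Rightarrow> 'a \<Rightarrow> ennreal" where
  "killed F h 0 f z = indicator F z * f z"
| "killed F h (Suc m) f z = indicator F z * (\<integral>\<^sup>+w. ennreal (p h z w) * killed F h m f w \<partial>\<mu>)"

lemma measurable_mu_p:
  assumes h: "0 < h" and f[measurable]: "f \<in> borel_measurable borel"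
  shows "(\<lambda>z. \<integral>\<^sup>+w. ennreal (p h z w) * f w \<partial>\<mu>) \<in> borel_measurable borel"
proof -
  note [measurable] = measurable_p[OF h]
  show ?thesis by measurable
qed

lemma measurable_killed:
  assumes h: "0 < h" and [measurable]: "F \<in> sets borel" and f: "f \<in> borel_measurable borel"
  shows "killed F h m f \<in> borel_measurable borel"
proof (induction m)
  case 0
  note [measurable] = f
  show ?case by (simp del: killed.simps add: killed.simps[abs_def]) 
next
  case (Suc m)
  note [measurable] = measurable_mu_p[OF h Suc]
  show ?case by (simp del: killed.simps add: killed.simps[abs_def])
qed

text \<open>Splits off the innermost factor instead of the outermost. In
  \<open>killed_symmetric\<close> the outermost factor of the operator on f moves across to g, where
  it is the innermost one.\<close>

lemma killed_Suc':
  "killed F h (Suc m) f z = killed F h m (\<lambda>z. \<integral>\<^sup>+w. ennreal (p h z w) * (indicator F w * f w) \<partial>\<mu>) z"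
  by (induction m arbitrary: z) auto

lemma killed_symmetric:
  assumes h: "0 < h" and F[measurable]: "F \<in> sets borel"
    and "f \<in> borel_measurable borel" "g \<in> borel_measurable borel"
  shows "(\<integral>\<^sup>+z. g z * killed F h m f z \<partial>\<mu>) = (\<integral>\<^sup>+z. f z * killed F h m g z \<partial>\<mu>)"
  using assms(3,4)
proof (induction m arbitrary: f g)
  case 0
  then show ?case by (simp add: ac_simps)
next
  case (Suc m)
  note [measurable] = Suc.prems measurable_p[OF h] measurable_killed[OF h F Suc.prems(1), of m]
  let ?Q = "\<lambda>z. \<integral>\<^sup>+w. ennreal (p h z w) * (indicator F w * g w) \<partial>\<mu>"
  have [measurable]: "?Q \<in> borel_measurable borel" by (rule measurable_mu_p[OF h]) measurable
  have "(\<integral>\<^sup>+z. g z * killed F h (Suc m) f z \<partial>\<mu>) =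
      (\<integral>\<^sup>+z. \<integral>\<^sup>+w. g z * indicator F z * (ennreal (p h z w) * killed F h m f w) \<partial>\<mu> \<partial>\<mu>)"
    by (intro nn_integral_cong, subst nn_integral_cmult) (auto simp: mult.assoc)
  also have "\<dots> = (\<integral>\<^sup>+w. \<integral>\<^sup>+z. g z * indicator F z * (ennreal (p h z w) * killed F h m f w) \<partial>\<mu> \<partial>\<mu>)"
    by (rule mu_Fubini[symmetric]) measurable
  also have "\<dots> = (\<integral>\<^sup>+w. ?Q w * killed F h m f w \<partial>\<mu>)"
    by (intro nn_integral_cong, subst nn_integral_multc[symmetric]) (auto simp: p_sym[OF h] ac_simps)
  also have "\<dots> = (\<integral>\<^sup>+z. f z * killed F h m ?Q z \<partial>\<mu>)"
    by (rule Suc.IH) measurable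
  also have "\<dots> = (\<integral>\<^sup>+z. f z * killed F h (Suc m) g z \<partial>\<mu>)"
    by (simp only: killed_Suc')
  finally show ?case .
qed

text \<open>Markov property at the constant stopping time h: after the first step the remaining grid
  conditions are those of a path started at X h.\<close>

lemma killed_eq:
  assumes h: "0 < h" and F[measurable]: "F \<in> sets borel" and f: "f \<in> borel_measurable borel"
  shows "killed F h m f z =
    (\<integral>\<^sup>+\<omega>. f (X (real m * h) \<omega>) * indicator {\<omega>. \<forall>k\<le>m. X (real k * h) \<omega> \<in> F} \<omega> \<partial>P z)"
proof (induction m arbitrary: z)
  case 0
  have "(\<integral>\<^sup>+\<omega>. f (X 0 \<omega>) * indicator {\<omega>. X 0 \<omega> \<in> F} \<omega> \<partial>P z) = (\<integral>\<^sup>+\<omega>. indicator F z * f z \<partial>P z)"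
  proof (rule nn_integral_cong_AE)
    show "AE \<omega> in P z. f (X 0 \<omega>) * indicator {\<omega>. X 0 \<omega> \<in> F} \<omega> = indicator F z * f z"
      using AE_X_0[of z] by eventually_elim (simp add: indicator_def)
  qed
  then show ?case
    using prob_space.emeasure_space_1[OF prob_space_P[of z]] by simp
next
  case (Suc m)
  note [measurable] = f
  define G where "G w = f (w (real m * h)) * indicator {w. \<forall>k\<le>m. w (real k * h) \<in> F} w" for w :: "real \<Rightarrow> 'a"
  have [measurable]: "(\<lambda>w :: real \<Rightarrow> 'a. w q) \<in> PS \<rightarrow>\<^sub>M borel" for q
    by (rule measurable_component_singleton) simp
  have G[measurable]: "G \<in> borel_measurable PS"
    unfolding G_def[abs_def] by measurable
  have path: "G (path \<omega>) = f (X (real m * h) \<omega>) * indicator {\<omega>. \<forall>k\<le>m. X (real k * h) \<omega> \<in> F} \<omega>" for \<omega>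
    using h by (auto simp: G_def path_def indicator_def max_def mult_less_0_iff)
  let ?T = "\<lambda>\<omega>. ennreal h"
  have shift: "G (shifted_path ?T \<omega>) * indicator F (X 0 \<omega>) =
      f (X (real (Suc m) * h) \<omega>) * indicator {\<omega>. \<forall>k\<le>Suc m. X (real k * h) \<omega> \<in> F} \<omega>" for \<omega>
  proof -
    have "(\<forall>k\<le>Suc m. X (real k * h) \<omega> \<in> F) \<longleftrightarrow> X 0 \<omega> \<in> F \<and> (\<forall>k\<le>m. X (h + real k * h) \<omega> \<in> F)"
    proof (intro iffI conjI allI impI)
      fix k assume H: "X 0 \<omega> \<in> F \<and> (\<forall>k\<le>m. X (h + real k * h) \<omega> \<in> F)" "k \<le> Suc m"
      then show "X (real k * h) \<omega> \<in> F"
        by (cases k) (auto simp: algebra_simps)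
    next
      assume H: "\<forall>k\<le>Suc m. X (real k * h) \<omega> \<in> F"
      show "X 0 \<omega> \<in> F" using H[rule_format, of 0] by simp
      show "X (h + real k * h) \<omega> \<in> F" if "k \<le> m" for k
        using H[rule_format, of "Suc k"] that by (simp add: algebra_simps)
    qed
    then show ?thesis
      using h by (auto simp: G_def shifted_path_def indicator_def max_def mult_less_0_iff algebra_simps)
  qed
  have T: "stopping_time \<R> ?T" by (rule stopping_time_const)
  have top: "space N \<in> sets (right.pre_sigma ?T)"
    using sets.top[of "right.pre_sigma ?T"] by (simp add: right.space_pre_sigma)
  have eq: "{\<omega>\<in>space N. ?T \<omega> < \<infinity>} = space N" by simp
  have "(\<integral>\<^sup>+\<omega>. f (X (real (Suc m) * h) \<omega>) * indicator {\<omega>. \<forall>k\<le>Suc m. X (real k * h) \<omega> \<in> F} \<omega> \<partial>P z) =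
      (\<integral>\<^sup>+\<omega>. indicator F z * (G (shifted_path ?T \<omega>) * indicator (space N) \<omega>) \<partial>P z)"
    unfolding shift[symmetric]
  proof (rule nn_integral_cong_AE)
    show "AE \<omega> in P z. G (shifted_path ?T \<omega>) * indicator F (X 0 \<omega>) =
        indicator F z * (G (shifted_path ?T \<omega>) * indicator (space N) \<omega>)"
      using AE_X_0[of z] AE_space by eventually_elim (simp add: mult.commute)
  qed
  also have "\<dots> = indicator F z * (\<integral>\<^sup>+\<omega>\<in>space N. G (shifted_path ?T \<omega>) \<partial>P z)"
    using measurable_shifted_path[OF T] sets.top[of N]
    by (intro nn_integral_cmult borel_measurable_times_ennreal measurable_compose[OF _ G] borel_measurable_indicator)
      (simp_all cong: measurable_cong_sets)
  also have "(\<integral>\<^sup>+\<omega>\<in>space N. G (shifted_path ?T \<omega>) \<partial>P z) =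
      (\<integral>\<^sup>+\<omega>\<in>space N. (\<integral>\<^sup>+\<omega>'. G (path \<omega>') \<partial>P (X h \<omega>)) \<partial>P z)"
    using strong_markov_path[OF T top G, of z] h unfolding eq by simp
  also have "\<dots> = (\<integral>\<^sup>+\<omega>. killed F h m f (X h \<omega>) \<partial>P z)"
    unfolding path Suc.IH[symmetric] by (intro nn_integral_cong) simp
  also have "\<dots> = (\<integral>\<^sup>+w. ennreal (p h z w) * killed F h m f w \<partial>\<mu>)"
    by (rule nn_integral_law_X[OF h measurable_killed[OF h F f]])
  finally show ?case by simp
qed

section \<open>Killing in continuous time, and symmetry\<close>

definition killed_at :: "'a set \<Rightarrow> real \<Rightarrow> ('a \<Rightarrow> ennreal) \<Rightarrow> 'a \<Rightarrow> ennreal" where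
  "killed_at F t f z = (\<integral>\<^sup>+\<omega>. f (X t \<omega>) * indicator {\<omega>. \<forall>s\<in>{0..t}. X s \<omega> \<in> F} \<omega> \<partial>P z)"

lemma killed_decseq: "decseq (\<lambda>n. indicator {\<omega>. \<forall>k\<le>2^n. X (real k * (t / 2^n)) \<omega> \<in> F} \<omega> :: ennreal)"
proof (intro decseq_SucI)
  fix n :: nat
  have "X (real k * (t / 2^n)) \<omega> \<in> F" if "\<forall>k\<le>2^Suc n. X (real k * (t / 2^Suc n)) \<omega> \<in> F" "k \<le> 2^n" for k
    using that(1)[rule_format, of "2 * k"] that(2) by simp
  then show "(indicator {\<omega>. \<forall>k\<le>2^Suc n. X (real k * (t / 2^Suc n)) \<omega> \<in> F} \<omega> :: ennreal)
      \<le> indicator {\<omega>. \<forall>k\<le>2^n. X (real k * (t / 2^n)) \<omega> \<in> F} \<omega>"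
    by (intro indicator_leI) auto
qed

lemma dyadic_stays:
  assumes F: "closed F" and \<omega>: "\<omega> \<in> space N" and t: "0 < t"
    and R: "\<And>n k. k \<le> 2^n \<Longrightarrow> X (real k * (t / 2^n)) \<omega> \<in> F" and s: "s \<in> {0..t}"
  shows "X s \<omega> \<in> F"
proof (rule ccontr)
  assume "X s \<omega> \<notin> F"
  then obtain e where e: "e > 0" "\<And>u. 0 \<le> u \<Longrightarrow> \<bar>u - s\<bar> < e \<Longrightarrow> X u \<omega> \<in> - F"
    using X_open_near[OF \<omega>, of s "- F"] F s by auto
  obtain n where n: "(1/2::real)^n < e / t"
    using real_arch_pow_inv[of "e / t" "1/2"] e(1) t by auto
  define k where "k = nat \<lfloor>2^n * (s / t)\<rfloor>"
  have k: "real k \<le> 2^n * (s / t)" "2^n * (s / t) < real k + 1"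
    using s t by (auto simp: k_def floor_less_cancel)
  have "2^n * (s / t) \<le> 2^n" using s t by (simp add: field_simps)
  then have "real k \<le> 2^n" using k by linarith
  then have "k \<le> 2^n" by (metis of_nat_le_iff of_nat_numeral of_nat_power)
  moreover have "\<bar>real k * (t / 2^n) - s\<bar> < e"
  proof -
    have "real k * (t / 2^n) \<le> s" "s < real k * (t / 2^n) + t * (1/2)^n"
      using k t by (auto simp: field_simps power_divide)
    moreover have "t * (1/2)^n < e" using n t by (simp add: field_simps)
    ultimately show ?thesis by auto
  qed
  ultimately show False using R[of k n] e(2)[of "real k * (t / 2^n)"] t by auto
qed

text \<open>A continuous path that is in the closed F at all dyadic fractions of t is in F
  throughout [0, t], and refining the grid only adds conditions. This is a decreasing limit of
  functions bounded by 1.\<close>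

lemma killed_at_INF:
  assumes F: "closed F" and f[measurable]: "f \<in> borel_measurable borel" and f1: "\<And>x. f x \<le> 1" and t: "0 < t"
  shows "killed_at F t f z = (INF n. killed F (t / 2^n) (2^n) f z)"
    and "decseq (\<lambda>n. killed F (t / 2^n) (2^n) f)"
proof -
  have [measurable]: "F \<in> sets borel" using F by auto
  define G where "G n \<omega> = f (X t \<omega>) * indicator {\<omega>. \<forall>k\<le>2^n. X (real k * (t / 2^n)) \<omega> \<in> F} \<omega>" for n :: nat and \<omega>
  have eq: "killed F (t / 2^n) (2^n) f z = (\<integral>\<^sup>+\<omega>. G n \<omega> \<partial>P z)" for n z
  proof -
    have *: "real (2^n) * (t / 2^n) = t" by simp
    show ?thesis
      using t unfolding G_def by (subst killed_eq[OF _ _ f]) (simp_all only: * divide_pos_pos zero_less_power zero_less_numeral \<open>F \<in> sets borel\<close>)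
  qed
  have Gdec: "decseq G"
    unfolding decseq_def unfolding le_fun_def G_def
    by (intro allI impI mult_left_mono decseqD[OF killed_decseq]) auto
  show "decseq (\<lambda>n. killed F (t / 2^n) (2^n) f)"
    unfolding decseq_def
    by (intro allI impI le_funI) (auto simp: eq intro!: nn_integral_mono le_funD[OF decseqD[OF Gdec]])
  have [measurable]: "X (real k * (t / 2^n)) \<in> N \<rightarrow>\<^sub>M borel" for k n
    using t by (intro measurable_X) auto
  have [measurable]: "X t \<in> N \<rightarrow>\<^sub>M borel" using t by (intro measurable_X) auto
  have Gm: "G n \<in> borel_measurable (P z)" for n
    unfolding G_def[abs_def] indicator_def by measurable
  have INF_eq: "f (X t \<omega>) * indicator {\<omega>. \<forall>s\<in>{0..t}. X s \<omega> \<in> F} \<omega> = (INF n. G n \<omega>)" if \<omega>: "\<omega> \<in> space N" for \<omega>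
  proof (cases "\<forall>s\<in>{0..t}. X s \<omega> \<in> F")
    case True
    have "X (real k * (t / 2^n)) \<omega> \<in> F" if "k \<le> 2^n" for k n
    proof -
      have "real k \<le> 2^n" using that by (metis of_nat_le_iff of_nat_numeral of_nat_power)
      then have "real k * (t / 2^n) \<in> {0..t}" using t by (auto simp: field_simps)
      then show ?thesis using True by blast
    qed
    then have "G n \<omega> = f (X t \<omega>)" for n by (auto simp: G_def indicator_def)
    then show ?thesis using True by simp
  next
    case False
    then obtain n k where "k \<le> 2^n" "X (real k * (t / 2^n)) \<omega> \<notin> F"
      using dyadic_stays[OF F \<omega> t] by metis
    then have "G n \<omega> = 0" by (auto simp: G_def indicator_def)
    then have "(INF n. G n \<omega>) \<le> 0" by (metis INF_lower UNIV_I)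
    then show ?thesis using False by simp
  qed
  have "killed_at F t f z = (\<integral>\<^sup>+\<omega>. (INF n. G n \<omega>) \<partial>P z)"
    unfolding killed_at_def by (intro nn_integral_cong INF_eq) simp
  also have "\<dots> = (INF n. integral\<^sup>N (P z) (G n))"
  proof (rule nn_integral_monotone_convergence_INF_decseq[OF Gdec Gm])
    have "(\<integral>\<^sup>+\<omega>. G 0 \<omega> \<partial>P z) \<le> (\<integral>\<^sup>+\<omega>. 1 \<partial>P z)"
      using f1 by (intro nn_integral_mono) (auto simp: G_def indicator_def)
    also have "\<dots> < \<infinity>" using prob_space.emeasure_space_1[OF prob_space_P[of z]] by simp
    finally show "(\<integral>\<^sup>+\<omega>. G 0 \<omega> \<partial>P z) < \<infinity>" .
  qed
  finally show "killed_at F t f z = (INF n. killed F (t / 2^n) (2^n) f z)"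
    by (simp add: eq)
qed

lemma killed_at_symmetric:
  assumes F: "closed F" and t: "0 < t"
    and f[measurable]: "f \<in> borel_measurable borel" and f1: "\<And>x. f x \<le> 1"
    and g[measurable]: "g \<in> borel_measurable borel" and g1: "\<And>x. g x \<le> 1"
    and fin: "(\<integral>\<^sup>+z. g z \<partial>\<mu>) < \<infinity>"
  shows "(\<integral>\<^sup>+z. g z * killed_at F t f z \<partial>\<mu>) = (\<integral>\<^sup>+z. f z * killed_at F t g z \<partial>\<mu>)"
proof -
  have F'[measurable]: "F \<in> sets borel" using F by auto
  let ?a = "\<lambda>f n z. killed F (t / 2^n) (2^n) f z"
  have sym: "(\<integral>\<^sup>+z. g z * ?a f n z \<partial>\<mu>) = (\<integral>\<^sup>+z. f z * ?a g n z \<partial>\<mu>)" for n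
    using t by (intro killed_symmetric) auto
  have ind: "f x * indicator A \<omega> \<le> 1" for x A and \<omega> :: 'w
    using f1 by (cases "\<omega> \<in> A") auto
  have le1: "?a f n z \<le> 1" for n z
  proof -
    have "?a f n z = (\<integral>\<^sup>+\<omega>. f (X (real (2^n) * (t / 2^n)) \<omega>) *
        indicator {\<omega>. \<forall>k\<le>2^n. X (real k * (t / 2^n)) \<omega> \<in> F} \<omega> \<partial>P z)"
      using t by (intro killed_eq) auto
    also have "\<dots> \<le> (\<integral>\<^sup>+\<omega>. 1 \<partial>P z)" by (intro nn_integral_mono ind)
    also have "\<dots> = 1" using prob_space.emeasure_space_1[OF prob_space_P[of z]] by simp
    finally show ?thesis .
  qed
  have fin0: "(\<integral>\<^sup>+z. g z * ?a f 0 z \<partial>\<mu>) < \<infinity>"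
  proof -
    have "g z * ?a f 0 z \<le> g z" for z
      using mult_left_mono[OF le1[of 0 z], of "g z"] by simp
    then have "(\<integral>\<^sup>+z. g z * ?a f 0 z \<partial>\<mu>) \<le> (\<integral>\<^sup>+z. g z \<partial>\<mu>)"
      by (intro nn_integral_mono)
    then show ?thesis using fin by simp
  qed
  have lim: "(\<integral>\<^sup>+z. g z * killed_at F t f z \<partial>\<mu>) = (INF n. \<integral>\<^sup>+z. g z * ?a f n z \<partial>\<mu>)"
    if m[measurable]: "f \<in> borel_measurable borel" "g \<in> borel_measurable borel"
      and b: "\<And>x. f x \<le> 1" "\<And>x. g x \<le> 1" and fin0: "(\<integral>\<^sup>+z. g z * ?a f 0 z \<partial>\<mu>) < \<infinity>" for f g
  proof -
    have dec: "decseq (\<lambda>n. ?a f n z)" for z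
      unfolding decseq_def using decseqD[OF killed_at_INF(2)[OF F m(1) b(1) t]] by (blast intro: le_funD)
    have "(\<integral>\<^sup>+z. g z * killed_at F t f z \<partial>\<mu>) = (\<integral>\<^sup>+z. (INF n. g z * ?a f n z) \<partial>\<mu>)"
      unfolding killed_at_INF(1)[OF F m(1) b(1) t] using b(2)
      by (intro nn_integral_cong INF_mult_left_ennreal_decseq dec) (auto intro: le_less_trans[of _ 1])
    also have "\<dots> = (INF n. \<integral>\<^sup>+z. g z * ?a f n z \<partial>\<mu>)"
    proof (rule nn_integral_monotone_convergence_INF_decseq)
      show "decseq (\<lambda>n z. g z * ?a f n z)"
        unfolding decseq_def by (intro allI impI le_funI mult_left_mono decseqD[OF dec]) auto
      show "(\<lambda>z. g z * ?a f n z) \<in> borel_measurable \<mu>" for n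
      proof -
        have [measurable]: "?a f n \<in> borel_measurable borel"
          using t by (intro measurable_killed F' m) simp
        show ?thesis by measurable
      qed
      show "(\<integral>\<^sup>+z. g z * ?a f 0 z \<partial>\<mu>) < \<infinity>" by (rule fin0)
    qed
    finally show ?thesis .
  qed
  have "(\<integral>\<^sup>+z. g z * killed_at F t f z \<partial>\<mu>) = (INF n. \<integral>\<^sup>+z. g z * ?a f n z \<partial>\<mu>)"
    by (rule lim[OF f g f1 g1 fin0])
  also have "\<dots> = (INF n. \<integral>\<^sup>+z. f z * ?a g n z \<partial>\<mu>)" unfolding sym ..
  \<comment> \<open>A decreasing limit needs a finite first integral. Integrability of g supplies it
    for one order of f and g, and symmetry at n = 0 transfers it to the other.\<close>
  also have "\<dots> = (\<integral>\<^sup>+z. f z * killed_at F t g z \<partial>\<mu>)"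
    using fin0 unfolding sym by (rule lim[OF g f g1 f1, symmetric])
  finally show ?thesis .
qed

text \<open>Integrate \<open>killed_at_symmetric\<close> over t; Fubini exchanges the integrals over
  time and space on both sides.\<close>

lemma green_symmetric:
  assumes F: "closed F"
    and f: "continuous_on UNIV f" "\<And>x. f x \<le> 1"
    and g: "continuous_on UNIV g" "\<And>x. g x \<le> 1"
    and fin: "(\<integral>\<^sup>+z. ennreal (g z) \<partial>\<mu>) < \<infinity>"
  shows "(\<integral>\<^sup>+z. ennreal (g z) * green F f z \<partial>\<mu>) = (\<integral>\<^sup>+z. ennreal (f z) * green F g z \<partial>\<mu>)"
proof -
  have F'[measurable]: "F \<in> sets borel" using F by auto
  have fm[measurable]: "f \<in> borel_measurable borel" and gm[measurable]: "g \<in> borel_measurable borel"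
    by (intro borel_measurable_continuous_onI f g)+
  interpret lm: pair_sigma_finite \<mu> "lborel :: real measure" ..
  define R where "R f t z = (\<integral>\<^sup>+\<omega>. occ_rate F f (path \<omega>) t \<partial>P z)" for f t z
  have R_meas: "(\<lambda>(z, t). R f t z) \<in> borel_measurable (borel \<Otimes>\<^sub>M borel)"
    if [measurable]: "f \<in> borel_measurable borel" for f
  proof -
    note [measurable] = measurable_occ_rate[OF F' that] kernel_path_subprob
    have [measurable]: "(\<lambda>p :: ('a \<times> real). distr (P (fst p)) PS path) \<in> borel \<Otimes>\<^sub>M borel \<rightarrow>\<^sub>M subprob_algebra PS"
      by (rule measurable_compose[OF measurable_fst kernel_path_subprob])
    have "(\<lambda>p. \<integral>\<^sup>+w. occ_rate F f w (snd p) \<partial>distr (P (fst p)) PS path) \<in> borel_measurable (borel \<Otimes>\<^sub>M borel)"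
      by (rule nn_integral_measurable_subprob_algebra2[where N=PS]) measurable
    moreover have "(\<integral>\<^sup>+w. occ_rate F f w (snd p) \<partial>distr (P (fst p)) PS path) = R f (snd p) (fst p)" for p
      unfolding R_def by (subst nn_integral_distr) auto
    ultimately show ?thesis by (simp add: case_prod_beta')
  qed
  have green_R: "green F f z = (\<integral>\<^sup>+t. R f t z \<partial>lborel)" if "f \<in> borel_measurable borel" for f z
  proof -
    interpret prob_space "P z" by (rule prob_space_P)
    interpret pz: pair_sigma_finite "lborel :: real measure" "P z" ..
    note [measurable] = measurable_occ_rate[OF F' that]
    show ?thesis
      unfolding green_def occ_def R_def by (rule pz.Fubini') measurable
  qed
  have swap: "(\<integral>\<^sup>+z. ennreal (g z) * green F f z \<partial>\<mu>) = (\<integral>\<^sup>+t. (\<integral>\<^sup>+z. ennreal (g z) * R f t z \<partial>\<mu>) \<partial>lborel)"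
    if [measurable]: "f \<in> borel_measurable borel" "g \<in> borel_measurable borel" for f g
  proof -
    note [measurable] = R_meas[OF that(1)]
    have "(\<integral>\<^sup>+z. ennreal (g z) * green F f z \<partial>\<mu>) = (\<integral>\<^sup>+z. (\<integral>\<^sup>+t. ennreal (g z) * R f t z \<partial>lborel) \<partial>\<mu>)"
      unfolding green_R[OF that(1)] by (intro nn_integral_cong nn_integral_cmult[symmetric]) measurable
    also have "\<dots> = (\<integral>\<^sup>+t. (\<integral>\<^sup>+z. ennreal (g z) * R f t z \<partial>\<mu>) \<partial>lborel)"
      by (rule lm.Fubini'[symmetric]) measurable
    finally show ?thesis .
  qed
  have R_killed: "R f t z = killed_at F t (\<lambda>x. ennreal (f x)) z" if "continuous_on UNIV f" "0 < t" for f t z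
    unfolding R_def killed_at_def
  proof (intro nn_integral_cong)
    fix \<omega> assume "\<omega> \<in> space (P z)"
    then show "occ_rate F f (path \<omega>) t = ennreal (f (X t \<omega>)) * indicator {\<omega>. \<forall>s\<in>{0..t}. X s \<omega> \<in> F} \<omega>"
      using that(2) by (subst occ_rate_continuous[OF continuous_path F that(1)]) (auto simp: path_def indicator_def max_def)
  qed
  have R_neg: "R f t z = 0" if "t < 0" for f t z
    using that by (simp add: R_def occ_rate_def)
  \<comment> \<open>Time 0, at which there is no transition density, is a null set, and at negative
    times both sides are 0.\<close>
  have "AE t in (lborel :: real measure). (\<integral>\<^sup>+z. ennreal (g z) * R f t z \<partial>\<mu>) = (\<integral>\<^sup>+z. ennreal (f z) * R g t z \<partial>\<mu>)"
    using AE_lborel_singleton[of 0]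
  proof eventually_elim
    fix t :: real assume "t \<noteq> 0"
    then consider "t < 0" | "0 < t" by linarith
    then show "(\<integral>\<^sup>+z. ennreal (g z) * R f t z \<partial>\<mu>) = (\<integral>\<^sup>+z. ennreal (f z) * R g t z \<partial>\<mu>)"
    proof cases
      case 2
      then show ?thesis
        unfolding R_killed[OF f(1) 2] R_killed[OF g(1) 2]
        using f(2) g(2) fin by (intro killed_at_symmetric F) (auto simp: ennreal_le_1)
    qed (simp add: R_neg)
  qed
  then have "(\<integral>\<^sup>+t. (\<integral>\<^sup>+z. ennreal (g z) * R f t z \<partial>\<mu>) \<partial>lborel) = (\<integral>\<^sup>+t. (\<integral>\<^sup>+z. ennreal (f z) * R g t z \<partial>\<mu>) \<partial>lborel)"
    by (rule nn_integral_cong_AE)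
  then show ?thesis
    unfolding swap[OF fm gm] swap[OF gm fm] .
qed

end

section \<open>Harnack chains\<close>

locale harnack_diffusion = symmetric_diffusion N P X \<mu> p
  for N :: "'w measure"
    and P :: "'a::{metric_space, second_countable_topology} \<Rightarrow> 'w measure"
    and X :: "real \<Rightarrow> 'w \<Rightarrow> 'a"
    and \<mu> :: "'a measure" and p :: "real \<Rightarrow> 'a \<Rightarrow> 'a \<Rightarrow> real" +
  fixes H :: real
  assumes geodesic: "geodesic_metric TYPE('a)"
    and finite_nbhd: "\<exists>U. open U \<and> x \<in> U \<and> emeasure \<mu> U < \<infinity>"
    and full_support: "full_support \<mu>"
    and H1: "1 \<le> H"
    and harnack: "\<And>x R u. 0 < R \<Longrightarrow> (\<And>z. 0 \<le> u z) \<Longrightarrow> harmonic_in P X (ball x (2 * R)) u \<Longrightarrow>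
        (SUP z\<in>ball x R. ennreal (u z)) \<le> ennreal H * (INF z\<in>ball x R. ennreal (u z))"
begin

lemma between:
  assumes "0 \<le> \<tau>" "\<tau> \<le> dist x y"
  obtains z :: 'a where "dist x z = \<tau>" "dist z y = dist x y - \<tau>"
proof -
  obtain \<gamma> where \<gamma>: "\<gamma> 0 = x" "\<gamma> (dist x y) = y"
    "\<And>s t. s \<in> {0..dist x y} \<Longrightarrow> t \<in> {0..dist x y} \<Longrightarrow> dist (\<gamma> s) (\<gamma> t) = \<bar>s - t\<bar>"
    using geodesic unfolding geodesic_metric_def by blast
  show ?thesis
    using that[of "\<gamma> \<tau>"] \<gamma>(3)[of 0 \<tau>] \<gamma>(3)[of \<tau> "dist x y"] \<gamma>(1,2) assms by auto
qed

lemma ennreal_H: "1 \<le> ennreal H" "ennreal H < top"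
  using H1 by simp_all

lemma green_harnack:
  assumes F: "closed F" and f: "continuous_on UNIV f" and s: "0 < s"
    and c: "ball c (2 * s) \<subseteq> F" "\<And>x. x \<in> ball c (2 * s) \<Longrightarrow> f x = 0"
    and fin: "\<And>z. green F f z < \<infinity>" and ab: "a \<in> ball c s" "b \<in> ball c s"
  shows "green F f a \<le> ennreal H * green F f b"
proof -
  let ?u = "\<lambda>z. enn2real (green F f z)"
  have u: "ennreal (?u z) = green F f z" for z using fin[of z] by simp
  have "harmonic_in P X (ball c (2 * s)) ?u"
    by (rule harmonic_green[OF _ c(1) F f c(2) fin]) auto
  from harnack[OF s _ this]
  have "(SUP z\<in>ball c s. green F f z) \<le> ennreal H * (INF z\<in>ball c s. green F f z)"
    by (simp add: u)
  moreover have "green F f a \<le> (SUP z\<in>ball c s. green F f z)" using ab by (intro SUP_upper)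
  moreover have "ennreal H * (INF z\<in>ball c s. green F f z) \<le> ennreal H * green F f b"
    using ab by (intro mult_left_mono INF_lower) auto
  ultimately show ?thesis by order
qed

text \<open>Walk from a to b along geodesics, paying one factor H for each step shorter than s. The
  condition concerns all points metrically between a and b, so it is inherited by the pair (c, b)
  for each such point c.\<close>

lemma green_chain:
  assumes F: "closed F" and f: "continuous_on UNIV f" and s: "0 < s"
    and fin: "\<And>z. green F f z < \<infinity>"
  shows "(\<And>c. dist a c + dist c b = dist a b \<Longrightarrow> ball c (2 * s) \<subseteq> F \<and> (\<forall>x\<in>ball c (2 * s). f x = 0)) \<Longrightarrow>
    dist a b < real n * s \<Longrightarrow> green F f a \<le> ennreal H ^ n * green F f b"
proof (induction n arbitrary: a)
  case 0
  then show ?case using zero_le_dist[of a b] by (auto simp: not_less[symmetric])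
next
  case (Suc n)
  have a: "ball a (2 * s) \<subseteq> F" "\<And>x. x \<in> ball a (2 * s) \<Longrightarrow> f x = 0"
    using Suc.prems(1)[of a] by auto
  show ?case
  proof (cases "dist a b < s")
    case True
    have "green F f a \<le> ennreal H * green F f b"
      by (rule green_harnack[OF F f s a fin]) (use True s in auto)
    also have "\<dots> \<le> ennreal H ^ Suc n * green F f b"
      using mult_right_mono[OF one_le_power[OF ennreal_H(1), of n], of "ennreal H * green F f b"]
      by (simp add: ac_simps)
    finally show ?thesis .
  next
    case False
    \<comment> \<open>The midpoint of max 0 (dist a b - n s) and s: shorter than s, so that c is in
      \<open>ball a s\<close>, and long enough that less than n s remains.\<close>
    define \<sigma> where "\<sigma> = (max 0 (dist a b - real n * s) + s) / 2"
    have \<sigma>: "0 \<le> \<sigma>" "\<sigma> < s" "dist a b - real n * s < \<sigma>"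
      using Suc.prems(2) s by (auto simp: \<sigma>_def algebra_simps)
    then obtain c where c: "dist a c = \<sigma>" "dist c b = dist a b - \<sigma>"
      using between[of \<sigma> a b] False by auto
    have "green F f a \<le> ennreal H * green F f c"
      by (rule green_harnack[OF F f s a fin]) (use c \<sigma> s in auto)
    also have "green F f c \<le> ennreal H ^ n * green F f b"
    proof (rule Suc.IH)
      show "dist c b < real n * s" using c \<sigma> by simp
      fix e assume "dist c e + dist e b = dist c b"
      then have "dist a e + dist e b = dist a b"
        using c dist_triangle[of a e c] dist_triangle[of a b e] by linarith
      then show "ball e (2 * s) \<subseteq> F \<and> (\<forall>x\<in>ball e (2 * s). f x = 0)" by (rule Suc.prems(1))
    qed
    finally show ?thesis by (simp add: mult_left_mono mult.assoc)
  qed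
qed

text \<open>Replaces the symmetry of a Green kernel. f lives near a, where \<open>green F g\<close>
  is constant up to H, and g lives near b, where \<open>green F f\<close> is. So in \<integral> f G
  g = \<integral> g G f each potential can be replaced by its value at the centre, at the cost of
  one factor H each.\<close>

lemma green_swap:
  assumes F: "closed F" and s: "0 < s"
    and f: "continuous_on UNIV f" "\<And>x. 0 \<le> f x" "\<And>x. f x \<le> 1" "\<And>x. x \<notin> ball a s \<Longrightarrow> f x = 0"
    and g: "continuous_on UNIV g" "\<And>x. 0 \<le> g x" "\<And>x. g x \<le> 1" "\<And>x. x \<notin> ball b s \<Longrightarrow> g x = 0"
    and fin: "\<And>z. green F f z < \<infinity>" "\<And>z. green F g z < \<infinity>"
    and gfin: "(\<integral>\<^sup>+z. ennreal (g z) \<partial>\<mu>) < \<infinity>"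
    and a: "ball a (2 * s) \<subseteq> F" "\<And>x. x \<in> ball a (2 * s) \<Longrightarrow> g x = 0"
    and b: "ball b (2 * s) \<subseteq> F" "\<And>x. x \<in> ball b (2 * s) \<Longrightarrow> f x = 0"
  shows "(\<integral>\<^sup>+z. ennreal (f z) \<partial>\<mu>) * green F g a \<le> ennreal H ^ 2 * ((\<integral>\<^sup>+z. ennreal (g z) \<partial>\<mu>) * green F f b)"
proof -
  have [measurable]: "F \<in> sets borel" using F by auto
  have [measurable]: "f \<in> borel_measurable borel" "g \<in> borel_measurable borel"
    by (intro borel_measurable_continuous_onI f g)+
  have [measurable]: "green F f \<in> borel_measurable borel" "green F g \<in> borel_measurable borel"
    by (intro measurable_green; measurable)+
  have 1: "ennreal (f z) * green F g a \<le> ennreal H * (ennreal (f z) * green F g z)" for z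
  proof (cases "z \<in> ball a s")
    case True
    have "green F g a \<le> ennreal H * green F g z"
      by (rule green_harnack[OF F g(1) s a fin(2)]) (use True s in auto)
    from mult_left_mono[OF this, of "ennreal (f z)"] show ?thesis by (simp add: ac_simps)
  qed (simp add: f)
  have 2: "ennreal (g z) * green F f z \<le> ennreal H * (ennreal (g z) * green F f b)" for z
  proof (cases "z \<in> ball b s")
    case True
    have "green F f z \<le> ennreal H * green F f b"
      by (rule green_harnack[OF F f(1) s b fin(1)]) (use True s in auto)
    from mult_left_mono[OF this, of "ennreal (g z)"] show ?thesis by (simp add: ac_simps)
  qed (simp add: g)
  have "(\<integral>\<^sup>+z. ennreal (f z) \<partial>\<mu>) * green F g a = (\<integral>\<^sup>+z. ennreal (f z) * green F g a \<partial>\<mu>)"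
    by (rule nn_integral_multc[symmetric]) measurable
  also have "\<dots> \<le> (\<integral>\<^sup>+z. ennreal H * (ennreal (f z) * green F g z) \<partial>\<mu>)"
    by (intro nn_integral_mono 1)
  also have "\<dots> = ennreal H * (\<integral>\<^sup>+z. ennreal (f z) * green F g z \<partial>\<mu>)"
    by (rule nn_integral_cmult) measurable
  also have "(\<integral>\<^sup>+z. ennreal (f z) * green F g z \<partial>\<mu>) = (\<integral>\<^sup>+z. ennreal (g z) * green F f z \<partial>\<mu>)"
    by (rule green_symmetric[OF F f(1,3) g(1,3) gfin, symmetric])
  also have "(\<integral>\<^sup>+z. ennreal (g z) * green F f z \<partial>\<mu>) \<le> (\<integral>\<^sup>+z. ennreal H * (ennreal (g z) * green F f b) \<partial>\<mu>)"
    by (intro nn_integral_mono 2)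
  also have "\<dots> = ennreal H * ((\<integral>\<^sup>+z. ennreal (g z) \<partial>\<mu>) * green F f b)"
    by (subst nn_integral_cmult, measurable) (subst nn_integral_multc, auto)
  finally show ?thesis by (simp add: power2_eq_square mult.assoc mult_left_mono)
qed

lemma exists_bump:
  assumes "0 < \<rho>"
  obtains f :: "'a \<Rightarrow> real" where "continuous_on UNIV f" "\<And>x. 0 \<le> f x" "\<And>x. f x \<le> 1"
    "\<And>x. x \<notin> ball b \<rho> \<Longrightarrow> f x = 0"
    "0 < (\<integral>\<^sup>+z. ennreal (f z) \<partial>\<mu>)" "(\<integral>\<^sup>+z. ennreal (f z) \<partial>\<mu>) < \<infinity>" "\<exists>U. open U \<and> b \<in> U \<and> (\<forall>x\<in>U. 0 < f x)"
proof -
  obtain U where U: "open U" "b \<in> U" "emeasure \<mu> U < \<infinity>" using finite_nbhd by blast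
  then obtain e where e: "e > 0" "ball b e \<subseteq> U" using open_contains_ball by blast
  \<comment> \<open>1 bounds the height of the cone f, while e puts the set where it is positive
    into a set of finite measure and \<rho> puts it into the prescribed ball.\<close>
  define k where "k = Min {1, e, \<rho>}"
  have k: "0 < k" "k \<le> 1" "k \<le> e" "k \<le> \<rho>" using e assms by (auto simp: k_def)
  define f where "f x = max 0 (k - dist x b)" for x :: 'a
  have pos: "0 < f x \<longleftrightarrow> x \<in> ball b k" for x by (auto simp: f_def dist_commute)
  have cont: "continuous_on UNIV f" unfolding f_def by (intro continuous_intros)
  then have [measurable]: "f \<in> borel_measurable borel" by (rule borel_measurable_continuous_onI)
  have f1: "0 \<le> f x" "f x \<le> 1" for x
    using k zero_le_dist[of x b] unfolding f_def by linarith+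
  have "(\<integral>\<^sup>+z. ennreal (f z) \<partial>\<mu>) \<noteq> 0"
  proof
    assume "(\<integral>\<^sup>+z. ennreal (f z) \<partial>\<mu>) = 0"
    then have "AE z in \<mu>. ennreal (f z) = 0" by (subst (asm) nn_integral_0_iff_AE) auto
    then have "AE z in \<mu>. z \<notin> ball b k"
      by eventually_elim (use pos in \<open>auto simp: ennreal_eq_0_iff not_less[symmetric]\<close>)
    then have "emeasure \<mu> (ball b k) = 0"
      by (subst (asm) AE_iff_measurable[of "ball b k"]) (auto simp: sets_eq_imp_space_eq[OF sets_mu])
    then show False using full_support k(1) unfolding full_support_def by (metis centre_in_ball empty_iff less_irrefl open_ball)
  qed
  moreover have "(\<integral>\<^sup>+z. ennreal (f z) \<partial>\<mu>) < \<infinity>"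
  proof -
    have "(\<integral>\<^sup>+z. ennreal (f z) \<partial>\<mu>) \<le> (\<integral>\<^sup>+z. indicator U z \<partial>\<mu>)"
    proof (intro nn_integral_mono)
      fix z show "ennreal (f z) \<le> indicator U z"
      proof (cases "z \<in> U")
        case False
        then have "\<not> 0 < f z" using pos e(2) k(3) by (auto simp: subset_eq)
        then show ?thesis using f1(1)[of z] by simp
      qed (use f1 in \<open>auto simp: ennreal_le_1\<close>)
    qed
    also have "\<dots> = emeasure \<mu> U" using U(1) by simp
    finally show ?thesis using U(3) by simp
  qed
  moreover have "f x = 0" if "x \<notin> ball b \<rho>" for x
    using that k(4) by (auto simp: f_def dist_commute)
  moreover have "\<exists>U. open U \<and> b \<in> U \<and> (\<forall>x\<in>U. 0 < f x)"
    using pos k(1) by (intro exI[of _ "ball b k"]) auto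
  ultimately show ?thesis
    using that[OF cont f1] by (auto simp: zero_less_iff_neq_zero)
qed

text \<open>Argue on a single path outside the null sets. Leaving \<open>ball z (2 * l)\<close> in
  finite time, it must cross the sphere of radius l about y. There f is positive, so right after the
  first crossing the path spends an interval of time where f > 0, without having left
  \<open>cball y r\<close>. Its occupation cannot be 0.\<close>

lemma green_pos:
  assumes F: "closed F" "cball y r \<subseteq> F" and f: "continuous_on UNIV f"
    and fpos: "\<And>x. dist x y = l \<Longrightarrow> 0 < f x" and l: "dist z y < l" "l < r"
    and fin: "mean_exit_time P X z (2 * l) < \<infinity>"
  shows "0 < green F f z"
proof (rule ccontr)
  have [measurable]: "F \<in> sets borel" using F by auto
  have fm: "f \<in> borel_measurable borel" by (rule borel_measurable_continuous_onI[OF f])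
  note [measurable] = measurable_occ[OF \<open>F \<in> sets borel\<close> fm]
  let ?T = "exit_time X (ball z (2 * l))"
  have T: "stopping_time \<R> ?T"
    unfolding exit_time_def by (intro stopping_time_hitting_closed) auto
  note [measurable] = measurable_stopping_time_N[OF T]
  assume "\<not> 0 < green F f z"
  then have "AE \<omega> in P z. occ F f (path \<omega>) = 0"
    unfolding green_def by (subst (asm) zero_less_iff_neq_zero, subst (asm) nn_integral_0_iff_AE) auto
  moreover have "AE \<omega> in P z. ?T \<omega> \<noteq> \<infinity>"
    using fin unfolding mean_exit_time_def by (intro nn_integral_PInf_AE) auto
  ultimately have "AE \<omega> in P z. X 0 \<omega> = z \<and> occ F f (path \<omega>) = 0 \<and> ?T \<omega> \<noteq> \<infinity> \<and> \<omega> \<in> space (P z)"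
    using AE_X_0[of z] AE_space by eventually_elim auto
  then obtain \<omega> where \<omega>: "\<omega> \<in> space N" "X 0 \<omega> = z" "occ F f (path \<omega>) = 0" "?T \<omega> \<noteq> \<infinity>"
    using eventually_happens'[OF prob_space.ae_filter_bot[OF prob_space_P[of z]]] unfolding space_P by blast
  define \<tau> where "\<tau> = enn2real (?T \<omega>)"
  have "X \<tau> \<omega> \<in> closure (- ball z (2 * l))"
    unfolding \<tau>_def exit_time_def using \<omega>(4) by (intro hit_closure \<omega>) (auto simp: exit_time_def less_top[symmetric])
  \<comment> \<open>The path has moved at least 2 l away from z, and z is less than l from y, so the
    path is now at least l from y.\<close>
  then have "2 * l \<le> dist z (X \<tau> \<omega>)" by (auto simp: closure_complement interior_open not_less)
  then have far: "l \<le> dist (X \<tau> \<omega>) y"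
    using dist_triangle[of z "X \<tau> \<omega>" y] l by (simp add: dist_commute)
  have \<tau>: "0 \<le> \<tau>" by (simp add: \<tau>_def)
  have cont: "continuous_on {0..} (\<lambda>t. dist (X t \<omega>) y)"
    by (intro continuous_intros continuous_X \<omega>)
  let ?S = "{t\<in>{0..\<tau>}. dist (X t \<omega>) y = l}"
  have cS: "continuous_on {0..\<tau>} (\<lambda>t. dist (X t \<omega>) y)"
    by (rule continuous_on_subset[OF cont]) auto
  have "?S \<noteq> {}"
    using IVT'[OF _ far \<tau> cS] \<omega>(2) l(1) by force
  moreover have "compact ?S"
  proof -
    have "?S = {0..\<tau>} \<inter> (\<lambda>t. dist (X t \<omega>) y) -` {l}" by auto
    moreover have "closed ({0..\<tau>} \<inter> (\<lambda>t. dist (X t \<omega>) y) -` {l})"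
      by (rule continuous_closed_preimage[OF cS]) auto
    moreover have "bounded ?S" by (rule bounded_subset[of "{0..\<tau>}"]) auto
    ultimately show ?thesis by (simp add: compact_eq_bounded_closed)
  qed
  ultimately have "\<exists>t\<in>?S. \<forall>s\<in>?S. t \<le> s"
    by (intro compact_attains_inf)
  then obtain t where t: "t \<in> ?S" "\<And>s. s \<in> ?S \<Longrightarrow> t \<le> s"
    by blast
  \<comment> \<open>t is the first time on the sphere: an earlier position beyond it would give an
    earlier crossing, by the intermediate value theorem.\<close>
  have before: "dist (X s \<omega>) y \<le> l" if "0 \<le> s" "s \<le> t" for s
  proof (rule ccontr)
    assume "\<not> dist (X s \<omega>) y \<le> l"
    then have a: "l \<le> dist (X s \<omega>) y" "dist (X s \<omega>) y \<noteq> l" by auto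
    have "continuous_on {0..s} (\<lambda>t. dist (X t \<omega>) y)"
      by (rule continuous_on_subset[OF cont]) auto
    from IVT'[OF _ a(1) that(1) this] obtain u where "0 \<le> u" "u \<le> s" "dist (X u \<omega>) y = l"
      using \<omega>(2) l by auto
    moreover from this a(2) have "u < s" by (cases "u = s") auto
    ultimately show False using t(2)[of u] t(1) that by auto
  qed
  have "open {x. 0 < f x \<and> dist x y < r}"
    by (intro open_Collect_conj open_Collect_less continuous_intros f)
  then obtain e where e: "e > 0" "\<And>s. 0 \<le> s \<Longrightarrow> \<bar>s - t\<bar> < e \<Longrightarrow> X s \<omega> \<in> {x. 0 < f x \<and> dist x y < r}"
    using X_open_near[OF \<omega>(1), of t "{x. 0 < f x \<and> dist x y < r}"] t(1) fpos l by auto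
  have "occ_rate F f (path \<omega>) s \<noteq> 0" if s: "s \<in> {t<..<t + e}" for s
  proof -
    have "path \<omega> u \<in> F" if "u \<in> {0..s}" for u
    proof -
      have "dist (X u \<omega>) y \<le> r"
        using before[of u] e(2)[of u] that s l by (cases "u \<le> t") auto
      then show ?thesis using F(2) that by (auto simp: path_def max_def dist_commute subset_eq)
    qed
    moreover have "0 < f (path \<omega> s)"
      using e(2)[of s] s t(1) by (auto simp: path_def max_def)
    ultimately show ?thesis
      using s t(1) by (subst occ_rate_continuous[OF continuous_path[OF \<omega>(1)] F(1) f]) (auto simp: ennreal_eq_0_iff)
  qed
  moreover have "AE s in lborel. occ_rate F f (path \<omega>) s = 0"
    using \<omega>(3) measurable_occ_rate1[OF \<open>F \<in> sets borel\<close> fm] unfolding occ_def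
    by (subst (asm) nn_integral_0_iff_AE) auto
  ultimately have "AE s in lborel. s \<notin> {t<..<t + e}"
    by (auto elim!: eventually_mono)
  then have "emeasure lborel {t<..<t + e} = 0"
    by (subst (asm) AE_iff_measurable[of "{t<..<t + e}"]) auto
  then show False using e(1) by simp
qed

end

section \<open>Hitting probabilities\<close>

context harnack_diffusion
begin

text \<open>For points \<open>x\<^sub>1\<close>, \<open>x\<^sub>2\<close> of the sphere that are far apart, move the pole of the Green function
  from \<open>y\<close> to \<open>x\<^sub>1\<close>, then the argument from \<open>y\<close> to \<open>x\<^sub>2\<close>, and come back with the roles of the
  points exchanged: annuli need not be connected, so there is no direct Harnack chain.\<close>

lemma sphere_harnack:
  assumes r: "0 < r" and F: "F = cball y (3 * r)"
    and fin: "\<And>f z. continuous_on UNIV f \<Longrightarrow> (\<And>x. f x \<le> 1) \<Longrightarrow> green F f z < \<infinity>"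
    and f: "continuous_on UNIV f" "\<And>x. 0 \<le> f x" "\<And>x. f x \<le> 1" "\<And>x. x \<notin> ball y (r / 25) \<Longrightarrow> f x = 0"
    and ffin: "(\<integral>\<^sup>+z. ennreal (f z) \<partial>\<mu>) < \<infinity>"
    and x: "dist x1 y = r" "dist x2 y = r"
  shows "green F f x1 \<le> ennreal H ^ 32 * green F f x2"
proof -
  have cF: "closed F" by (simp add: F)
  have inF: "ball c \<rho> \<subseteq> F" if "dist c y + \<rho> \<le> 3 * r" for c \<rho>
  proof
    fix x assume "x \<in> ball c \<rho>"
    then show "x \<in> F" using that dist_triangle[of y x c] by (auto simp: F dist_commute)
  qed
  have zero: "g x = 0" if "\<And>x. x \<notin> ball b (r / 25) \<Longrightarrow> g x = 0" "x \<in> ball a \<rho>" "\<rho> + r / 25 \<le> dist a b"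
    for g :: "'a \<Rightarrow> real" and a b x \<rho>
  proof (rule that(1))
    show "x \<notin> ball b (r / 25)"
      using that(2,3) dist_triangle[of a b x] by (auto simp: dist_commute)
  qed
  \<comment> \<open>Length of a Harnack step. The doubled ball has radius 4 r/25, and together with
    the support radius r/25 this makes r/5, the separation of pole and argument asked for below.
    Thirteen steps cover 26 r/25, more than the distance r between y and the sphere.\<close>
  let ?s = "2 * r / 25"
  show ?thesis
  proof (cases "dist x1 x2 < 2 / 5 * r")
    \<comment> \<open>One Harnack ball suffices: its double has radius 4 r/5, and 4/5 + 1/25 < 1
      keeps it off the support of f. The other factors only raise the exponent to 32.\<close>
    case True
    have "green F f x1 \<le> ennreal H * green F f x2"
    proof (rule green_harnack[OF cF f(1)])
      show "ball x1 (2 * (2 / 5 * r)) \<subseteq> F" using r x by (intro inF) auto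
      show "f x = 0" if "x \<in> ball x1 (2 * (2 / 5 * r))" for x
        by (rule zero[OF f(4) that]) (use x r in auto)
    qed (use True r fin f in auto)
    also have "\<dots> \<le> ennreal H ^ 31 * (ennreal H * green F f x2)"
      using mult_right_mono[OF one_le_power[OF ennreal_H(1), of 31], of "ennreal H * green F f x2"] by simp
    also have "\<dots> = ennreal H ^ 32 * green F f x2"
      by (simp flip: mult.assoc power_Suc2)
    finally show ?thesis .
  next
    case far: False
    have "0 < r / 25" using r by simp
    obtain f1 where f1: "continuous_on UNIV f1" "\<And>x. 0 \<le> f1 x" "\<And>x. f1 x \<le> 1" "\<And>x. x \<notin> ball x1 (r / 25) \<Longrightarrow> f1 x = 0"
      "0 < (\<integral>\<^sup>+z. ennreal (f1 z) \<partial>\<mu>)" "(\<integral>\<^sup>+z. ennreal (f1 z) \<partial>\<mu>) < \<infinity>"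
      by (rule exists_bump[OF \<open>0 < r / 25\<close>, of x1]) blast
    obtain f2 where f2: "continuous_on UNIV f2" "\<And>x. 0 \<le> f2 x" "\<And>x. f2 x \<le> 1" "\<And>x. x \<notin> ball x2 (r / 25) \<Longrightarrow> f2 x = 0"
      "0 < (\<integral>\<^sup>+z. ennreal (f2 z) \<partial>\<mu>)" "(\<integral>\<^sup>+z. ennreal (f2 z) \<partial>\<mu>) < \<infinity>"
      by (rule exists_bump[OF \<open>0 < r / 25\<close>, of x2]) blast
    have swap: "(\<integral>\<^sup>+z. ennreal (g z) \<partial>\<mu>) * green F h a \<le> ennreal H ^ 2 * ((\<integral>\<^sup>+z. ennreal (h z) \<partial>\<mu>) * green F g b)"
      if g: "continuous_on UNIV g" "\<And>x. 0 \<le> g x" "\<And>x. g x \<le> 1" "\<And>x. x \<notin> ball a (r / 25) \<Longrightarrow> g x = 0"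
      and h: "continuous_on UNIV h" "\<And>x. 0 \<le> h x" "\<And>x. h x \<le> 1" "\<And>x. x \<notin> ball b (r / 25) \<Longrightarrow> h x = 0"
        "(\<integral>\<^sup>+z. ennreal (h z) \<partial>\<mu>) < \<infinity>"
      and ab: "r / 5 \<le> dist a b" "dist a y \<le> r" "dist b y \<le> r" for g h a b
    proof (rule green_swap[OF cF _ g(1-3) _ h(1-3) _ fin[OF g(1,3)] fin[OF h(1,3)] h(5)])
      show "0 < ?s" using r by simp
      show "g x = 0" if "x \<notin> ball a ?s" for x using that r by (intro g) auto
      show "h x = 0" if "x \<notin> ball b ?s" for x using that r by (intro h) auto
      show "ball a (2 * ?s) \<subseteq> F" "ball b (2 * ?s) \<subseteq> F" using ab r by (auto intro!: inF)
      show "h x = 0" if "x \<in> ball a (2 * ?s)" for x by (rule zero[OF h(4) that]) (use ab r in auto)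
      show "g x = 0" if "x \<in> ball b (2 * ?s)" for x
        by (rule zero[OF g(4) that]) (use ab r in \<open>auto simp: dist_commute\<close>)
    qed
    have along: "ball c (2 * ?s) \<subseteq> F \<and> (\<forall>x\<in>ball c (2 * ?s). g x = 0)"
      if g: "\<And>x. x \<notin> ball a (r / 25) \<Longrightarrow> g x = 0"
      and ab: "2 / 5 * r \<le> dist a b" "dist a y = r" "dist b y = r"
      and c: "dist y c + dist c b = dist y b" for g :: "'a \<Rightarrow> real" and a b c
    proof -
      \<comment> \<open>Add dist a b \<le> dist a c + dist c b and dist a y \<le> dist a c + dist c
        y. As dist y c + dist c b = r, this gives 2 r/5 + r \<le> 2 dist a c + r.\<close>
      have "r / 5 \<le> dist c a"
        using c ab dist_triangle[of a b c] dist_triangle[of a y c] by (simp add: dist_commute)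
      moreover have "dist c y \<le> r" 
        using c ab(3) zero_le_dist[of c b] dist_commute[of y c] dist_commute[of b y] by linarith
      ultimately show ?thesis
        using r by (auto intro!: inF zero[OF g] simp del: mem_ball)
    qed
    have chain: "green F g y \<le> ennreal H ^ 13 * green F g b" "green F g b \<le> ennreal H ^ 13 * green F g y"
      if g: "continuous_on UNIV g" "\<And>x. g x \<le> 1" "\<And>x. x \<notin> ball a (r / 25) \<Longrightarrow> g x = 0"
      and ab: "2 / 5 * r \<le> dist a b" "dist a y = r" "dist b y = r" for g a b
    proof -
      have d: "0 < ?s" "dist y b < real 13 * ?s" "dist b y < real 13 * ?s"
        using r ab by (auto simp: dist_commute)
      show "green F g y \<le> ennreal H ^ 13 * green F g b"
        by (rule green_chain[OF cF g(1) d(1) fin[OF g(1,2)] along[OF g(3) ab] d(2)])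
      show "green F g b \<le> ennreal H ^ 13 * green F g y"
        by (rule green_chain[OF cF g(1) d(1) fin[OF g(1,2)] along[OF g(3) ab] d(3)])
          (auto simp: dist_commute add.commute)
    qed
    let ?I1 = "\<integral>\<^sup>+z. ennreal (f1 z) \<partial>\<mu>" and ?I2 = "\<integral>\<^sup>+z. ennreal (f2 z) \<partial>\<mu>" and ?I = "\<integral>\<^sup>+z. ennreal (f z) \<partial>\<mu>"
    let ?h = "ennreal H"
    have pw: "?h ^ 32 = ?h ^ 2 * ?h ^ 13 * ?h ^ 2 * ?h ^ 13 * ?h ^ 2"
      "?h ^ 30 = ?h ^ 2 * ?h ^ 13 * ?h ^ 2 * ?h ^ 13" "?h ^ 17 = ?h ^ 2 * ?h ^ 13 * ?h ^ 2" "?h ^ 15 = ?h ^ 2 * ?h ^ 13"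
      by (simp_all flip: power_add)
    \<comment> \<open>Three swaps at H^2 and two chains at H^13 make H^32. The masses of the two
      auxiliary bumps end up on both sides and cancel.\<close>
    have "?I1 * ?I2 * green F f x1 = ?I2 * (?I1 * green F f x1)" by (simp add: ac_simps)
    also have "\<dots> \<le> ?I2 * (?h ^ 2 * (?I * green F f1 y))"
      by (intro mult_left_mono swap[OF f1(1-4) f ffin]) (use x r in auto)
    also have "\<dots> \<le> ?I2 * (?h ^ 2 * (?I * (?h ^ 13 * green F f1 x2)))"
      by (intro mult_left_mono chain[OF f1(1,3,4)]) (use x far in auto)
    also have "\<dots> = ?h ^ 15 * ?I * (?I2 * green F f1 x2)"
      unfolding pw by (simp only: ac_simps)
    also have "\<dots> \<le> ?h ^ 15 * ?I * (?h ^ 2 * (?I1 * green F f2 x1))"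
      by (intro mult_left_mono swap[OF f2(1-4) f1(1-4,6)]) (use x r far in \<open>auto simp: dist_commute\<close>)
    also have "\<dots> = ?h ^ 17 * ?I * (?I1 * green F f2 x1)"
      unfolding pw by (simp only: ac_simps)
    also have "\<dots> \<le> ?h ^ 17 * ?I * (?I1 * (?h ^ 13 * green F f2 y))"
      by (intro mult_left_mono chain(2)[OF f2(1,3,4)]) (use x far in \<open>auto simp: dist_commute\<close>)
    also have "\<dots> = ?h ^ 30 * ?I1 * (?I * green F f2 y)"
      unfolding pw by (simp only: ac_simps)
    also have "\<dots> \<le> ?h ^ 30 * ?I1 * (?h ^ 2 * (?I2 * green F f x2))"
      by (intro mult_left_mono swap[OF f f2(1-4,6)]) (use x r in \<open>auto simp: dist_commute\<close>)
    also have "\<dots> = ?I1 * ?I2 * (?h ^ 32 * green F f x2)"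
      unfolding pw by (simp only: ac_simps)
    finally have "?I1 * ?I2 * green F f x1 \<le> ?I1 * ?I2 * (?h ^ 32 * green F f x2)" .
    moreover have "?I1 * ?I2 \<noteq> 0" "?I1 * ?I2 \<noteq> top"
      using f1(5,6) f2(5,6) by (auto simp: ennreal_mult_eq_top_iff)
    ultimately show ?thesis by (simp add: ennreal_mult_le_mult_iff)
  qed
qed

text \<open>Let m be the supremum of G f over the sphere. Then m \<le> H^45 G f x, by comparison on
  the sphere and a chain from the sphere to x, and G f x is at most m times the probability in
  question. It remains to divide by m.\<close>

lemma hit_probability:
  assumes r: "0 < r" and c: "\<And>z. z \<in> cball y (3 * r) \<Longrightarrow> mean_exit_time P X z (7 * r) < \<infinity>"
    and x: "r \<le> dist x y" "dist x y \<le> 2 * r"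
  shows "1 \<le> ennreal H ^ 45 *
    emeasure (P x) {\<omega>\<in>space N. hitting_time X (ball y r) \<omega> < hitting_time X (- cball y (3 * r)) \<omega>}"
    (is "1 \<le> _ * ?p")
proof -
  define F where "F = cball y (3 * r)"
  have cF: "closed F" by (simp add: F_def)
  \<comment> \<open>F has diameter at most 6 r, so a ball of radius 7 r about any of its points
    contains it. This is the origin of 7 r in the hypothesis.\<close>
  have sub: "F \<subseteq> ball z (7 * r)" if "z \<in> F" for z
  proof
    fix w assume "w \<in> F"
    then show "w \<in> ball z (7 * r)"
      using that r dist_triangle[of z w y] by (auto simp: F_def dist_commute)
  qed
  have fin: "green F f z < \<infinity>" if "continuous_on UNIV f" "\<And>x. f x \<le> 1" for f z
  proof (cases "z \<in> F")
    case True
    then show ?thesis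
      using green_le_mean_exit[OF cF sub that] c[of z] by (auto simp: F_def intro: le_less_trans)
  qed (simp add: green_outside[OF cF that(1)])
  have "0 < r / 25" using r by simp
  obtain f where f: "continuous_on UNIV f" "\<And>x. 0 \<le> f x" "\<And>x. f x \<le> 1" "\<And>x. x \<notin> ball y (r / 25) \<Longrightarrow> f x = 0"
    "(\<integral>\<^sup>+z. ennreal (f z) \<partial>\<mu>) < \<infinity>" "\<exists>U. open U \<and> y \<in> U \<and> (\<forall>x\<in>U. 0 < f x)"
    by (rule exists_bump[OF \<open>0 < r / 25\<close>, of y]) blast
  have f0: "f z = 0" if "z \<notin> ball y r" for z using that r by (intro f(4)) auto
  define m where "m = (SUP z\<in>{z. dist z y = r}. green F f z)"
  have hit: "green F f z \<le> m * emeasure (P z) {\<omega>\<in>space N. hitting_time X (ball y r) \<omega> < hitting_time X (- F) \<omega>}"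
    if z: "z \<notin> ball y r" for z
  proof (rule green_hit_le[OF open_ball _ cF f(1) f0 z])
    have "closure (ball y r) \<subseteq> cball y r" by (rule closure_minimal) auto
    also have "\<dots> \<subseteq> ball y (3 * r)" using r by auto
    also have "\<dots> \<subseteq> interior F" by (rule interior_maximal) (auto simp: F_def)
    finally show "closure (ball y r) \<subseteq> interior F" .
    fix w assume "w \<in> closure (ball y r)" "w \<notin> ball y r"
    then have "dist w y = r"
      using closure_minimal[of "ball y r" "cball y r"] by (force simp: dist_commute)
    then show "green F f w \<le> m" unfolding m_def by (intro SUP_upper) simp
  qed
  \<comment> \<open>Here a geodesic from y to x meets the sphere. All points between x' and x have
    distance between r and 2 r from y, so the Harnack balls about them stay in F and miss the
    support of f.\<close>
  obtain x' where x': "dist y x' = r" "dist x' x = dist y x - r"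
    using between[of r y x] r x by (auto simp: dist_commute)
  have chain: "green F f x' \<le> ennreal H ^ 13 * green F f x"
  proof (rule green_chain[OF cF f(1) _ fin[OF f(1,3)]])
    show "0 < 2 * r / 25" "dist x' x < real 13 * (2 * r / 25)"
      using r x x' by (auto simp: dist_commute)
    fix e assume e: "dist x' e + dist e x = dist x' x"
    have d: "r \<le> dist e y" "dist e y \<le> 2 * r"
      using e x x' dist_triangle[of y x e] dist_triangle[of e y x'] zero_le_dist[of e x] zero_le_dist[of x' e]
        dist_commute[of x y] dist_commute[of y e] dist_commute[of x' e] dist_commute[of x' y]
      by linarith+
    have "w \<in> F \<and> f w = 0" if w: "w \<in> ball e (2 * (2 * r / 25))" for w
    proof
      show "w \<in> F" using w d r dist_triangle[of y w e] by (auto simp: F_def dist_commute)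
      show "f w = 0" using w d r dist_triangle[of e y w] by (intro f(4)) (auto simp: dist_commute)
    qed
    then show "ball e (2 * (2 * r / 25)) \<subseteq> F \<and> (\<forall>w\<in>ball e (2 * (2 * r / 25)). f w = 0)" by blast
  qed
  have "m \<le> ennreal H ^ 32 * green F f x'"
    unfolding m_def
  proof (rule SUP_least)
    fix z assume "z \<in> {z. dist z y = r}"
    then show "green F f z \<le> ennreal H ^ 32 * green F f x'"
      using x' by (intro sphere_harnack[OF r F_def fin f(1-5)]) (auto simp: dist_commute)
  qed
  also have "\<dots> \<le> ennreal H ^ 32 * (ennreal H ^ 13 * green F f x)"
    by (intro mult_left_mono chain) simp
  also have "\<dots> = ennreal H ^ 45 * green F f x"
    by (simp flip: mult.assoc power_add)
  also have "\<dots> \<le> ennreal H ^ 45 * (m * ?p)"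
    using hit[of x] x by (intro mult_left_mono) (auto simp: F_def dist_commute)
  finally have m_le: "m * 1 \<le> m * (ennreal H ^ 45 * ?p)" by (simp add: ac_simps)
  have "m \<noteq> top"
  proof -
    have "m \<le> ennreal H ^ 32 * green F f x'" by fact
    also have "\<dots> < top"
      using fin[OF f(1,3), of x'] by (simp add: ennreal_mult_less_top power_less_top_ennreal)
    finally show ?thesis by simp
  qed
  \<comment> \<open>If m = 0, then G f vanishes outside \<open>ball y r\<close>. For a bump g in the
    surrounding shell, \<integral> f G g = \<integral> g G f = 0, although G g > 0 on
    \<open>ball y r\<close> and f > 0 near y. This contradicts full support.\<close>
  moreover have "m \<noteq> 0"
  proof
    assume m0: "m = 0"
    \<comment> \<open>Zero unless the distance from y is between r and 2 r, and positive at 3 r/2;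
      the height is cut to 1 because \<open>green_symmetric\<close> asks for g \<le> 1.\<close>
    define g where "g z = max 0 (min 1 (r / 2) - \<bar>dist z y - 3 / 2 * r\<bar>)" for z
    have g: "continuous_on UNIV g" "\<And>z. g z \<le> 1"
      unfolding g_def by (auto intro!: continuous_intros)
    have gA: "g z = 0" if "z \<in> ball y r" for z
      using that by (auto simp: g_def dist_commute)
    have g_pos: "0 < green F g z" if z: "z \<in> ball y r" for z
    proof (rule green_pos[OF cF _ g(1), of y "3 * r" "3 / 2 * r"])
      show "mean_exit_time P X z (2 * (3 / 2 * r)) < \<infinity>"
      proof (rule le_less_trans[OF _ c])
        show "mean_exit_time P X z (2 * (3 / 2 * r)) \<le> mean_exit_time P X z (7 * r)"
          unfolding mean_exit_time_def exit_time_def using r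
          by (intro nn_integral_mono hitting_time_antimono) auto
        show "z \<in> cball y (3 * r)" using z r by auto
      qed
    qed (use z r in \<open>auto simp: F_def g_def dist_commute\<close>)
    have gf0: "ennreal (g z) * green F f z = 0" for z
      using hit[of z] gA[of z] m0 by (cases "z \<in> ball y r") (auto simp: F_def)
    have "(\<integral>\<^sup>+z. ennreal (g z) * green F f z \<partial>\<mu>) = 0"
      by (simp only: gf0 nn_integral_const mult_zero_left)
    then have int0: "(\<integral>\<^sup>+z. ennreal (f z) * green F g z \<partial>\<mu>) = 0"
      using green_symmetric[OF cF g f(1,3) f(5)] by simp
    have [measurable]: "F \<in> sets borel" using cF by auto
    have [measurable]: "f \<in> borel_measurable borel" "g \<in> borel_measurable borel"
      by (intro borel_measurable_continuous_onI f g)+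
    have [measurable]: "green F g \<in> borel_measurable borel"
      by (intro measurable_green) measurable
    have AE0: "AE z in \<mu>. ennreal (f z) * green F g z = 0"
      using int0 by (subst (asm) nn_integral_0_iff_AE) auto
    obtain U where U: "open U" "y \<in> U" "\<And>z. z \<in> U \<Longrightarrow> 0 < f z" using f(6) by blast
    have "AE z in \<mu>. z \<notin> U"
      using AE0
    proof eventually_elim
      fix z assume z: "ennreal (f z) * green F g z = 0"
      show "z \<notin> U"
      proof
        assume "z \<in> U"
        then have "0 < f z" by (rule U)
        moreover from this have "z \<in> ball y r" using f0[of z] by (cases "z \<in> ball y r") auto
        ultimately show False using z g_pos[of z] by (auto simp: ennreal_eq_0_iff)
      qed
    qed
    then have "emeasure \<mu> U = 0"
      using U(1) by (subst (asm) AE_iff_measurable[of U]) (auto simp: sets_eq_imp_space_eq[OF sets_mu])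
    then show False using full_support U unfolding full_support_def by fastforce
  qed
  ultimately show ?thesis
    using m_le by (subst (asm) ennreal_mult_le_mult_iff) auto
qed

text \<open>The ball is hit before \<open>cball y (3 * r)\<close> is left with probability at least
  1/H^45. By Markov's inequality the path stays in \<open>cball y (3 * r)\<close> until t with at
  most half that probability, and the other half remains for a hit before t. A start inside the ball
  is separate: there continuity makes the hit immediate.\<close>

lemma hit_in_time:
  assumes r: "0 < r" and t: "0 < t"
    and c: "\<And>z. z \<in> cball y (3 * r) \<Longrightarrow> mean_exit_time P X z (7 * r) \<le> ennreal (t / (2 * H ^ 45))"
    and x: "dist x y \<le> 2 * r"
  shows "ennreal (1 / (2 * H ^ 45)) \<le> emeasure (P x) {\<omega>\<in>space N. hitting_time X (ball y r) \<omega> < ennreal t}"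
proof -
  interpret prob_space "P x" by (rule prob_space_P)
  let ?T = "hitting_time X (ball y r)" and ?S = "hitting_time X (- cball y (3 * r))"
  have T: "stopping_time \<R> ?T" and S: "stopping_time \<R> ?S"
    by (intro stopping_time_hitting_open; simp add: open_Compl)+
  note [measurable] = measurable_stopping_time_N[OF T] measurable_stopping_time_N[OF S]
  have Hp: "1 \<le> H ^ 45" using H1 by (rule one_le_power)
  show ?thesis
  proof (cases "dist x y < r")
    case True
    have "AE \<omega> in P x. ?T \<omega> < ennreal t"
      using AE_X_0[of x] AE_space
    proof eventually_elim
      fix \<omega> assume \<omega>: "X 0 \<omega> = x" "\<omega> \<in> space (P x)"
      then obtain e where e: "e > 0" "\<And>s. 0 \<le> s \<Longrightarrow> \<bar>s - 0\<bar> < e \<Longrightarrow> X s \<omega> \<in> ball y r"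
        using X_open_near[of \<omega> 0 "ball y r"] True by (auto simp: dist_commute)
      define s where "s = min t e / 2"
      have "0 < s" "s < t" "s < e" using t e(1) by (auto simp: s_def)
      then show "?T \<omega> < ennreal t"
        using e(2)[of s] t by (auto simp: hitting_time_less_iff ennreal_less_iff intro!: exI[of _ s])
    qed
    then have "emeasure (P x) {\<omega>\<in>space N. ?T \<omega> < ennreal t} = 1"
      by (intro emeasure_eq_1_AE) auto
    moreover have "1 / (2 * H ^ 45) \<le> 1"
      by (subst divide_le_eq_1_pos) (use Hp in linarith)+
    ultimately show ?thesis by (simp add: ennreal_le_1)
  next
    case False
    have xin: "x \<in> cball y (3 * r)" using x r by (auto simp: dist_commute)
    have exit_le: "?S \<omega> \<le> exit_time X (ball x (7 * r)) \<omega>" for \<omega>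
      unfolding exit_time_def
    proof (rule hitting_time_antimono)
      show "- ball x (7 * r) \<subseteq> - cball y (3 * r)"
      proof (rule Compl_anti_mono, rule)
        fix w assume "w \<in> cball y (3 * r)"
        then show "w \<in> ball x (7 * r)"
          using xin r dist_triangle[of x w y] by (auto simp: dist_commute)
      qed
    qed
    let ?A = "{\<omega>\<in>space N. ?T \<omega> < ennreal t}" and ?B = "{\<omega>\<in>space N. ennreal t \<le> ?S \<omega>}"
    have "ennreal t * emeasure (P x) ?B = (\<integral>\<^sup>+\<omega>. ennreal t * indicator ?B \<omega> \<partial>P x)"
      by (subst nn_integral_cmult_indicator) auto
    also have "\<dots> \<le> mean_exit_time P X x (7 * r)"
      unfolding mean_exit_time_def
      by (intro nn_integral_mono) (auto simp: indicator_def intro: order_trans[OF _ exit_le])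
    also have "\<dots> \<le> ennreal (t / (2 * H ^ 45))" by (rule c[OF xin])
    also have "\<dots> = ennreal t * ennreal (1 / (2 * H ^ 45))"
      using t H1 by (subst ennreal_mult[symmetric]) auto
    finally have B: "emeasure (P x) ?B \<le> ennreal (1 / (2 * H ^ 45))"
      using t by (simp add: ennreal_mult_le_mult_iff)
    have "1 \<le> ennreal H ^ 45 * emeasure (P x) {\<omega>\<in>space N. ?T \<omega> < ?S \<omega>}"
    proof (rule hit_probability[OF r])
      show "mean_exit_time P X z (7 * r) < \<infinity>" if "z \<in> cball y (3 * r)" for z
        using c[OF that] by (rule le_less_trans) simp
    qed (use False x in auto)
    also have "emeasure (P x) {\<omega>\<in>space N. ?T \<omega> < ?S \<omega>} \<le> emeasure (P x) (?A \<union> ?B)"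
      by (intro emeasure_mono) (auto simp: not_less)
    also have "\<dots> \<le> emeasure (P x) ?A + emeasure (P x) ?B"
      by (intro emeasure_subadditive) auto
    also have "\<dots> \<le> emeasure (P x) ?A + ennreal (1 / (2 * H ^ 45))"
      by (intro add_left_mono B)
    finally have "1 \<le> ennreal H ^ 45 * (emeasure (P x) ?A + ennreal (1 / (2 * H ^ 45)))"
      by (simp add: mult_left_mono)
    then have "1 \<le> H ^ 45 * (prob ?A + 1 / (2 * H ^ 45))"
      using H1 unfolding emeasure_eq_measure
      by (simp add: ennreal_power flip: ennreal_plus ennreal_mult'' ennreal_1)
    also have "\<dots> = H ^ 45 * prob ?A + 1 / 2" using H1 by (simp add: field_simps)
    finally have "1 / (2 * H ^ 45) \<le> prob ?A" using H1 by (simp add: field_simps)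
    then show ?thesis unfolding emeasure_eq_measure by (simp add: ennreal_leI)
  qed
qed

end

section \<open>Chaining hits along a sequence of balls\<close>

context markov_diffusion
begin

text \<open>Strong Markov property at the hit of the first ball. At that moment the path is only
  known to be in the closure, so starting points range over closed balls although the targets are
  open.\<close>

lemma hit_chain:
  assumes t: "0 < t"
  shows "(\<And>i x. i \<le> m \<Longrightarrow> x \<in> cball (z i) r \<Longrightarrow>
      \<eta> \<le> emeasure (P x) {\<omega>\<in>space N. hitting_time X (ball (z (Suc i)) r) \<omega> < ennreal t}) \<Longrightarrow>
    x \<in> cball (z 0) r \<Longrightarrow>
    \<eta> ^ Suc m \<le> emeasure (P x) {\<omega>\<in>space N. hitting_time X (ball (z (Suc m)) r) \<omega> < ennreal (real (Suc m) * t)}"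
proof (induction m arbitrary: z x)
  case 0
  then show ?case by simp
next
  case (Suc m)
  let ?T = "hitting_time X (ball (z (Suc 0)) r)" and ?U = "ball (z (Suc (Suc m))) r"
  have T: "stopping_time \<R> ?T" by (intro stopping_time_hitting_open) simp
  have TU: "stopping_time \<R> (hitting_time X ?U)" by (intro stopping_time_hitting_open) simp
  note [measurable] = measurable_stopping_time_N[OF T] measurable_stopping_time_N[OF TU]
  let ?A = "{\<omega>\<in>space N. ?T \<omega> < ennreal t}"
  have A: "?A \<in> sets (right.pre_sigma ?T)"
    using measurable_sets[OF right.measurable_stopping_time_pre_sigma[OF T], of "{..<ennreal t}"]
    by (simp add: right.space_pre_sigma vimage_def Int_def conj_commute)
  have A': "{\<omega>\<in>?A. ?T \<omega> < \<infinity>} = ?A" by (auto intro: less_trans)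
  \<comment> \<open>The hitting event as a set of paths. Since the ball is open, rational times are
    enough for continuous paths, and they make the set measurable in \<open>PS\<close>.\<close>
  define f :: "(real \<Rightarrow> 'a) \<Rightarrow> ennreal" where
    "f w = indicator {w. \<exists>q\<in>{q\<in>\<rat>. 0 < q \<and> ennreal q < ennreal (real (Suc m) * t)}. w q \<in> ?U} w" for w
  have "(\<lambda>w :: real \<Rightarrow> 'a. w q) \<in> PS \<rightarrow>\<^sub>M borel" for q
    by (rule measurable_component_singleton) simp
  then have "Measurable.pred PS (\<lambda>w. \<exists>q\<in>{q\<in>\<rat>. 0 < q \<and> ennreal q < ennreal (real (Suc m) * t)}. w q \<in> ?U)"
    by (intro measurable_pred_countable countable_Collect countable_rat pred_sets2[of ?U borel]) auto
  then have f: "f \<in> borel_measurable PS"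
    unfolding f_def[abs_def] by (intro borel_measurable_indicator) (simp add: pred_def space_PiM)
  have f_path: "(\<integral>\<^sup>+\<omega>. f (path \<omega>) \<partial>P v) = emeasure (P v) {\<omega>\<in>space N. hitting_time X ?U \<omega> < ennreal (real (Suc m) * t)}" for v
  proof -
    have eq: "f (path \<omega>) = indicator {\<omega>\<in>space N. hitting_time X ?U \<omega> < ennreal (real (Suc m) * t)} \<omega>"
      if "\<omega> \<in> space N" for \<omega>
    proof -
      have "hitting_time X ?U \<omega> < ennreal (real (Suc m) * t) \<longleftrightarrow>
          (\<exists>q\<in>{q\<in>\<rat>. 0 < q \<and> ennreal q < ennreal (real (Suc m) * t)}. path \<omega> q \<in> ?U)"
        unfolding hitting_time_open_less_iff[OF open_ball that] path_def by (intro iffI; elim bexE; force simp only: mem_Collect_eq max_absorb2 less_imp_le)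
      then show ?thesis using that unfolding f_def indicator_def by (simp only: mem_Collect_eq simp_thms)
    qed
    have "(\<integral>\<^sup>+\<omega>. f (path \<omega>) \<partial>P v) = (\<integral>\<^sup>+\<omega>. indicator {\<omega>\<in>space N. hitting_time X ?U \<omega> < ennreal (real (Suc m) * t)} \<omega> \<partial>P v)"
      by (intro nn_integral_cong eq) simp
    also have "\<dots> = emeasure (P v) {\<omega>\<in>space N. hitting_time X ?U \<omega> < ennreal (real (Suc m) * t)}"
      by (rule nn_integral_indicator) measurable
    finally show ?thesis .
  qed
  have step: "\<eta> ^ Suc m \<le> (\<integral>\<^sup>+\<omega>. f (path \<omega>) \<partial>P v)" if "v \<in> cball (z (Suc 0)) r" for v
    unfolding f_path using Suc.IH[of "\<lambda>i. z (Suc i)" v] Suc.prems(1)[of "Suc _"] that by simp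
  have sh: "hitting_time X ?U \<omega> < ennreal (real (Suc (Suc m)) * t)"
    if \<omega>: "\<omega> \<in> ?A" "f (shifted_path ?T \<omega>) \<noteq> 0" for \<omega>
  proof -
    define \<tau> where "\<tau> = enn2real (?T \<omega>)"
    have "?T \<omega> < top" using \<omega>(1) by (auto intro: less_trans)
    then have \<tau>: "0 \<le> \<tau>" "?T \<omega> = ennreal \<tau>" by (auto simp: \<tau>_def)
    have "\<tau> < t" using \<omega>(1) \<tau> t by (auto simp: ennreal_less_iff)
    obtain q where q: "0 < q" "q < real (Suc m) * t" "X (\<tau> + q) \<omega> \<in> ?U"
      using \<omega>(2) t by (auto simp: f_def indicator_def shifted_path_def \<tau>_def ennreal_less_iff max_def split: if_splits)
    have "\<tau> + q < real (Suc (Suc m)) * t" using q \<open>\<tau> < t\<close> by (simp add: algebra_simps)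
    then show ?thesis
      using q \<tau> by (auto simp: hitting_time_less_iff intro!: exI[of _ "\<tau> + q"] ennreal_lessI)
  qed
  have "\<eta> ^ Suc (Suc m) \<le> \<eta> ^ Suc m * emeasure (P x) ?A"
    unfolding power_Suc2[of \<eta> "Suc m"]
    using Suc.prems(1)[of 0 x] Suc.prems(2) by (intro mult_left_mono) simp_all
  also have "\<dots> = (\<integral>\<^sup>+\<omega>. \<eta> ^ Suc m * indicator ?A \<omega> \<partial>P x)"
    by (rule nn_integral_cmult_indicator[symmetric]) simp
  also have "\<dots> \<le> (\<integral>\<^sup>+\<omega>\<in>?A. (\<integral>\<^sup>+\<omega>'. f (path \<omega>') \<partial>P (X (enn2real (?T \<omega>)) \<omega>)) \<partial>P x)"
  proof (rule nn_integral_mono)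
    fix \<omega> assume "\<omega> \<in> space (P x)"
    show "\<eta> ^ Suc m * indicator ?A \<omega> \<le> (\<integral>\<^sup>+\<omega>'. f (path \<omega>') \<partial>P (X (enn2real (?T \<omega>)) \<omega>)) * indicator ?A \<omega>"
    proof (cases "\<omega> \<in> ?A")
      case True
      then have "X (enn2real (?T \<omega>)) \<omega> \<in> closure (ball (z (Suc 0)) r)"
        by (intro hit_closure) (auto intro: less_trans)
      also have "\<dots> \<subseteq> cball (z (Suc 0)) r" by (rule closure_minimal) auto
      finally show ?thesis using True step by simp
    qed simp
  qed
  also have "\<dots> = (\<integral>\<^sup>+\<omega>\<in>?A. f (shifted_path ?T \<omega>) \<partial>P x)"
    using strong_markov_path[OF T A f, of x] unfolding A' by simp
  also have "\<dots> \<le> (\<integral>\<^sup>+\<omega>. indicator {\<omega>\<in>space N. hitting_time X ?U \<omega> < ennreal (real (Suc (Suc m)) * t)} \<omega> \<partial>P x)"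
  proof (intro nn_integral_mono)
    fix \<omega>
    have "f (shifted_path ?T \<omega>) \<le> 1" by (simp add: f_def indicator_def)
    then show "f (shifted_path ?T \<omega>) * indicator ?A \<omega>
        \<le> indicator {\<omega>\<in>space N. hitting_time X ?U \<omega> < ennreal (real (Suc (Suc m)) * t)} \<omega>"
      using sh[of \<omega>] by (cases "\<omega> \<in> ?A \<and> f (shifted_path ?T \<omega>) \<noteq> 0") (auto simp: indicator_def)
  qed
  also have "\<dots> = emeasure (P x) {\<omega>\<in>space N. hitting_time X ?U \<omega> < ennreal (real (Suc (Suc m)) * t)}"
    by simp
  finally show ?case .
qed

end

section \<open>Choice of the constants\<close>

lemma nu_set_finiteE:
  assumes "nu_set P X q A t R \<noteq> \<infinity>"
  obtains n where "nu_set P X q A t R = enat n" "1 \<le> n"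
    "ennreal q * (SUP z\<in>A. mean_exit_time P X z (R / real n)) \<le> ennreal (t / real n)"
proof -
  let ?S = "{n::nat. 1 \<le> n \<and> ennreal q * (SUP z\<in>A. mean_exit_time P X z (R / real n)) \<le> ennreal (t / real n)}"
  have "enat ` ?S \<noteq> {}"
  proof
    assume "enat ` ?S = {}"
    then have "nu_set P X q A t R = Inf {}" unfolding nu_set_def by (simp only:)
    then show False using assms by (simp add: top_enat_def)
  qed
  then have "nu_set P X q A t R \<in> enat ` ?S"
    unfolding nu_set_def by (rule wellorder_InfI[OF some_in_eq[THEN iffD2]])
  then show ?thesis using that by auto
qed

theorem proposition4p3:
  fixes \<mu> :: "'a::{metric_space, second_countable_topology} measure"
    and \<F> :: "('a \<Rightarrow> real) set"
    and \<E> :: "('a \<Rightarrow> real) \<Rightarrow> ('a \<Rightarrow> real) \<Rightarrow> real"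
    and N :: "'w measure"
    and P :: "'a \<Rightarrow> 'w measure"
    and X :: "real \<Rightarrow> 'w \<Rightarrow> 'a"
    and p :: "real \<Rightarrow> 'a \<Rightarrow> 'a \<Rightarrow> real"
  assumes "locally compact (UNIV :: 'a set)"
    and "geodesic_metric TYPE('a)"
    and "radon_measure \<mu>"
    and "full_support \<mu>"
    and "dirichlet_form \<mu> \<F> \<E>"
    and "regular_form \<mu> \<F> \<E>"
    and "strongly_local \<mu> \<F> \<E>"
    and "diffusion N P X"
    and "feller_process P X"
    and "associated_process \<mu> \<F> \<E> P X"
    and "transition_density \<mu> P X p"
    and "elliptic_harnack P X"
  shows "\<exists>q b C :: real. 0 < q \<and> 0 < b \<and> 0 < C \<and>
           (\<forall>x y t r. 0 < t \<longrightarrow> 0 < r \<longrightarrow> dist x y / 4 \<le> r \<longrightarrow> r < dist x y \<longrightarrow>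
              exp_neg C (nu P X q x t (b * dist x y)) \<le>
              measure (P x) {\<omega> \<in> space N. hitting_time X (ball y r) \<omega> < ennreal t})"
proof -
  obtain H :: real where H: "1 \<le> H" "\<And>x R u. 0 < R \<Longrightarrow> (\<And>z. 0 \<le> u z) \<Longrightarrow> harmonic_in P X (ball x (2 * R)) u \<Longrightarrow>
      (SUP z\<in>ball x R. ennreal (u z)) \<le> ennreal H * (INF z\<in>ball x R. ennreal (u z))"
    using assms(12) unfolding elliptic_harnack_def by blast
  interpret sigma_finite_measure \<mu> by (rule radon_sigma_finite[OF assms(1,3)])
  interpret harnack_diffusion N P X \<mu> p H
  proof
    show "sets \<mu> = sets borel" using assms(3) by (simp add: radon_measure_def)
    show "\<exists>U. open U \<and> x \<in> U \<and> emeasure \<mu> U < \<infinity>" for x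
      using radon_finite_nbhd[OF assms(1,3), of x] by blast
    show "(SUP z\<in>ball x R. ennreal (u z)) \<le> ennreal H * (INF z\<in>ball x R. ennreal (u z))"
      if "0 < R" "\<And>z. 0 \<le> u z" "harmonic_in P X (ball x (2 * R)) u" for x R u
      using that by (rule H(2))
  qed (fact assms H(1))+
  \<comment> \<open>The success probability of one step, from \<open>hit_in_time\<close>.\<close>
  define \<delta> where "\<delta> = 1 / (2 * H ^ 45)"
  have Hp: "1 \<le> H ^ 45" using H(1) by (rule one_le_power)
  have \<delta>: "0 < \<delta>" "\<delta> < 1"
    unfolding \<delta>_def by (intro divide_pos_pos, simp, use Hp in linarith) (subst divide_less_eq_1_pos; use Hp in linarith)
  \<comment> \<open>Makes exp (- C n) equal to \<delta>^(4 n), the cost of 4 n steps.\<close>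
  define C where "C = - 4 * ln \<delta>"
  have C: "0 < C" using \<delta> by (simp add: C_def)
  \<comment> \<open>With steps of duration s = t/(4 n), the exit time bound \<delta> s required by
    \<open>hit_in_time\<close> is (t/n)/q, which is what the definition of \<nu> provides.\<close>
  define q where "q = 4 / \<delta>"
  have q: "0 < q" using \<delta> by (simp add: q_def)
  have "exp_neg C (nu P X q x t (2 * dist x y)) \<le>
      measure (P x) {\<omega> \<in> space N. hitting_time X (ball y r) \<omega> < ennreal t}"
    if t: "0 < t" and r: "0 < r" "dist x y / 4 \<le> r" "r < dist x y" for x y t r
  proof (cases "nu P X q x t (2 * dist x y) = \<infinity>")
    case True
    then show ?thesis by (simp add: exp_neg_def)
  next
    case False
    interpret Px: prob_space "P x" by (rule prob_space_P)
    define d where "d = dist x y"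
    have d: "0 < d" using r(1,3) unfolding d_def by linarith
    obtain n where n: "nu P X q x t (2 * d) = enat n" "1 \<le> n"
      "ennreal q * (SUP z\<in>ball x (2 * d). mean_exit_time P X z (2 * d / real n)) \<le> ennreal (t / real n)"
      using False unfolding nu_def d_def by (rule nu_set_finiteE)
    \<comment> \<open>Four steps for each unit of \<nu>. Then 7 \<rho> \<le> 2 d/n, so \<nu> with b
      = 2 controls the exit times at radius 7 \<rho>, and \<rho> \<le> d/4 \<le> r, so the last ball
      lies in the target. Moreover d + 3 \<rho> < 2 d: all centres that \<open>hit_in_time\<close>
      asks about are in \<open>ball x (2 * d)\<close>.\<close>
    define \<rho> where "\<rho> = d / (4 * n)"
    define s where "s = t / (4 * n)"
    have \<rho>: "0 < \<rho>" "4 * \<rho> \<le> d" "real (4 * n) * \<rho> = d"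
      and s: "0 < s" "real (4 * n) * s = t"
      using d t n(2) by (auto simp: \<rho>_def s_def field_simps)
    have exit: "mean_exit_time P X z (7 * \<rho>) \<le> ennreal (s / (2 * H ^ 45))" if "dist x z < 2 * d" for z
    proof -
      have "mean_exit_time P X z (7 * \<rho>) \<le> mean_exit_time P X z (2 * d / real n)"
        unfolding mean_exit_time_def exit_time_def using d n(2)
        by (intro nn_integral_mono hitting_time_antimono Compl_anti_mono subset_ball) (auto simp: \<rho>_def field_simps)
      also have "\<dots> \<le> (SUP z\<in>ball x (2 * d). mean_exit_time P X z (2 * d / real n))"
        using that by (intro SUP_upper) auto
      finally have "ennreal q * mean_exit_time P X z (7 * \<rho>) \<le> ennreal (t / real n)"
        using n(3) by (meson mult_left_mono order_trans zero_le)
      also have "t / real n = q * (s / (2 * H ^ 45))"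
      proof -
        have "q * (s / (2 * H ^ 45)) = q * \<delta> * s" by (simp add: \<delta>_def)
        also have "\<dots> = 4 * s" using \<delta> by (simp add: q_def)
        finally show ?thesis using n(2) by (simp add: s_def)
      qed
      also have "ennreal (q * (s / (2 * H ^ 45))) = ennreal q * ennreal (s / (2 * H ^ 45))"
        using q s H(1) by (intro ennreal_mult) auto
      finally show ?thesis using q by (simp add: ennreal_mult_le_mult_iff)
    qed
    obtain \<gamma> where \<gamma>: "\<gamma> 0 = x" "\<gamma> d = y"
      "\<And>u v. u \<in> {0..d} \<Longrightarrow> v \<in> {0..d} \<Longrightarrow> dist (\<gamma> u) (\<gamma> v) = \<bar>u - v\<bar>"
      using assms(2) unfolding geodesic_metric_def d_def by blast
    define z where "z i = \<gamma> (real i * \<rho>)" for i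
    \<comment> \<open>\<open>hit_chain\<close> makes m + 1 steps.\<close>
    define m where "m = 4 * n - 1"
    have m: "Suc m = 4 * n" using n(2) by (simp add: m_def)
    have mem: "real i * \<rho> \<in> {0..d}" if "i \<le> Suc m" for i
      using that \<rho> mult_right_mono[of "real i" "real (4 * n)" \<rho>] by (auto simp: m)
    have "ennreal \<delta> ^ Suc m \<le> emeasure (P x) {\<omega>\<in>space N. hitting_time X (ball (z (Suc m)) \<rho>) \<omega> < ennreal (real (Suc m) * s)}"
    proof (rule hit_chain[OF s(1)])
      show "x \<in> cball (z 0) \<rho>" using \<gamma>(1) \<rho>(1) by (simp add: z_def)
      fix i v assume i: "i \<le> m" and v: "v \<in> cball (z i) \<rho>"
      have zz: "dist (z i) (z (Suc i)) = \<rho>"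
        using \<gamma>(3)[OF mem mem, of i "Suc i"] i \<rho>(1) by (simp add: z_def algebra_simps)
      have xz: "dist x (z (Suc i)) \<le> d"
        using \<gamma>(3)[of 0 "real (Suc i) * \<rho>"] mem[of "Suc i"] i d \<gamma>(1) by (auto simp: z_def simp del: of_nat_Suc)
      show "ennreal \<delta> \<le> emeasure (P v) {\<omega>\<in>space N. hitting_time X (ball (z (Suc i)) \<rho>) \<omega> < ennreal s}"
        unfolding \<delta>_def
      proof (rule hit_in_time[OF \<rho>(1) s(1)])
        show "dist v (z (Suc i)) \<le> 2 * \<rho>"
          using zz v dist_triangle[of v "z (Suc i)" "z i"] by (simp add: dist_commute)
        fix w assume "w \<in> cball (z (Suc i)) (3 * \<rho>)"
        then have "dist x w < 2 * d"
          using dist_triangle[of x w "z (Suc i)"] xz \<rho> by simp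
        then show "mean_exit_time P X w (7 * \<rho>) \<le> ennreal (s / (2 * H ^ 45))" by (rule exit)
      qed
    qed
    also have "\<dots> = emeasure (P x) {\<omega>\<in>space N. hitting_time X (ball y \<rho>) \<omega> < ennreal t}"
    proof -
      have "z (Suc m) = y" using \<gamma>(2) \<rho>(3) unfolding z_def m by simp
      then show ?thesis using s(2) by (simp only: m)
    qed
    also have "\<dots> \<le> emeasure (P x) {\<omega>\<in>space N. hitting_time X (ball y r) \<omega> < ennreal t}"
    proof (rule emeasure_mono)
      have "\<rho> \<le> r" using \<rho>(2) r(2) by (simp add: d_def)
      then have "hitting_time X (ball y r) \<omega> \<le> hitting_time X (ball y \<rho>) \<omega>" for \<omega>
        by (intro hitting_time_antimono subset_ball)
      then show "{\<omega>\<in>space N. hitting_time X (ball y \<rho>) \<omega> < ennreal t} \<subseteq> {\<omega>\<in>space N. hitting_time X (ball y r) \<omega> < ennreal t}"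
        by (auto intro: le_less_trans)
      show "{\<omega>\<in>space N. hitting_time X (ball y r) \<omega> < ennreal t} \<in> sets (P x)"
        using measurable_stopping_time_N[OF stopping_time_hitting_open[OF open_ball]] by simp
    qed
    also have "ennreal \<delta> ^ Suc m = ennreal (exp_neg C (nu P X q x t (2 * dist x y)))"
    proof -
      have "exp (- C * real n) = exp (real (4 * n) * ln \<delta>)" by (simp add: C_def)
      also have "\<dots> = \<delta> ^ (4 * n)" using \<delta> by (simp add: exp_of_nat_mult flip: of_nat_mult)
      finally show ?thesis
        using n(1) \<delta> by (simp add: exp_neg_def d_def m ennreal_power)
    qed
    finally show ?thesis by (simp add: Px.emeasure_eq_measure)
  qed
  then show ?thesis
    using q C by (intro exI[of _ q] exI[of _ "2::real"] exI[of _ C]) auto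
qed

end
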